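(* For every $v\in\mathrm{Conv}_{\mathrm{MA}}(\mathbb{R}^n;\mathbb{R})$ the quantity $$\operatorname{Z}(v)=\int_{\mathbb{R}^n}\det(\operatorname{Hess}v(x))^{\frac{1}{n+2}}\,e^{-\frac{n}{n+2}v(x)}\,dx$$ is finite, and $\operatorname{Z}$ is $\tau^*$-upper semicontinuous: $\operatorname{Z}(v)\ge\limsup_{k\to\infty}\operatorname{Z}(v_k)$ for every sequence $v_k\in\mathrm{Conv}_{\mathrm{MA}}(\mathbb{R}^n;\mathbb{R})$ that $\tau^*$-converges to $v\in\mathrm{Conv}_{\mathrm{MA}}(\mathbb{R}^n;\mathbb{R})$.
   Context: For a finite convex $v\colon\mathbb{R}^n\to\mathbb{R}$, $\operatorname{Hess}v(x)$ is its Hessian, which exists for almost every $x$ by Aleksandrov's theorem; $dx$ is Lebesgue measure. The subdifferential is $\partial v(x)=\{y:v(z)\ge v(x)+\langle y,z-x\rangle\ \forall z\}$ and the Monge–Ampère measure is $\mathrm{MA}(v;B)=V_n\big(\bigcup_{x\in B}\partial v(x)\big)$ for Borel $B$, $V_n$ Lebesgue measure. For nonempty compact convex $K\subset\mathbb{R}^{n+1}$, $h_K(z)=\sup_{w\in K}\langle z,w\rangle$. $\mathrm{Conv}_{\mathrm{MA}}(\mathbb{R}^n;\mathbb{R})$ is the set of functions $v=h_K(\cdot,-1)$ on $\mathbb{R}^n$ ($K\subset\mathbb{R}^{n+1}$ nonempty compact convex) with $\operatorname{supp}\mathrm{MA}(v;\cdot)$ compact. $v_k$ $\tau^*$-converges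 to $v$ if $v_k$ epi-converges to $v$ (for all $x_k\to x$, $v(x)\le\liminf_k v_k(x_k)$, and for each $x$ some $x_k\to x$ has $v(x)=\lim_k v_k(x_k)$) and a single compact set contains the supports of $\mathrm{MA}(v;\cdot)$ and of all $\mathrm{MA}(v_k;\cdot)$. *)

theory Defs
  imports "HOL-Analysis.Analysis"
begin

text \<open>Support function of a set K in R^(n+1), the latter modelled as real^'n \<times> real.\<close>
definition support_fun :: "('a::real_inner) set \<Rightarrow> 'a \<Rightarrow> real" where
  "support_fun K z = Sup ((\<lambda>w. inner z w) ` K)"

definition subdiff :: "('a::real_inner \<Rightarrow> real) \<Rightarrow> 'a \<Rightarrow> 'a set" where
  "subdiff v x = {y. \<forall>z. v z \<ge> v x + inner y (z - x)}"

definition MA :: "(real^'n \<Rightarrow> real) \<Rightarrow> (real^'n) set \<Rightarrow> ennreal" where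
  "MA v B = emeasure lebesgue (\<Union>x\<in>B. subdiff v x)"

definition MA_supp :: "(real^'n \<Rightarrow> real) \<Rightarrow> (real^'n) set" where
  "MA_supp v = {x. \<forall>U. open U \<and> x \<in> U \<longrightarrow> MA v U > 0}"

definition ConvMA :: "(real^'n \<Rightarrow> real) set" where
  "ConvMA = {v. (\<exists>K :: ((real^'n) \<times> real) set. K \<noteq> {} \<and> compact K \<and> convex K \<and>
                    v = (\<lambda>x. support_fun K (x, -1))) \<and> compact (MA_supp v)}"

definition has_hessian_at :: "(real^'n \<Rightarrow> real) \<Rightarrow> real^'n^'n \<Rightarrow> real^'n \<Rightarrow> bool" where
  "has_hessian_at v A x \<longleftrightarrow> transpose A = A \<and>
     (\<exists>p. ((\<lambda>y. (v y - v x - inner p (y - x) - (1/2) * inner (y - x) (A *v (y - x)))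
              / (norm (y - x))\<^sup>2) \<longlongrightarrow> 0) (at x))"

text \<open>Hessian (defined a.e. for convex v by Aleksandrov's theorem; 0 elsewhere).\<close>
definition Hess :: "(real^'n \<Rightarrow> real) \<Rightarrow> real^'n \<Rightarrow> real^'n^'n" where
  "Hess v x = (if \<exists>A. has_hessian_at v A x then THE A. has_hessian_at v A x else 0)"

definition Zfun :: "(real^'n \<Rightarrow> real) \<Rightarrow> ennreal" where
  "Zfun v = (\<integral>\<^sup>+ x. ennreal (det (Hess v x) powr (1 / (real CARD('n) + 2))
               * exp (- (real CARD('n) / (real CARD('n) + 2)) * v x)) \<partial>lebesgue)"

definition epi_converges :: "(nat \<Rightarrow> 'a::metric_space \<Rightarrow> real) \<Rightarrow> ('a \<Rightarrow> real) \<Rightarrow> bool" where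
  "epi_converges vs v \<longleftrightarrow>
     (\<forall>x xs. xs \<longlonglongrightarrow> x \<longrightarrow> ereal (v x) \<le> liminf (\<lambda>k. ereal (vs k (xs k)))) \<and>
     (\<forall>x. \<exists>xs. xs \<longlonglongrightarrow> x \<and> (\<lambda>k. vs k (xs k)) \<longlonglongrightarrow> v x)"

definition tau_star_converges :: "(nat \<Rightarrow> real^'n \<Rightarrow> real) \<Rightarrow> (real^'n \<Rightarrow> real) \<Rightarrow> bool" where
  "tau_star_converges vs v \<longleftrightarrow> epi_converges vs v \<and>
     (\<exists>C. compact C \<and> MA_supp v \<subseteq> C \<and> (\<forall>k. MA_supp (vs k) \<subseteq> C))"

end

theory Submission
  imports Defs
begin

text \<open>
  The resolvent \<open>(I + \<partial>v)\<^sup>-\<^sup>1\<close> is nonexpansive, so by Rademacher and Sard it has an invertible derivative over almost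
  every point; inverting it gives Aleksandrov's theorem. A selection of \<open>\<partial>v\<close> is injective where the
  Hessian determinant is positive, and the change of variables formula then yields
  \<open>\<integral>\<^sub>B det (Hess v) \<le> MA(v; B)\<close>, with equality once a Lebesgue null set is removed from \<open>B\<close>.

  The integrand is concave in \<open>t = det (Hess v)\<close>. The tangent bound
  \<open>t\<^sup>p \<le> (1 - p) s\<^sup>p + p s\<^sup>p\<^sup>-\<^sup>1 t\<close>, where \<open>p = 1/(n+2)\<close>, bounds the functional on a set by the volume
  of the set and that of its subdifferential image. Both are stable under the convergence: if \<open>F\<close> is compact and \<open>W \<supseteq> \<partial>v(F)\<close>
  is open, then \<open>\<partial>v\<^sub>k(U) \<subseteq> W\<close> for some neighbourhood \<open>U\<close> of \<open>F\<close> and all large \<open>k\<close>. Taking for \<open>F\<close> compact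
  parts of the level sets of \<open>det (Hess v)\<close>, with \<open>s\<close> the level, gives the upper bound. The tangent bound with large \<open>s\<close> makes
  the left-over set negligible, uniformly in \<open>k\<close>; the common compact support confines everything to a bounded set.
\<close>

subsection \<open>Rademacher's theorem\<close>

text \<open>The Hessian determinants of the \<open>v_k\<close> carry no usable convergence:
  piecewise affine \<open>v_k\<close> have vanishing Hessian almost everywhere whatever their limit,
  and conversely the mass of MA(\<open>v_k\<close>) may concentrate on a null set. Only upper bounds
  for Monge-Ampere masses pass to the limit, and concavity in \<open>t\<close> is what turns them
  into upper bounds for the integral. Mass that concentrates on a null set is invisible to
  \<open>det (Hess v)\<close>; it does no harm because the exponent \<open>p\<close> is below 1, so
  that bounded mass on volume \<epsilon> contributes at most a multiple of \<epsilon> to the power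
  \<open>1 - p\<close>. For this reason the compact pieces avoid the exceptional null set, where the
  singular part of MA(\<open>v\<close>) may sit, and the rest is handled by a uniform integrability
  estimate. The detour through the resolvent is taken because \<partial>v is in general neither
  single-valued nor Lipschitz, while its resolvent is both.\<close>

lemma lipschitz_right_differentiable_real:
  fixes f :: "real \<Rightarrow> real"
  assumes lip: "L-lipschitz_on UNIV f"
  shows "\<exists>N. negligible N \<and> (\<forall>x. x \<notin> N \<longrightarrow> (\<exists>l. ((\<lambda>t. (f (x + t) - f x) / t) \<longlongrightarrow> l) (at_right 0)))"
proof -
  \<comment> \<open>Slope \<open>L + 1\<close>, rather than \<open>L\<close>, makes \<open>g\<close>
    expand distances, hence a bijection of the line whose inverse is monotone and so Borel.\<close>
  define g where "g = (\<lambda>x. f x + (L + 1) * x)"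
  have fL: "\<bar>f y - f x\<bar> \<le> L * \<bar>y - x\<bar>" for x y
    using lipschitz_onD[OF lip, of y x] by (simp add: dist_real_def)
  have L0: "0 \<le> L" using lip by (rule lipschitz_on_nonneg)
  have glow: "y - x \<le> g y - g x" if "x \<le> y" for x y
    using fL[of y x] that by (auto simp: g_def algebra_simps abs_le_iff)
  have gup: "\<bar>g y - g x\<bar> \<le> (2 * L + 1) * \<bar>y - x\<bar>" for x y
  proof -
    have "\<bar>g y - g x\<bar> \<le> \<bar>f y - f x\<bar> + \<bar>(L + 1) * (y - x)\<bar>"
      unfolding g_def by (simp add: algebra_simps)
    also have "\<bar>(L + 1) * (y - x)\<bar> = (L + 1) * \<bar>y - x\<bar>" using L0 by (simp add: abs_mult)
    finally show ?thesis using fL[of y x] by (simp add: algebra_simps)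
  qed
  have gmono: "g x \<le> g y \<longleftrightarrow> x \<le> y" for x y
    using glow[of x y] glow[of y x] by (cases "x \<le> y"; cases "y \<le> x"; force)
  have inj: "inj g" using gmono by (intro injI) (metis order_antisym order_refl)
  have "continuous_on UNIV f" using lip by (rule lipschitz_on_continuous_on)
  then have contg: "continuous_on UNIV g" unfolding g_def by (intro continuous_intros)
  have surj: "surj g"
  proof -
    have "\<exists>x. g x = y" for y
    proof -
      define R where "R = \<bar>y - g 0\<bar>"
      have "g (- R) \<le> y" "y \<le> g R" using glow[of "-R" 0] glow[of 0 R] unfolding R_def by auto
      moreover have "- R \<le> R" unfolding R_def by simp
      ultimately show ?thesis
        using IVT'[of g "-R" y R] continuous_on_subset[OF contg] by blast
    qed
    then show ?thesis unfolding surj_def by metis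
  qed
  define h where "h = inv g"
  have gh: "g (h y) = y" for y unfolding h_def using surj by (simp add: surj_f_inv_f)
  have hg: "h (g x) = x" for x unfolding h_def using inj by simp
  have hmono: "mono h" by (intro monoI) (metis gmono gh)
  have h_meas: "h \<in> borel_measurable borel" by (rule borel_measurable_mono[OF hmono])
  \<comment> \<open>The Lebesgue-Stieltjes measure of \<open>g\<close>: a set receives the length of
    its image. As a pushforward under the inverse it needs no construction, and the Lipschitz bound
    on \<open>g\<close> makes it absolutely continuous.\<close>
  define M where "M = distr lborel borel h"
  have vim: "h -` A = g ` A" for A proof (intro set_eqI iffI)
    show "x \<in> g ` A" if "x \<in> h -` A" for x using that gh[of x] by (metis image_eqI vimageE)
    show "x \<in> h -` A" if "x \<in> g ` A" for x using that hg by auto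
  qed
  have emM: "emeasure M A = emeasure lborel (g ` A)" if "A \<in> sets borel" for A
    unfolding M_def using that h_meas by (subst emeasure_distr) (auto simp: vim)
  have "absolutely_continuous lborel M"
    unfolding absolutely_continuous_def
  proof
    fix A :: "real set" assume A: "A \<in> null_sets lborel"
    then have Ab: "A \<in> sets borel" by auto
    have "negligible A" using A by (meson negligible_iff_null_sets null_sets_completionI)
    then have neg: "negligible (g ` A)"
      by (rule negligible_locally_Lipschitz_image[rotated])
         (auto intro!: exI[of _ UNIV] exI[of _ "2*L+1"] gup)
    have "g ` A \<in> sets borel" using measurable_sets[OF h_meas Ab] by (simp add: vim)
    then have "emeasure lborel (g ` A) = 0"
      using neg by (simp add: negligible_iff_null_sets null_sets_def)
    then show "A \<in> null_sets M" using emM[OF Ab] Ab by (auto simp: M_def null_sets_def)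
  qed
  moreover have "sets M = sets lborel" by (simp add: M_def)
  ultimately have "\<exists>\<phi>\<in>borel_measurable lborel. density lborel \<phi> = M"
    by (rule sigma_finite_measure.Radon_Nikodym[OF sigma_finite_lborel])
  then obtain \<phi> where \<phi>: "\<phi> \<in> borel_measurable lborel" "density lborel \<phi> = M"
    by blast
  have img: "g ` {a..b} = {g a..g b}" if "a \<le> b" for a b
  proof -
    have "x \<in> g ` {a..b}" if "g a \<le> x" "x \<le> g b" for x
      using that gmono[of a "h x"] gmono[of "h x" b] by (intro image_eqI[of _ _ "h x"]) (auto simp: gh)
    then show ?thesis by (auto simp: gmono)
  qed
  have phint: "(\<integral>\<^sup>+x. \<phi> x * indicator {a..b} x \<partial>lborel) = ennreal (g b - g a)" if "a \<le> b" for a b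
  proof -
    have "(\<integral>\<^sup>+x. \<phi> x * indicator {a..b} x \<partial>lborel) = emeasure (density lborel \<phi>) {a..b}"
      using \<phi>(1) by (subst emeasure_density) auto
    also have "\<dots> = ennreal (g b - g a)" using \<phi>(2) emM[of "{a..b}"] img[OF that] gmono that by simp
    finally show ?thesis .
  qed
  have fin: "AE x in lborel. \<phi> x \<noteq> \<infinity>"
  proof -
    have "AE x in lborel. \<phi> x * indicator {- real n..real n} x \<noteq> \<infinity>" for n
      using \<phi>(1) by (intro nn_integral_PInf_AE) (auto simp: phint)
    then have "AE x in lborel. \<forall>n. \<phi> x * indicator {- real n..real n} x \<noteq> \<infinity>"
      by (simp add: AE_all_countable)
    then show ?thesis
    proof eventually_elim
      case (elim x)
      obtain n where "\<bar>x\<bar> \<le> real n" using real_arch_simple by blast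
      then show ?case using elim[rule_format, of n] by (auto simp: indicator_def abs_le_iff)
    qed
  qed
  define r where "r = (\<lambda>x. enn2real (\<phi> x))"
  have rmeas: "r \<in> borel_measurable borel" unfolding r_def using \<phi>(1) by simp
  have rint: "(r has_integral (g b - g a)) {a..b}" if "a \<le> b" for a b
  proof -
    have eq: "(\<integral>\<^sup>+x. ennreal (r x * indicator {a..b} x) \<partial>lborel) = ennreal (g b - g a)"
      unfolding phint[OF that, symmetric]
      by (rule nn_integral_cong_AE, use fin in eventually_elim) (auto simp: r_def indicator_def less_top)
    have "((\<lambda>x. r x * indicator {a..b} x) has_integral (g b - g a)) UNIV"
      using eq that gmono rmeas by (intro nn_integral_has_integral) (auto simp: r_def)
    moreover have "(\<lambda>x. r x * indicator {a..b} x) = (\<lambda>x. if x \<in> {a..b} then r x else 0)"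
      by (auto simp: indicator_def)
    ultimately show ?thesis 
      using has_integral_restrict_UNIV[of "{a..b}" r "g b - g a"] by simp
  qed
  have "r integrable_on cbox a b" for a b
    using rint[of a b] by (cases "a \<le> b") (auto simp: integrable_on_def)
  \<comment> \<open>Lebesgue differentiation is taken over boxes with \<open>x\<close> as lower
    corner, which is why right derivatives come out.\<close>
  then obtain N where N: "negligible N" "\<And>x e. \<lbrakk>x \<notin> N; 0 < e\<rbrakk> \<Longrightarrow>
      \<exists>d>0. \<forall>h. 0 < h \<and> h < d \<longrightarrow> norm (integral (cbox x (x + h *\<^sub>R One)) r /\<^sub>R h ^ DIM(real) - r x) < e"
    using integrable_ccontinuous_explicit[of r] by metis
  have "((\<lambda>t. (f (x + t) - f x) / t) \<longlongrightarrow> r x - (L + 1)) (at_right 0)" if "x \<notin> N" for x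
  proof (rule tendstoI)
    fix e :: real assume "0 < e"
    then obtain d where d: "d > 0" "\<And>h. 0 < h \<Longrightarrow> h < d \<Longrightarrow>
        norm (integral (cbox x (x + h *\<^sub>R One)) r /\<^sub>R h ^ DIM(real) - r x) < e"
      using N(2)[OF \<open>x \<notin> N\<close>] by metis
    have "dist ((f (x + t) - f x) / t) (r x - (L + 1)) < e" if "0 < t" "t < d" for t
    proof -
      have "integral {x..x + t} r = g (x + t) - g x" using rint[of x "x+t"] that by auto
      then have "\<bar>(g (x + t) - g x) / t - r x\<bar> < e" using d(2)[OF that] by (simp add: divide_inverse mult.commute)
      moreover have "(g (x + t) - g x) / t = (f (x + t) - f x) / t + (L + 1)"
        using that by (simp add: g_def field_simps)
      ultimately show ?thesis by (simp add: dist_real_def)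
    qed
    then show "\<forall>\<^sub>F t in at_right 0. dist ((f (x + t) - f x) / t) (r x - (L + 1)) < e"
      unfolding eventually_at_right_field using d(1) by blast
  qed
  then show ?thesis using N(1) by blast
qed

section \<open>One-sided directional derivatives of Lipschitz functions\<close>

definition diff_quot :: "('a::real_normed_vector \<Rightarrow> real) \<Rightarrow> 'a \<Rightarrow> 'a \<Rightarrow> real \<Rightarrow> real" where
  "diff_quot f v x t = (f (x + t *\<^sub>R v) - f x) / t"

lemma abs_diff_quot_le:
  assumes "L-lipschitz_on UNIV f"
  shows "\<bar>diff_quot f v x t\<bar> \<le> L * norm v"
proof (cases "t = 0")
  case False
  have "\<bar>f (x + t *\<^sub>R v) - f x\<bar> \<le> L * (\<bar>t\<bar> * norm v)"
    using lipschitz_onD[OF assms, of "x + t *\<^sub>R v" x] by (simp add: dist_norm)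
  then show ?thesis using False by (simp add: diff_quot_def abs_divide divide_le_eq mult_ac)
qed (use lipschitz_on_nonneg[OF assms] in \<open>simp add: diff_quot_def\<close>)

text \<open>Consecutive steps have ratio tending to 1, so for Lipschitz functions the limit along the steps
  decides the one-sided limit; this keeps the set of existence visibly Borel.\<close>
lemma diff_quot_tendsto_at_right:
  assumes lip: "L-lipschitz_on UNIV f"
    and lim: "(\<lambda>n. diff_quot f v x (1 / real (Suc n))) \<longlonglongrightarrow> l"
  shows "(diff_quot f v x \<longlongrightarrow> l) (at_right 0)"
proof -
  define K where "K = L * norm v"
  have L0: "0 \<le> L" using lip by (rule lipschitz_on_nonneg)
  have K0: "0 \<le> K" unfolding K_def using L0 by simp
  define k where "k = (\<lambda>t::real. nat \<lfloor>1 / t\<rfloor>)"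
  have k: "real (k t) \<le> 1 / t" "1 / t < real (k t) + 1" "1 \<le> k t" if "0 < t" "t < 1" for t
  proof -
    have "1 < 1 / t" using that by simp
    then have "1 \<le> \<lfloor>1 / t\<rfloor>" by linarith
    then have "real (k t) = of_int \<lfloor>1 / t\<rfloor>" "1 \<le> k t" unfolding k_def by linarith+
    then show "real (k t) \<le> 1 / t" "1 / t < real (k t) + 1" "1 \<le> k t" by linarith+
  qed
  have fL: "\<bar>f (x + a *\<^sub>R v) - f (x + b *\<^sub>R v)\<bar> \<le> K * \<bar>a - b\<bar>" for a b
    using lipschitz_onD[OF lip, of "x + a *\<^sub>R v" "x + b *\<^sub>R v"]
    by (simp add: dist_norm K_def mult_ac flip: scaleR_left_diff_distrib)
  \<comment> \<open>Moving the end point and changing the denominator each cost at most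
    \<open>K * ((s - t) / t)\<close>, which explains the factor 2; and
    \<open>(s - t) / t \<le> s\<close>, as \<open>1 / t\<close> and \<open>1 / s\<close> differ by
    less than 1.\<close>
  have close: "\<bar>diff_quot f v x t - diff_quot f v x (1 / real (k t))\<bar> \<le> 2 * K * (1 / real (k t))"
    if t: "0 < t" "t < 1" for t
  proof -
    define s where "s = 1 / real (k t)"
    have s: "0 < s" "t \<le> s" using k[OF t] t unfolding s_def by (auto simp: field_simps)
    have st: "(s - t) / t \<le> s"
    proof -
      have "s / t \<le> s * (real (k t) + 1)" using k(2)[OF t] s(1) mult_left_mono[of "1 / t" "real (k t) + 1" s] by simp
      also have "\<dots> = 1 + s" using k(3)[OF t] unfolding s_def by (simp add: field_simps)
      finally show ?thesis using t by (simp add: diff_divide_distrib)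
    qed
    have "diff_quot f v x t - diff_quot f v x s
        = (f (x + t *\<^sub>R v) - f (x + s *\<^sub>R v)) / t + (f (x + s *\<^sub>R v) - f (x + 0 *\<^sub>R v)) * ((s - t) / (s * t))"
      using s t unfolding diff_quot_def by (simp add: field_simps)
    also have "\<bar>\<dots>\<bar> \<le> \<bar>(f (x + t *\<^sub>R v) - f (x + s *\<^sub>R v)) / t\<bar> + \<bar>(f (x + s *\<^sub>R v) - f (x + 0 *\<^sub>R v)) * ((s - t) / (s * t))\<bar>"
      by (rule abs_triangle_ineq)
    also have "\<dots> \<le> K * \<bar>t - s\<bar> / t + (K * \<bar>s - 0\<bar>) * ((s - t) / (s * t))"
    proof (rule add_mono)
      show "\<bar>(f (x + t *\<^sub>R v) - f (x + s *\<^sub>R v)) / t\<bar> \<le> K * \<bar>t - s\<bar> / t"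
        using t fL[of t s] by (simp add: abs_divide divide_right_mono)
      have "0 \<le> (s - t) / (s * t)" using s t by simp
      then show "\<bar>(f (x + s *\<^sub>R v) - f (x + 0 *\<^sub>R v)) * ((s - t) / (s * t))\<bar> \<le> (K * \<bar>s - 0\<bar>) * ((s - t) / (s * t))"
        unfolding abs_mult using fL[of s 0] by (metis abs_of_nonneg mult_right_mono)
    qed
    also have "\<dots> = 2 * (K * ((s - t) / t))" using s t by (simp add: field_simps)
    also have "\<dots> \<le> 2 * (K * s)" using st K0 by (intro mult_left_mono) auto
    finally show ?thesis by (simp add: s_def mult_ac)
  qed
  have klim: "filterlim k sequentially (at_right 0)"
    unfolding k_def
    by (intro filterlim_compose[OF filterlim_nat_sequentially] filterlim_compose[OF filterlim_floor_sequentially])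
       (auto simp: divide_inverse intro: filterlim_inverse_at_top_right)
  have lim': "(\<lambda>n. diff_quot f v x (1 / real n)) \<longlonglongrightarrow> l"
    using lim by (subst (asm) filterlim_sequentially_Suc[where f="\<lambda>n. diff_quot f v x (1 / real n)"])
  have 1: "((\<lambda>t. diff_quot f v x (1 / real (k t))) \<longlongrightarrow> l) (at_right 0)"
    using filterlim_compose[OF lim' klim] .
  have "(\<lambda>n. 2 * K * (1 / real n)) \<longlonglongrightarrow> 2 * K * 0" by (intro tendsto_intros lim_1_over_n)
  then have 2: "((\<lambda>t. 2 * K * (1 / real (k t))) \<longlongrightarrow> 0) (at_right 0)"
    using filterlim_compose[OF _ klim] by fastforce
  have "((\<lambda>t. diff_quot f v x t - diff_quot f v x (1 / real (k t))) \<longlongrightarrow> 0) (at_right 0)"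
  proof (rule Lim_null_comparison[OF _ 2])
    show "\<forall>\<^sub>F t in at_right 0. norm (diff_quot f v x t - diff_quot f v x (1 / real (k t))) \<le> 2 * K * (1 / real (k t))"
      using close by (auto simp: eventually_at_right_field intro!: exI[of _ 1])
  qed
  from tendsto_add[OF this 1] show ?thesis by simp
qed

lemma nn_integral_lborel_translate:
  fixes c :: "'a::euclidean_space"
  assumes "g \<in> borel_measurable borel"
  shows "(\<integral>\<^sup>+x. g (x + c) \<partial>lborel) = (\<integral>\<^sup>+x. g x \<partial>lborel)"
proof -
  have "(\<integral>\<^sup>+x. g x \<partial>lborel) = (\<integral>\<^sup>+x. g x \<partial>distr lborel borel ((+) c))"
    by (simp add: lborel_distr_plus)
  also have "\<dots> = (\<integral>\<^sup>+x. g (c + x) \<partial>lborel)" using assms by (intro nn_integral_distr) auto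
  finally show ?thesis by (simp add: add.commute)
qed

lemma filterlim_inverse_Suc_at_right: "filterlim (\<lambda>n. 1 / real (Suc n)) (at_right 0) sequentially"
  unfolding filterlim_at using LIMSEQ_Suc[OF lim_1_over_n] by (auto simp del: of_nat_Suc)

text \<open>The one-dimensional result applies on every line parallel to \<open>v\<close>. Averaging
  the measure of \<open>E\<close> over its translates along \<open>v\<close> and exchanging the
  integrals reduces the claim to these lines without adapting coordinates to
  \<open>v\<close>.\<close>

lemma AE_diff_quot_converges:
  fixes f :: "'a::euclidean_space \<Rightarrow> real"
  assumes lip: "L-lipschitz_on UNIV f"
  shows "AE x in lborel. \<exists>l. (diff_quot f v x \<longlongrightarrow> l) (at_right 0)"
proof -
  define E where "E = {x. \<not> convergent (\<lambda>n. diff_quot f v x (1 / real (Suc n)))}"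
  have contf: "continuous_on UNIV f" using lip by (rule lipschitz_on_continuous_on)
  have fm: "f \<in> borel_measurable borel" using contf by (rule borel_measurable_continuous_onI)
  have E: "E \<in> sets borel"
  proof -
    have "{x \<in> space borel. Cauchy (\<lambda>n. diff_quot f v x (1 / real (Suc n)))} \<in> sets borel"
      unfolding diff_quot_def by (rule sets_Collect_Cauchy) (use fm in measurable)
    moreover have "E = - {x \<in> space borel. Cauchy (\<lambda>n. diff_quot f v x (1 / real (Suc n)))}"
      unfolding E_def by (auto simp: Cauchy_convergent_iff)
    ultimately show ?thesis by (simp only: borel_comp)
  qed
  have line: "(\<integral>\<^sup>+t. indicator E (x + t *\<^sub>R v) \<partial>lborel) = 0" for x
  proof -
    have "(L * norm v)-lipschitz_on UNIV (\<lambda>t. f (x + t *\<^sub>R v))"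
    proof (rule lipschitz_onI)
      show "dist (f (x + a *\<^sub>R v)) (f (x + b *\<^sub>R v)) \<le> L * norm v * dist a b" for a b
        using lipschitz_onD[OF lip, of "x + a *\<^sub>R v" "x + b *\<^sub>R v"]
        by (simp add: dist_norm mult_ac flip: scaleR_left_diff_distrib)
    qed (use lipschitz_on_nonneg[OF lip] in simp)
    from lipschitz_right_differentiable_real[OF this] obtain N where N: "negligible N"
      "\<forall>t. t \<notin> N \<longrightarrow> (\<exists>l. ((\<lambda>h. (f (x + (t + h) *\<^sub>R v) - f (x + t *\<^sub>R v)) / h) \<longlongrightarrow> l) (at_right 0))"
      by blast
    have "x + t *\<^sub>R v \<notin> E" if t: "t \<notin> N" for t
    proof -
      obtain l where l: "((\<lambda>h. (f (x + (t + h) *\<^sub>R v) - f (x + t *\<^sub>R v)) / h) \<longlongrightarrow> l) (at_right 0)"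
        using N(2) t by blast
      from filterlim_compose[OF l filterlim_inverse_Suc_at_right] have "(\<lambda>n. diff_quot f v (x + t *\<^sub>R v) (1 / real (Suc n))) \<longlonglongrightarrow> l"
        by (simp add: diff_quot_def scaleR_add_left add.assoc del: of_nat_Suc)
      then show ?thesis by (auto simp: E_def convergent_def)
    qed
    then have sub: "{t. x + t *\<^sub>R v \<in> E} \<subseteq> N" by auto
    have m: "{t. x + t *\<^sub>R v \<in> E} \<in> sets borel"
      using measurable_sets[of "\<lambda>t. x + t *\<^sub>R v" borel borel E] E by (simp add: vimage_def)
    have "negligible {t. x + t *\<^sub>R v \<in> E}" using N(1) sub by (rule negligible_subset)
    then have "emeasure lborel {t. x + t *\<^sub>R v \<in> E} = 0"
      using m by (simp add: negligible_iff_null_sets null_sets_def)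
    moreover have "(\<integral>\<^sup>+t. indicator E (x + t *\<^sub>R v) \<partial>lborel) = (\<integral>\<^sup>+t. indicator {t. x + t *\<^sub>R v \<in> E} t \<partial>lborel)"
      by (rule nn_integral_cong) (auto simp: indicator_def)
    ultimately show ?thesis using m by simp
  qed
  have "emeasure lborel E = (\<integral>\<^sup>+t. emeasure lborel E * indicator {0..1::real} t \<partial>lborel)"
    by (simp add: nn_integral_cmult_indicator)
  also have "\<dots> = (\<integral>\<^sup>+t. (\<integral>\<^sup>+x. indicator E (x + t *\<^sub>R v) * indicator {0..1} t \<partial>lborel) \<partial>lborel)"
    using E by (intro nn_integral_cong)
      (simp add: nn_integral_multc nn_integral_lborel_translate[of "indicator E" "_ *\<^sub>R v"])
  also have "\<dots> = (\<integral>\<^sup>+x. (\<integral>\<^sup>+t. indicator E (x + t *\<^sub>R v) * indicator {0..1} t \<partial>lborel) \<partial>lborel)"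
  proof (rule lborel_pair.Fubini')
    have m: "(\<lambda>z. fst z + snd z *\<^sub>R v) \<in> borel_measurable (lborel \<Otimes>\<^sub>M lborel)"
      by measurable
    have "(\<lambda>z. indicator E (fst z + snd z *\<^sub>R v) :: ennreal) \<in> borel_measurable (lborel \<Otimes>\<^sub>M lborel)"
      using E by (intro measurable_compose[OF m]) simp
    moreover have "(\<lambda>z. indicator {0..1::real} (snd z) :: ennreal) \<in> borel_measurable (lborel \<Otimes>\<^sub>M lborel)"
      by (intro measurable_compose[OF measurable_snd]) simp
    ultimately show "(\<lambda>(x, t). indicator E (x + t *\<^sub>R v) * indicator {0..1} t :: ennreal)
        \<in> borel_measurable (lborel \<Otimes>\<^sub>M lborel)"
      by (simp add: case_prod_unfold)
  qed
  also have "\<dots> \<le> (\<integral>\<^sup>+x. (\<integral>\<^sup>+t. indicator E (x + t *\<^sub>R v) \<partial>lborel) \<partial>(lborel :: 'a measure))"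
    by (intro nn_integral_mono) (auto simp: indicator_def)
  also have "\<dots> = 0" by (simp add: line)
  finally have "E \<in> null_sets lborel" using E by (auto simp: null_sets_def)
  then show ?thesis
  proof (rule AE_I')
    show "{x \<in> space lborel. \<not> (\<exists>l. (diff_quot f v x \<longlongrightarrow> l) (at_right 0))} \<subseteq> E"
      using diff_quot_tendsto_at_right[OF lip] by (auto simp: E_def convergent_def)
  qed
qed

text \<open>A limit along a single sequence, so that measurability in the base point is immediate;
  where the quotients diverge the value of \<open>lim\<close> is unspecified.\<close>

definition right_dir_deriv :: "('a::real_normed_vector \<Rightarrow> real) \<Rightarrow> 'a \<Rightarrow> 'a \<Rightarrow> real" where
  "right_dir_deriv f v x = lim (\<lambda>n. diff_quot f v x (1 / real (Suc n)))"

lemma AE_right_dir_deriv: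
  fixes f :: "'a::euclidean_space \<Rightarrow> real"
  assumes lip: "L-lipschitz_on UNIV f"
  shows "AE x in lborel. (diff_quot f v x \<longlongrightarrow> right_dir_deriv f v x) (at_right 0)"
  using AE_diff_quot_converges[OF lip, of v]
proof eventually_elim
  case (elim x)
  then obtain l where l: "(diff_quot f v x \<longlongrightarrow> l) (at_right 0)" by blast
  have "(\<lambda>n. diff_quot f v x (1 / real (Suc n))) \<longlonglongrightarrow> l"
    by (rule filterlim_compose[OF l filterlim_inverse_Suc_at_right])
  then have "right_dir_deriv f v x = l" unfolding right_dir_deriv_def by (rule limI)
  then show ?case using l by simp
qed

lemma AE_right_dir_deriv_LIMSEQ:
  fixes f :: "'a::euclidean_space \<Rightarrow> real"
  assumes lip: "L-lipschitz_on UNIV f"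
  shows "AE x in lborel. (\<lambda>n. diff_quot f v x (1 / real (Suc n))) \<longlonglongrightarrow> right_dir_deriv f v x"
  using AE_right_dir_deriv[OF lip, of v]
  by eventually_elim (rule filterlim_compose[OF _ filterlim_inverse_Suc_at_right])

lemma measurable_diff_quot:
  fixes f :: "'a::euclidean_space \<Rightarrow> real"
  assumes "f \<in> borel_measurable borel"
  shows "(\<lambda>x. diff_quot f v x t) \<in> borel_measurable borel"
  unfolding diff_quot_def using assms by measurable

lemma measurable_right_dir_deriv:
  fixes f :: "'a::euclidean_space \<Rightarrow> real"
  assumes "f \<in> borel_measurable borel"
  shows "right_dir_deriv f v \<in> borel_measurable borel"
proof -
  have "(\<lambda>x. lim (\<lambda>n. diff_quot f v x (1 / real (Suc n)))) \<in> borel_measurable borel"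
    by (rule borel_measurable_lim_metric) (rule measurable_diff_quot[OF assms])
  then show ?thesis unfolding right_dir_deriv_def .
qed

text \<open>Lebesgue differentiation; it converts identities between box integrals into identities
  almost everywhere.\<close>

lemma AE_zero_if_box_integrals_zero:
  fixes h :: "'a::euclidean_space \<Rightarrow> real"
  assumes int: "\<And>a b. set_integrable lborel (cbox a b) h"
    and zero: "\<And>a b. (LINT x:cbox a b|lborel. h x) = 0"
  shows "AE x in lebesgue. h x = 0"
proof -
  have 1: "h integrable_on cbox a b" "integral (cbox a b) h = 0" for a b
    using set_borel_integral_eq_integral[OF int[of a b]] zero[of a b] by auto
  obtain N where N: "negligible N" "\<And>x e. \<lbrakk>x \<notin> N; 0 < e\<rbrakk> \<Longrightarrow>
      \<exists>d>0. \<forall>t. 0 < t \<and> t < d \<longrightarrow> norm (integral (cbox x (x + t *\<^sub>R One)) h /\<^sub>R t ^ DIM('a) - h x) < e"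
    using integrable_ccontinuous_explicit[OF 1(1)] by metis
  have "h x = 0" if "x \<notin> N" for x
  proof (rule ccontr)
    assume "h x \<noteq> 0"
    then have "0 < \<bar>h x\<bar>" by simp
    from N(2)[OF \<open>x \<notin> N\<close> this] obtain d where "d > 0"
      "\<And>t. 0 < t \<Longrightarrow> t < d \<Longrightarrow> norm (integral (cbox x (x + t *\<^sub>R One)) h /\<^sub>R t ^ DIM('a) - h x) < \<bar>h x\<bar>"
      by blast
    from this(2)[of "d/2"] this(1) show False by (simp add: 1)
  qed
  then show ?thesis
    using N(1) by (intro AE_I'[of N]) (auto simp: negligible_iff_null_sets)
qed

lemma lborel_integral_translate:
  fixes g :: "'a::euclidean_space \<Rightarrow> real"
  assumes "g \<in> borel_measurable borel"
  shows "(LINT x|lborel. g (c + x)) = (LINT x|lborel. g x)"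
proof -
  have "(LINT x|lborel. g x) = (LINT x|distr lborel borel ((+) c). g x)"
    by (simp add: lborel_distr_plus)
  also have "\<dots> = (LINT x|lborel. g (c + x))" using assms by (intro integral_distr) auto
  finally show ?thesis by simp
qed

text \<open>Difference quotients are additive in the direction except that the base point of the
  second one moves by \<open>\<tau> n\<close> times \<open>v\<close>. Pointwise nothing controls
  this move, but under an integral it can be shifted onto the box, where it disappears in the
  limit.\<close>

lemma AE_right_dir_deriv_add:
  fixes f :: "'a::euclidean_space \<Rightarrow> real"
  assumes lip: "L-lipschitz_on UNIV f"
  shows "AE x in lborel. right_dir_deriv f (v + w) x = right_dir_deriv f v x + right_dir_deriv f w x"
proof -
  define \<tau> where "\<tau> = (\<lambda>n::nat. 1 / real (Suc n))"
  have \<tau>: "\<tau> \<longlonglongrightarrow> 0" unfolding \<tau>_def by (rule LIMSEQ_Suc[OF lim_1_over_n])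
  have \<tau>1: "0 < \<tau> n" "\<tau> n \<le> 1" for n unfolding \<tau>_def by auto
  define D where "D = right_dir_deriv f"
  define Q where "Q = (\<lambda>u n x. diff_quot f u x (\<tau> n))"
  have "continuous_on UNIV f" using lip by (rule lipschitz_on_continuous_on)
  then have fm: "f \<in> borel_measurable borel" by (rule borel_measurable_continuous_onI)
  have Dm: "D u \<in> borel_measurable borel" for u
    unfolding D_def using fm by (rule measurable_right_dir_deriv)
  have Qm: "Q u n \<in> borel_measurable borel" for u n
    unfolding Q_def using fm by (rule measurable_diff_quot)
  have lim: "AE x in lborel. (\<lambda>n. Q u n x) \<longlonglongrightarrow> D u x" for u
    unfolding D_def Q_def \<tau>_def by (rule AE_right_dir_deriv_LIMSEQ[OF lip])
  have Qb: "\<bar>Q u n x\<bar> \<le> L * norm u" for u n x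
    unfolding Q_def by (rule abs_diff_quot_le[OF lip])
  have Qadd: "Q (v + w) n x = Q v n x + Q w n (\<tau> n *\<^sub>R v + x)" for n x
    unfolding Q_def diff_quot_def by (simp add: algebra_simps add_divide_distrib diff_divide_distrib)
  have conv: "integrable lborel (\<lambda>x. indicator (cbox a b) x * D u x)"
    "\<And>n. integrable lborel (\<lambda>x. indicator (cbox a b) (x - \<tau> n *\<^sub>R z) * Q u n x)"
    "(\<lambda>n. LINT x|lborel. indicator (cbox a b) (x - \<tau> n *\<^sub>R z) * Q u n x)
      \<longlonglongrightarrow> (LINT x|lborel. indicator (cbox a b) x * D u x)" for a b u z
  proof -
    obtain R where R: "\<And>x. x \<in> cbox a b \<Longrightarrow> norm x \<le> R"
      using bounded_cbox[of a b] by (auto simp: bounded_iff)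
    define W where "W = (\<lambda>x::'a. indicator (cball 0 (R + norm z)) x * (L * norm u))"
    have Wi: "integrable lborel W"
      unfolding W_def by (intro integrable_mult_left integrable_real_indicator) (use emeasure_bounded_finite[OF bounded_cball] in \<open>auto simp: less_top\<close>)
    have W: "norm (indicator (cbox a b) (x - \<tau> n *\<^sub>R z) * Q u n x) \<le> W x" for n x
    proof (cases "x - \<tau> n *\<^sub>R z \<in> cbox a b")
      case True
      have "norm x \<le> norm (x - \<tau> n *\<^sub>R z) + norm (\<tau> n *\<^sub>R z)" by (metis diff_add_cancel norm_triangle_ineq)
      also have "norm (\<tau> n *\<^sub>R z) \<le> norm z" using \<tau>1[of n] by (simp add: mult_left_le_one_le)
      finally have "norm x \<le> R + norm z" using R[OF True] by simp
      then show ?thesis using Qb[of u n x] True by (simp add: W_def)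
    qed (use lipschitz_on_nonneg[OF lip] in \<open>simp add: W_def indicator_def\<close>)
    \<comment> \<open>The indicators of the shifted boxes converge wherever the limiting indicator
      is continuous, that is, off the frontier.\<close>
    have "frontier (cbox a b) \<in> null_sets lborel"
      using negligible_frontier_interval[of a b] unfolding frontier_cbox
      by (simp add: negligible_iff_null_sets null_sets_completion_iff)
    then have "AE x in lborel. x \<notin> frontier (cbox a b)" by (rule AE_not_in)
    then have AEl: "AE x in lborel. (\<lambda>n. indicator (cbox a b) (x - \<tau> n *\<^sub>R z) * Q u n x) \<longlonglongrightarrow> indicator (cbox a b) x * D u x"
      using lim[of u]
    proof eventually_elim
      case (elim x)
      have "isCont (indicator (cbox a b) :: 'a \<Rightarrow> real) x"
        using elim(1) by (simp add: isCont_indicator)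
      moreover have "(\<lambda>n. x - \<tau> n *\<^sub>R z) \<longlonglongrightarrow> x - 0 *\<^sub>R z" by (intro tendsto_intros \<tau>)
      ultimately have "(\<lambda>n. indicator (cbox a b) (x - \<tau> n *\<^sub>R z) :: real) \<longlonglongrightarrow> indicator (cbox a b) x"
        using isCont_tendsto_compose[of x "indicator (cbox a b)"] by simp
      then show ?case using elim(2) by (intro tendsto_mult)
    qed
    have m1: "(\<lambda>x. indicator (cbox a b) x * D u x) \<in> borel_measurable lborel" using Dm by simp
    have m2: "(\<lambda>x. indicator (cbox a b) (x - \<tau> n *\<^sub>R z) * Q u n x) \<in> borel_measurable lborel" for n
      using Qm by simp
    have bd: "AE x in lborel. norm (indicator (cbox a b) (x - \<tau> n *\<^sub>R z) * Q u n x) \<le> W x" for n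
      using W by simp
    show "integrable lborel (\<lambda>x. indicator (cbox a b) x * D u x)"
      by (rule integrable_dominated_convergence[OF m1 m2 Wi AEl bd])
    show "integrable lborel (\<lambda>x. indicator (cbox a b) (x - \<tau> n *\<^sub>R z) * Q u n x)" for n
      by (rule integrable_dominated_convergence2[OF m1 m2 Wi AEl bd])
    show "(\<lambda>n. LINT x|lborel. indicator (cbox a b) (x - \<tau> n *\<^sub>R z) * Q u n x)
      \<longlonglongrightarrow> (LINT x|lborel. indicator (cbox a b) x * D u x)"
      by (rule integral_dominated_convergence[OF m1 m2 Wi AEl bd])
  qed
  have box: "(LINT x|lborel. indicator (cbox a b) x * D (v + w) x)
     = (LINT x|lborel. indicator (cbox a b) x * D v x) + (LINT x|lborel. indicator (cbox a b) x * D w x)" for a b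
  proof -
    have "(LINT x|lborel. indicator (cbox a b) x * Q (v + w) n x)
       = (LINT x|lborel. indicator (cbox a b) x * Q v n x) + (LINT x|lborel. indicator (cbox a b) (x - \<tau> n *\<^sub>R v) * Q w n x)" for n
    proof -
      have i1: "integrable lborel (\<lambda>x. indicator (cbox a b) x * Q u n x)" for u
        using conv(2)[of a b n 0 u] by simp
      have "(LINT x|lborel. indicator (cbox a b) x * Q (v + w) n x) - (LINT x|lborel. indicator (cbox a b) x * Q v n x)
         = (LINT x|lborel. indicator (cbox a b) x * Q (v + w) n x - indicator (cbox a b) x * Q v n x)"
        by (rule Bochner_Integration.integral_diff[symmetric]) (rule i1)+
      also have "\<dots> = (LINT x|lborel. indicator (cbox a b) ((\<tau> n *\<^sub>R v + x) - \<tau> n *\<^sub>R v) * Q w n (\<tau> n *\<^sub>R v + x))"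
        by (simp add: Qadd algebra_simps)
      also have "\<dots> = (LINT x|lborel. indicator (cbox a b) (x - \<tau> n *\<^sub>R v) * Q w n x)"
        using Qm by (intro lborel_integral_translate[where g="\<lambda>x. indicator (cbox a b) (x - \<tau> n *\<^sub>R v) * Q w n x"]) simp
      finally show ?thesis by simp
    qed
    then have "(\<lambda>n. LINT x|lborel. indicator (cbox a b) x * Q (v + w) n x)
      \<longlonglongrightarrow> (LINT x|lborel. indicator (cbox a b) x * D v x) + (LINT x|lborel. indicator (cbox a b) x * D w x)"
      using tendsto_add[OF conv(3)[of a b 0 v] conv(3)[of a b v w]] by simp
    moreover have "(\<lambda>n. LINT x|lborel. indicator (cbox a b) x * Q (v + w) n x)
      \<longlonglongrightarrow> (LINT x|lborel. indicator (cbox a b) x * D (v + w) x)"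
      using conv(3)[of a b 0 "v + w"] by simp
    ultimately show ?thesis by (rule LIMSEQ_unique[symmetric])
  qed
  have eq: "(\<lambda>x. indicator (cbox a b) x *\<^sub>R (D (v + w) x - D v x - D w x))
     = (\<lambda>x. indicator (cbox a b) x * D (v + w) x - indicator (cbox a b) x * D v x - indicator (cbox a b) x * D w x)" for a b
    by (auto simp: algebra_simps)
  have "AE x in lebesgue. D (v + w) x - D v x - D w x = 0"
  proof (rule AE_zero_if_box_integrals_zero)
    show "set_integrable lborel (cbox a b) (\<lambda>x. D (v + w) x - D v x - D w x)" for a b
      unfolding set_integrable_def eq by (intro Bochner_Integration.integrable_diff conv(1))
    show "(LINT x:cbox a b|lborel. D (v + w) x - D v x - D w x) = 0" for a b
      unfolding set_lebesgue_integral_def eq using conv(1) box by simp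
  qed
  then have "AE x in lborel. D (v + w) x - D v x - D w x = 0"
    using Dm by (subst (asm) AE_completion_iff) auto
  then show ?thesis unfolding D_def by eventually_elim simp
qed

text \<open>One-sided derivatives scale directly only under positive factors. For
  \<open>c < 0\<close>, additivity is applied to the opposite directions
  \<open>c *\<^sub>R v\<close> and \<open>(- c) *\<^sub>R v\<close>, whose sum is 0.\<close>

lemma AE_right_dir_deriv_scaleR:
  fixes f :: "'a::euclidean_space \<Rightarrow> real"
  assumes lip: "L-lipschitz_on UNIV f"
  shows "AE x in lborel. right_dir_deriv f (c *\<^sub>R v) x = c * right_dir_deriv f v x"
proof -
  have zero: "right_dir_deriv f 0 x = 0" for x
    unfolding right_dir_deriv_def diff_quot_def by (intro limI) simp
  have pos: "AE x in lborel. right_dir_deriv f (c *\<^sub>R v) x = c * right_dir_deriv f v x" if "c > 0" for c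
    using AE_right_dir_deriv[OF lip, of v] AE_right_dir_deriv[OF lip, of "c *\<^sub>R v"]
  proof eventually_elim
    case (elim x)
    have "((\<lambda>t. c * t) \<longlongrightarrow> c * 0) (at_right 0)" by (intro tendsto_intros)
    then have "filterlim (\<lambda>t. c * t) (at_right 0) (at_right 0)"
      unfolding filterlim_at using that by (auto simp: eventually_at_right_field intro!: exI[of _ 1])
    from tendsto_mult_left[OF filterlim_compose[OF elim(1) this], of c]
    have "((\<lambda>t. c * diff_quot f v x (c * t)) \<longlongrightarrow> c * right_dir_deriv f v x) (at_right 0)" .
    moreover have "(\<lambda>t. c * diff_quot f v x (c * t)) = diff_quot f (c *\<^sub>R v) x"
      using that by (auto simp: diff_quot_def fun_eq_iff mult.commute)
    ultimately show ?case using tendsto_unique[OF _ elim(2)] by simp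
  qed
  consider "c > 0" | "c = 0" | "c < 0" by linarith
  then show ?thesis
  proof cases
    case 3
    then have "AE x in lborel. right_dir_deriv f ((- c) *\<^sub>R v) x = (- c) * right_dir_deriv f v x"
      by (intro pos) simp
    then show ?thesis
      using AE_right_dir_deriv_add[OF lip, of "c *\<^sub>R v" "(- c) *\<^sub>R v"]
      by eventually_elim (simp add: zero flip: scaleR_left_distrib)
  qed (use pos zero in auto)
qed

lemma AE_right_dir_deriv_linear:
  fixes f :: "'a::euclidean_space \<Rightarrow> real"
  assumes lip: "L-lipschitz_on UNIV f"
  shows "AE x in lborel. right_dir_deriv f v x = (\<Sum>b\<in>Basis. (v \<bullet> b) * right_dir_deriv f b x)"
proof -
  have zero: "right_dir_deriv f 0 x = 0" for x
    unfolding right_dir_deriv_def diff_quot_def by (intro limI) simp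
  have "AE x in lborel. right_dir_deriv f (\<Sum>b\<in>S. (v \<bullet> b) *\<^sub>R b) x = (\<Sum>b\<in>S. (v \<bullet> b) * right_dir_deriv f b x)"
    if "finite S" for S :: "'a set"
    using that
  proof (induction S rule: finite_induct)
    case (insert b S)
    show ?case
      using insert.IH AE_right_dir_deriv_scaleR[OF lip, of "v \<bullet> b" b]
        AE_right_dir_deriv_add[OF lip, of "(v \<bullet> b) *\<^sub>R b" "\<Sum>b\<in>S. (v \<bullet> b) *\<^sub>R b"]
      by eventually_elim (use insert.hyps in simp)
  qed (simp add: zero)
  from this[OF finite_Basis] show ?thesis by (simp add: euclidean_representation)
qed

text \<open>Almost everywhere the quotients converge to one linear map along a countable dense set
  of directions. The Lipschitz bound carries this to nearby directions, and compactness of the unit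
  sphere reduces to finitely many, which makes the convergence uniform in the direction.\<close>

theorem rademacher:
  fixes f :: "'a::euclidean_space \<Rightarrow> real"
  assumes lip: "L-lipschitz_on UNIV f"
  shows "AE x in lborel. f differentiable (at x)"
proof -
  obtain D :: "'a set" where D: "countable D" "\<And>X. open X \<Longrightarrow> X \<noteq> {} \<Longrightarrow> \<exists>d\<in>D. d \<in> X"
    using countable_dense_exists by (metis (no_types, lifting))
  have "AE x in lborel. \<forall>q\<in>D. (diff_quot f q x \<longlongrightarrow> (\<Sum>b\<in>Basis. (q \<bullet> b) * right_dir_deriv f b x)) (at_right 0)"
  proof (subst AE_ball_countable[OF D(1)], intro ballI)
    fix q
    show "AE x in lborel. (diff_quot f q x \<longlongrightarrow> (\<Sum>b\<in>Basis. (q \<bullet> b) * right_dir_deriv f b x)) (at_right 0)"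
      using AE_right_dir_deriv[OF lip, of q] AE_right_dir_deriv_linear[OF lip, of q]
      by eventually_elim simp
  qed
  then show ?thesis
  proof eventually_elim
    case (elim x)
    define \<Lambda> where "\<Lambda> = (\<lambda>h. \<Sum>b\<in>Basis. (h \<bullet> b) * right_dir_deriv f b x)"
    have lin: "linear \<Lambda>"
      unfolding \<Lambda>_def by (rule linearI) (simp_all add: inner_add_left algebra_simps sum.distrib sum_distrib_left)
    then have blin: "bounded_linear \<Lambda>" by (rule linear_linear[THEN iffD2])
    obtain M where M: "M > 0" "\<And>h. norm (\<Lambda> h) \<le> norm h * M"
      using bounded_linear.pos_bounded[OF blin] by blast
    have L0: "0 \<le> L" using lip by (rule lipschitz_on_nonneg)
    have "(f has_derivative \<Lambda>) (at x)"
      unfolding has_derivative_at_alt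
    proof (intro conjI blin allI impI)
      fix e :: real assume e: "e > 0"
      \<comment> \<open>Replacing a unit vector by a \<open>q\<close> within \<open>\<delta>\<close>
        costs \<open>L * \<delta>\<close> in \<open>f\<close> and \<open>M * \<delta>\<close> in
        \<open>\<Lambda>\<close> per unit of length, together half of \<open>e\<close>.\<close>
      define \<delta> where "\<delta> = e / (2 * (L + M))"
      have \<delta>: "\<delta> > 0" unfolding \<delta>_def using e L0 M(1) by simp
      have "sphere 0 1 \<subseteq> (\<Union>q\<in>D. ball q \<delta>)"
      proof
        fix u :: 'a
        obtain d where "d \<in> D" "d \<in> ball u \<delta>" using D(2)[of "ball u \<delta>"] \<delta> by auto
        then show "u \<in> (\<Union>q\<in>D. ball q \<delta>)" by (auto simp: dist_commute)
      qed
      then obtain F where F: "F \<subseteq> D" "finite F" "sphere 0 1 \<subseteq> (\<Union>q\<in>F. ball q \<delta>)"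
        using compactE_image[of "sphere (0::'a) 1" D "\<lambda>q. ball q \<delta>"] by (metis compact_sphere open_ball)
      have "\<forall>\<^sub>F t in at_right 0. dist (diff_quot f q x t) (\<Lambda> q) < e / 2" if "q \<in> F" for q
        using elim that F(1) e unfolding \<Lambda>_def by (intro tendstoD) auto
      then have "\<forall>\<^sub>F t in at_right 0. \<forall>q\<in>F. dist (diff_quot f q x t) (\<Lambda> q) < e / 2"
        using F(2) by (simp add: eventually_ball_finite)
      then obtain d where d: "d > 0" "\<And>t q. 0 < t \<Longrightarrow> t < d \<Longrightarrow> q \<in> F \<Longrightarrow> \<bar>diff_quot f q x t - \<Lambda> q\<bar> < e / 2"
        unfolding eventually_at_right_field dist_real_def by blast
      have "norm (f y - f x - \<Lambda> (y - x)) \<le> e * norm (y - x)" if y: "norm (y - x) < d" for y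
      proof (cases "y = x")
        case True then show ?thesis by (simp add: linear_0[OF lin])
      next
        case False
        define t where "t = norm (y - x)"
        define u where "u = (y - x) /\<^sub>R t"
        have t: "0 < t" "t < d" using False y unfolding t_def by auto
        have u: "u \<in> sphere 0 1" "y = x + t *\<^sub>R u" using t unfolding u_def t_def by auto
        then obtain q where q: "q \<in> F" "norm (q - u) < \<delta>" using F(3) by (auto simp: dist_norm)
        have "\<bar>f (x + t *\<^sub>R u) - f (x + t *\<^sub>R q)\<bar> \<le> L * (t * norm (q - u))"
          using lipschitz_onD[OF lip, of "x + t *\<^sub>R u" "x + t *\<^sub>R q"] t
          by (simp add: dist_norm norm_minus_commute flip: scaleR_right_diff_distrib)
        moreover have "\<bar>f (x + t *\<^sub>R q) - f x - t * \<Lambda> q\<bar> \<le> t * (e / 2)"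
        proof -
          have "f (x + t *\<^sub>R q) - f x - t * \<Lambda> q = t * (diff_quot f q x t - \<Lambda> q)"
            using t by (simp add: diff_quot_def field_simps)
          then show ?thesis using d(2)[OF t q(1)] t by (simp add: abs_mult)
        qed
        moreover have "\<bar>t * \<Lambda> q - \<Lambda> (y - x)\<bar> \<le> t * (norm (q - u) * M)"
        proof -
          have "t * \<Lambda> q - \<Lambda> (y - x) = t * \<Lambda> (q - u)"
            using u(2) by (simp add: linear_diff[OF lin] linear_scale[OF lin] algebra_simps)
          then show ?thesis using M(2)[of "q - u"] t by (simp add: abs_mult)
        qed
        ultimately have "\<bar>f y - f x - \<Lambda> (y - x)\<bar> \<le> L * (t * norm (q - u)) + t * (e / 2) + t * (norm (q - u) * M)"
          unfolding u(2) by linarith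
        also have "\<dots> = t * ((L + M) * norm (q - u) + e / 2)" by (simp add: algebra_simps)
        also have "\<dots> \<le> t * ((L + M) * \<delta> + e / 2)"
          using q(2) t L0 M(1) by (intro mult_left_mono add_mono) auto
        also have "(L + M) * \<delta> = e / 2" unfolding \<delta>_def using L0 M(1) by (simp add: field_simps)
        finally show ?thesis by (simp add: t_def mult.commute)
      qed
      then show "\<exists>d>0. \<forall>y. norm (y - x) < d \<longrightarrow> norm (f y - f x - \<Lambda> (y - x)) \<le> e * norm (y - x)"
        using d(1) by blast
    qed
    then show ?case by (auto simp: differentiable_def)
  qed
qed

subsection \<open>Sard's theorem and change of variables for arbitrary finite index types\<close>

text \<open>The library proves these results for well-ordered index types only; they are transported along a
  well-ordered copy of the index type.\<close>

typedef 'a ordered_copy = "UNIV :: 'a set" morphisms of_copy to_copy by simp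

lemma bij_of_copy: "bij (of_copy :: 'a ordered_copy \<Rightarrow> 'a)"
  by (metis bijI' of_copy_inject to_copy_inverse UNIV_I)

lemma all_copy_iff: "(\<forall>i. P i) \<longleftrightarrow> (\<forall>j. P (to_copy j))"
  by (metis of_copy_inverse)

lemma card_ordered_copy [simp]: "CARD('a ordered_copy) = CARD('a)"
  by (rule bij_betw_same_card[OF bij_of_copy])

definition copy_index :: "'a::finite ordered_copy \<Rightarrow> nat" where
  "copy_index x = (SOME f :: 'a \<Rightarrow> nat. inj f) (of_copy x)"

lemma inj_copy_index: "inj copy_index"
proof -
  have "\<exists>f :: 'a \<Rightarrow> nat. inj f" using finite_imp_inj_to_nat_seg[of "UNIV :: 'a set"] by auto
  then have "inj (SOME f :: 'a \<Rightarrow> nat. inj f)" by (rule someI_ex)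
  then show ?thesis
    by (intro injI) (metis copy_index_def injD of_copy_inject)
qed

instantiation ordered_copy :: (finite) "{finite, wellorder}"
begin
definition "x \<le> y \<longleftrightarrow> copy_index x \<le> copy_index y"
definition "x < y \<longleftrightarrow> copy_index x < copy_index y"
instance
proof
  show "finite (UNIV :: 'a ordered_copy set)"
    using bij_betw_finite[OF bij_of_copy[where 'a='a]] by simp
  show "P a" if "\<And>x. (\<And>y. y < x \<Longrightarrow> P y) \<Longrightarrow> P x" for P and a :: "'a ordered_copy"
  proof (induction "copy_index a" arbitrary: a rule: less_induct)
    case less
    then show ?case using that by (simp add: less_ordered_copy_def)
  qed
qed (auto simp: less_eq_ordered_copy_def less_ordered_copy_def dest: injD[OF inj_copy_index])
end

definition copy_vec :: "real^'n \<Rightarrow> real^('n::finite ordered_copy)" where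
  "copy_vec x = (\<chi> i. x $ of_copy i)"

definition uncopy_vec :: "real^('n::finite ordered_copy) \<Rightarrow> real^'n" where
  "uncopy_vec y = (\<chi> i. y $ to_copy i)"

lemma uncopy_copy [simp]: "uncopy_vec (copy_vec x) = x"
  by (simp add: copy_vec_def uncopy_vec_def vec_eq_iff to_copy_inverse)

lemma copy_uncopy [simp]: "copy_vec (uncopy_vec y) = y"
  by (simp add: copy_vec_def uncopy_vec_def vec_eq_iff of_copy_inverse)

lemma linear_copy_vec: "linear copy_vec"
  by (rule linearI) (simp_all add: copy_vec_def vec_eq_iff)

lemma linear_uncopy_vec: "linear uncopy_vec"
  by (rule linearI) (simp_all add: uncopy_vec_def vec_eq_iff)

lemma norm_copy_vec [simp]: "norm (copy_vec x) = norm x"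
proof -
  have "(\<Sum>i\<in>UNIV. (norm (x $ of_copy i))\<^sup>2) = (\<Sum>i\<in>UNIV. (norm (x $ i))\<^sup>2)"
    by (rule sum.reindex_bij_betw[OF bij_of_copy])
  then show ?thesis by (simp add: norm_vec_def L2_set_def copy_vec_def)
qed

lemma norm_uncopy_vec [simp]: "norm (uncopy_vec y) = norm y"
  by (metis copy_uncopy norm_copy_vec)

lemma permutes_UNIV_iff: "p permutes UNIV \<longleftrightarrow> bij p"
  by (auto intro: bij_imp_permutes permutes_bij)

text \<open>Conjugation by \<open>g\<close> matches the permutations of the two index types and
  preserves signs.\<close>

lemma det_reindex:
  fixes A :: "real^'n^'n" and g :: "'m::finite \<Rightarrow> 'n"
  assumes g: "bij g"
  shows "det (\<chi> i j. A $ g i $ g j) = det A"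
proof -
  have gi: "inv g (g x) = x" "g (inv g y) = y" for x y
    using g by (simp_all add: bij_is_inj bij_is_surj surj_f_inv_f)
  have map: "map_permutation UNIV g p = g \<circ> p \<circ> inv g" for p
    using g by (auto simp: map_permutation_def restrict_id_def fun_eq_iff bij_is_surj)
  have "(\<Sum>p | p permutes (UNIV :: 'm set). of_int (sign p) * (\<Prod>i\<in>UNIV. A $ g i $ g (p i)))
      = (\<Sum>q | q permutes (UNIV :: 'n set). of_int (sign q) * (\<Prod>i\<in>UNIV. A $ i $ q i))"
  proof (rule sum.reindex_bij_witness[where i = "\<lambda>q. inv g \<circ> q \<circ> g" and j = "\<lambda>p. g \<circ> p \<circ> inv g"])
    show "g \<circ> p \<circ> inv g \<in> {q. q permutes UNIV}" if "p \<in> {p. p permutes (UNIV :: 'm set)}" for p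
      using that g by (auto simp: permutes_UNIV_iff bij_imp_bij_inv intro!: bij_comp)
    show "inv g \<circ> q \<circ> g \<in> {p. p permutes UNIV}" if "q \<in> {q. q permutes (UNIV :: 'n set)}" for q
      using that g by (auto simp: permutes_UNIV_iff bij_imp_bij_inv intro!: bij_comp)
    fix p assume "p \<in> {p. p permutes (UNIV :: 'm set)}"
    then have "sign (g \<circ> p \<circ> inv g) = sign p"
      using sign_map_permutation[of g UNIV p] g by (simp add: map bij_is_inj)
    moreover have "(\<Prod>i\<in>UNIV. A $ i $ (g \<circ> p \<circ> inv g) i) = (\<Prod>i\<in>UNIV. A $ g i $ g (p i))"
      using prod.reindex_bij_betw[OF g, of "\<lambda>i. A $ i $ (g \<circ> p \<circ> inv g) i"] by (simp add: gi)
    ultimately show "of_int (sign (g \<circ> p \<circ> inv g)) * (\<Prod>i\<in>UNIV. A $ i $ (g \<circ> p \<circ> inv g) i)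
        = of_int (sign p) * (\<Prod>i\<in>UNIV. A $ g i $ g (p i))" by simp
  qed (auto simp: fun_eq_iff gi)
  then show ?thesis by (simp add: det_def)
qed

lemma uncopy_axis: "uncopy_vec (axis j 1) = axis (of_copy j) 1"
  by (auto simp: uncopy_vec_def axis_def vec_eq_iff to_copy_inverse of_copy_inverse)

lemma det_matrix_copy: "det (matrix (\<lambda>y. copy_vec (L (uncopy_vec y)))) = det (matrix L)"
proof -
  have "matrix (\<lambda>y. copy_vec (L (uncopy_vec y))) = (\<chi> i j. matrix L $ of_copy i $ of_copy j)"
    by (simp add: matrix_def vec_eq_iff uncopy_axis) (simp add: copy_vec_def)
  then show ?thesis by (simp add: det_reindex[OF bij_of_copy])
qed

lemma prod_Basis_vec: "(\<Prod>b\<in>Basis. x \<bullet> b) = (\<Prod>i\<in>UNIV. x $ i)" for x :: "real^'n"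
proof -
  have B: "Basis = (\<lambda>i. axis i (1::real)) ` (UNIV :: 'n set)" by (auto simp: Basis_vec_def)
  have "inj (\<lambda>i::'n. axis i (1::real))" by (auto simp: inj_def axis_eq_axis)
  then show ?thesis unfolding B by (subst prod.reindex) (simp_all add: inner_axis o_def)
qed

lemma copy_vec_borel: "copy_vec \<in> borel_measurable borel"
  by (intro borel_measurable_continuous_onI linear_continuous_on linear_linear[THEN iffD2] linear_copy_vec)

lemma distr_copy_vec_lborel: "distr lborel borel (copy_vec :: real^'n \<Rightarrow> _) = lborel"
proof (rule lborel_eqI[symmetric])
  fix l u :: "real^('n::finite ordered_copy)"
  assume le: "\<And>b. b \<in> Basis \<Longrightarrow> l \<bullet> b \<le> u \<bullet> b"
  have le': "uncopy_vec l \<bullet> b \<le> uncopy_vec u \<bullet> b" if hb: "b \<in> Basis" for b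
  proof -
    obtain i where b: "b = axis i 1" using hb by (auto simp: Basis_vec_def)
    have "l $ to_copy i \<le> u $ to_copy i" using le[of "axis (to_copy i) 1"] by (simp add: inner_axis)
    then show ?thesis unfolding b by (simp add: inner_axis uncopy_vec_def)
  qed
  have "copy_vec -` box l u = box (uncopy_vec l) (uncopy_vec u)"
  proof -
    have "copy_vec x \<in> box l u \<longleftrightarrow> x \<in> box (uncopy_vec l) (uncopy_vec u)" for x
      unfolding mem_box_cart copy_vec_def uncopy_vec_def
      by (simp add: all_copy_iff to_copy_inverse)
    then show ?thesis by auto
  qed
  then have "emeasure (distr lborel borel copy_vec) (box l u) = emeasure lborel (box (uncopy_vec l) (uncopy_vec u))"
    by (subst emeasure_distr) (auto simp: copy_vec_borel)
  also have "\<dots> = (\<Prod>b\<in>Basis. (uncopy_vec u - uncopy_vec l) \<bullet> b)"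
    using le' by (rule emeasure_lborel_box)
  also have "\<dots> = (\<Prod>b\<in>Basis. (u - l) \<bullet> b)"
  proof -
    have "(\<Prod>i\<in>UNIV. (u - l) $ i) = (\<Prod>i\<in>UNIV. (uncopy_vec u - uncopy_vec l) $ i)"
      using prod.reindex_bij_betw[OF bij_of_copy, of "\<lambda>i. (uncopy_vec u - uncopy_vec l) $ i"]
      by (simp add: uncopy_vec_def of_copy_inverse)
    then show ?thesis by (simp add: prod_Basis_vec)
  qed
  finally show "emeasure (distr lborel borel copy_vec) (box l u) = (\<Prod>b\<in>Basis. (u - l) \<bullet> b)" .
qed simp

lemma negligible_isometric_image:
  fixes g :: "'a::euclidean_space \<Rightarrow> 'b::euclidean_space"
  assumes "DIM('a) = DIM('b)" "linear g" "\<And>x. norm (g x) = norm x" "negligible S"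
  shows "negligible (g ` S)"
proof (rule negligible_locally_Lipschitz_image)
  fix x assume "x \<in> S"
  have "\<forall>y\<in>S \<inter> UNIV. norm (g y - g x) \<le> 1 * norm (y - x)"
    using assms(2,3) by (metis linear_diff mult_1 order_refl)
  then show "\<exists>T B. open T \<and> x \<in> T \<and> (\<forall>y\<in>S \<inter> T. norm (g y - g x) \<le> B * norm (y - x))"
    using open_UNIV UNIV_I by blast
qed (use assms in auto)

lemma negligible_uncopy: "negligible S \<Longrightarrow> negligible (uncopy_vec ` S)"
  by (rule negligible_isometric_image) (auto simp: linear_uncopy_vec)

lemma vimage_copy: "copy_vec -` A = uncopy_vec ` A"
  by (auto simp: image_iff) (metis uncopy_copy)

lemma copy_vec_lebesgue: "copy_vec \<in> lebesgue \<rightarrow>\<^sub>M lebesgue"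
proof (rule measurableI)
  fix A :: "(real^('a::finite ordered_copy)) set" assume A: "A \<in> sets lebesgue"
  have "uncopy_vec differentiable_on A"
    by (intro linear_imp_differentiable_on linear_uncopy_vec)
  then show "copy_vec -` A \<inter> space lebesgue \<in> sets lebesgue"
    using differentiable_image_in_sets_lebesgue[OF A, of uncopy_vec] by (simp add: vimage_copy)
qed simp

text \<open>The Borel case extends to the completion because the null part of a Lebesgue set pulls
  back to a null set under an isometry.\<close>

lemma distr_copy_vec_lebesgue: "distr lebesgue lebesgue (copy_vec :: real^'n \<Rightarrow> _) = lebesgue"
proof (rule measure_eqI)
  fix A :: "(real^('n::finite ordered_copy)) set" assume "A \<in> sets (distr lebesgue lebesgue copy_vec)"
  then have A: "A \<in> sets lebesgue" by simp
  define B where "B = main_part lborel A"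
  have B: "B \<in> sets borel" using main_part_sets[of A lborel] A unfolding B_def by simp
  have vm: "copy_vec -` X \<in> sets lebesgue" if "X \<in> sets lebesgue" for X :: "(real^('n ordered_copy)) set"
    using measurable_sets[OF copy_vec_lebesgue that] by simp
  have "null_part lborel A \<in> null_sets lebesgue"
    using null_part_null_sets[of A lborel] A by simp
  moreover have AB: "A = B \<union> null_part lborel A"
    unfolding B_def using main_part_null_part_Un[of A lborel] A by simp
  ultimately have "negligible (copy_vec -` null_part lborel A)"
    unfolding vimage_copy by (intro negligible_uncopy) (simp add: negligible_iff_null_sets)
  then have N: "copy_vec -` null_part lborel A \<in> null_sets lebesgue"
    by (simp add: negligible_iff_null_sets)
  have "emeasure (distr lebesgue lebesgue copy_vec) A = emeasure lebesgue (copy_vec -` A)"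
    using A by (simp add: emeasure_distr copy_vec_lebesgue)
  also have "copy_vec -` A = copy_vec -` B \<union> copy_vec -` null_part lborel A"
    using AB by auto
  also have "emeasure lebesgue \<dots> = emeasure lebesgue (copy_vec -` B)"
    using N B vm[of B] by (intro emeasure_Un_null_set) auto
  also have "\<dots> = emeasure lborel (copy_vec -` B)"
    using measurable_sets[OF copy_vec_borel B] by simp
  also have "\<dots> = emeasure (distr lborel borel copy_vec) B"
    using B by (simp add: emeasure_distr copy_vec_borel)
  also have "\<dots> = emeasure lebesgue A"
    unfolding distr_copy_vec_lborel B_def using A by simp
  finally show "emeasure (distr lebesgue lebesgue copy_vec) A = emeasure lebesgue A" .
qed simp

lemma emeasure_copy_image:
  assumes "S \<in> sets lebesgue"
  shows "copy_vec ` S \<in> sets lebesgue" "emeasure lebesgue (copy_vec ` S) = emeasure lebesgue S"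
proof -
  have "copy_vec differentiable_on S"
    by (intro linear_imp_differentiable_on linear_copy_vec)
  then show *: "copy_vec ` S \<in> sets lebesgue"
    using differentiable_image_in_sets_lebesgue[OF assms, of copy_vec] by simp
  have "copy_vec -` copy_vec ` S = S" by (auto, metis uncopy_copy)
  then show "emeasure lebesgue (copy_vec ` S) = emeasure lebesgue S"
    using emeasure_distr[OF copy_vec_lebesgue *] unfolding distr_copy_vec_lebesgue by simp
qed

lemma has_derivative_copy:
  assumes "(f has_derivative f') (at x within S)"
  shows "((\<lambda>y. copy_vec (f (uncopy_vec y))) has_derivative (\<lambda>h. copy_vec (f' (uncopy_vec h))))
    (at (copy_vec x) within copy_vec ` S)"
proof -
  have c: "bounded_linear copy_vec" by (rule linear_linear[THEN iffD2, OF linear_copy_vec])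
  have u: "bounded_linear uncopy_vec" by (rule linear_linear[THEN iffD2, OF linear_uncopy_vec])
  have "uncopy_vec ` copy_vec ` S = S" by (auto simp: image_iff)
  then have "(f has_derivative f') (at (uncopy_vec (copy_vec x)) within uncopy_vec ` copy_vec ` S)"
    using assms by simp
  from has_derivative_in_compose[OF bounded_linear_imp_has_derivative[OF u] this]
  show ?thesis by (intro bounded_linear.has_derivative[OF c])
qed

lemma negligible_image_noninjective_derivative:
  fixes f :: "real^'n \<Rightarrow> real^'n"
  assumes der: "\<And>x. x \<in> S \<Longrightarrow> (f has_derivative f' x) (at x within S)"
    and ninj: "\<And>x. x \<in> S \<Longrightarrow> \<not> inj (f' x)"
  shows "negligible (f ` S)"
proof -
  define F where "F = (\<lambda>y. copy_vec (f (uncopy_vec y)))"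
  define F' where "F' = (\<lambda>y h. copy_vec (f' (uncopy_vec y) (uncopy_vec h)))"
  have "negligible (F ` copy_vec ` S)"
  proof (rule baby_Sard)
    fix y assume "y \<in> copy_vec ` S"
    then obtain x where x: "x \<in> S" "y = copy_vec x" by auto
    show d: "(F has_derivative F' y) (at y within copy_vec ` S)"
      using has_derivative_copy[OF der[OF x(1)]] unfolding F_def F'_def x(2) by simp
    obtain a b where ab: "a \<noteq> b" "f' x a = f' x b" using ninj[OF x(1)] by (auto simp: inj_def)
    have "F' y (copy_vec a) = F' y (copy_vec b)" "copy_vec a \<noteq> copy_vec b"
      unfolding F'_def x(2) using ab by (simp, metis uncopy_copy)
    then have "\<not> inj (F' y)" by (auto simp: inj_def)
    moreover have "(*v) (matrix (F' y)) = F' y"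
      using has_derivative_linear[OF d] by (simp add: fun_eq_iff matrix_works)
    ultimately have "rank (matrix (F' y)) \<noteq> CARD('n ordered_copy)"
      unfolding full_rank_injective by simp
    moreover have "rank (matrix (F' y)) \<le> CARD('n ordered_copy)"
      using rank_bound[of "matrix (F' y)"] by simp
    ultimately show "rank (matrix (F' y)) < CARD('n ordered_copy)" by simp
  qed simp
  then have "negligible (uncopy_vec ` F ` copy_vec ` S)" by (rule negligible_uncopy)
  moreover have "uncopy_vec ` F ` copy_vec ` S = f ` S" by (simp add: F_def image_image)
  ultimately show ?thesis by simp
qed

text \<open>Boundedness gives the image finite measure, and the change of variables theorem then
  yields integrability of the Jacobian as a conclusion. The values are in \<open>ennreal\<close>,
  ready for \<open>nn_integral\<close> estimates.\<close>

lemma emeasure_differentiable_image: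
  fixes f :: "real^'n \<Rightarrow> real^'n"
  assumes S: "S \<in> sets lebesgue"
    and der: "\<And>x. x \<in> S \<Longrightarrow> (f has_derivative f' x) (at x within S)"
    and inj: "inj_on f S" and bdd: "bounded (f ` S)"
  shows "f ` S \<in> sets lebesgue"
    and "(\<lambda>x. ennreal \<bar>det (matrix (f' x))\<bar> * indicator S x) \<in> borel_measurable lebesgue"
    and "emeasure lebesgue (f ` S) = (\<integral>\<^sup>+x. ennreal \<bar>det (matrix (f' x))\<bar> * indicator S x \<partial>lebesgue)"
proof -
  define F where "F = (\<lambda>y. copy_vec (f (uncopy_vec y)))"
  define F' where "F' = (\<lambda>y h. copy_vec (f' (uncopy_vec y) (uncopy_vec h)))"
  let ?S = "copy_vec ` S"
  have S': "?S \<in> sets lebesgue" using emeasure_copy_image(1)[OF S] .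
  have der': "(F has_derivative F' y) (at y within ?S)" if "y \<in> ?S" for y
    using that has_derivative_copy[OF der] unfolding F_def F'_def by auto
  have inj': "inj_on F ?S"
    using inj unfolding F_def inj_on_def by (metis image_iff uncopy_copy)
  have diff: "f differentiable_on S" using der unfolding differentiable_on_def differentiable_def by blast
  show fS: "f ` S \<in> sets lebesgue"
    using differentiable_image_in_sets_lebesgue[OF S _ diff] by simp
  have FS: "F ` ?S = copy_vec ` f ` S" by (simp add: F_def image_image)
  have FSm: "F ` ?S \<in> sets lebesgue" unfolding FS using emeasure_copy_image(1)[OF fS] .
  have "bounded (F ` ?S)" unfolding FS using bdd by (simp add: bounded_iff)
  then have lm: "F ` ?S \<in> lmeasurable" using FSm by (simp add: bounded_set_imp_lmeasurable)
  define m where "m = measure lebesgue (F ` ?S)"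
  have hi: "((\<lambda>y. \<bar>det (matrix (F' y))\<bar>) has_integral m) ?S"
    using has_measure_differentiable_image[OF S' der' inj', of m] lm m_def by blast
  have dm: "det (matrix (F' (copy_vec x))) = det (matrix (f' x))" for x
    unfolding F'_def by (simp add: det_matrix_copy)
  define G where "G = (\<lambda>y. ennreal \<bar>det (matrix (F' y))\<bar> * indicator ?S y)"
  have "(\<lambda>y. \<bar>det (matrix (F' y))\<bar> * indicator ?S y) \<in> borel_measurable lebesgue"
    using has_integral_implies_lebesgue_measurable[OF hi] by (simp add: mult.commute)
  then have "(\<lambda>y. ennreal (\<bar>det (matrix (F' y))\<bar> * indicator ?S y)) \<in> borel_measurable lebesgue"
    by (rule measurable_compose) simp
  then have Gm: "G \<in> borel_measurable lebesgue"
    unfolding G_def by (simp add: ennreal_mult' ennreal_indicator)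
  have Gc: "G (copy_vec x) = ennreal \<bar>det (matrix (f' x))\<bar> * indicator S x" for x
  proof -
    have "copy_vec x \<in> ?S \<longleftrightarrow> x \<in> S" by (metis image_iff uncopy_copy)
    then show ?thesis by (simp add: G_def dm indicator_def)
  qed
  show "(\<lambda>x. ennreal \<bar>det (matrix (f' x))\<bar> * indicator S x) \<in> borel_measurable lebesgue"
    using measurable_compose[OF copy_vec_lebesgue Gm] by (simp add: Gc)
  have "emeasure lebesgue (f ` S) = emeasure lebesgue (F ` ?S)"
    unfolding FS using emeasure_copy_image(2)[OF fS] by simp
  also have "\<dots> = ennreal m" unfolding m_def using lm by (simp add: emeasure_eq_measure2)
  also have "\<dots> = (\<integral>\<^sup>+y. G y \<partial>lborel)"
    using nn_integral_has_integral_lebesgue'[OF _ hi] by (simp add: G_def)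
  also have "\<dots> = (\<integral>\<^sup>+y. G y \<partial>lebesgue)" using Gm by (simp add: nn_integral_completion)
  also have "\<dots> = (\<integral>\<^sup>+y. G y \<partial>distr lebesgue lebesgue copy_vec)" by (simp add: distr_copy_vec_lebesgue)
  also have "\<dots> = (\<integral>\<^sup>+x. G (copy_vec x) \<partial>lebesgue)"
    by (rule nn_integral_distr[OF copy_vec_lebesgue]) (simp add: Gm)
  finally show "emeasure lebesgue (f ` S) = (\<integral>\<^sup>+x. ennreal \<bar>det (matrix (f' x))\<bar> * indicator S x \<partial>lebesgue)"
    by (simp add: Gc)
qed

subsection \<open>Subdifferentials and resolvents\<close>

text \<open>This stands for finite convexity in the form in which support functions provide it, a
  supporting affine function at every point; convexity and continuity follow.\<close>

definition everywhere_subdiff :: "('a::real_inner \<Rightarrow> real) \<Rightarrow> bool" where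
  "everywhere_subdiff v \<longleftrightarrow> (\<forall>x. subdiff v x \<noteq> {})"

lemma subdiffD: "p \<in> subdiff v x \<Longrightarrow> v x + p \<bullet> (z - x) \<le> v z"
  by (simp add: subdiff_def)

lemma everywhere_subdiff_convex:
  assumes "everywhere_subdiff v"
  shows "convex_on UNIV v"
proof (rule convex_onI)
  fix t :: real and x y :: 'a assume t: "0 < t" "t < 1"
  define z where "z = (1 - t) *\<^sub>R x + t *\<^sub>R y"
  obtain p where p: "p \<in> subdiff v z" using assms by (auto simp: everywhere_subdiff_def)
  have "(1 - t) * (v z + p \<bullet> (x - z)) + t * (v z + p \<bullet> (y - z)) \<le> (1 - t) * v x + t * v y"
    using t subdiffD[OF p] by (intro add_mono mult_left_mono) auto
  moreover have "(1 - t) * (v z + p \<bullet> (x - z)) + t * (v z + p \<bullet> (y - z)) = v z"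
  proof -
    have "(1 - t) * (p \<bullet> (x - z)) + t * (p \<bullet> (y - z)) = p \<bullet> ((1 - t) *\<^sub>R (x - z) + t *\<^sub>R (y - z))"
      by (simp add: inner_add_right)
    also have "(1 - t) *\<^sub>R (x - z) + t *\<^sub>R (y - z) = 0" unfolding z_def by (simp add: algebra_simps)
    finally show ?thesis by (simp add: algebra_simps)
  qed
  ultimately show "v ((1 - t) *\<^sub>R x + t *\<^sub>R y) \<le> (1 - t) * v x + t * v y"
    by (simp add: z_def)
qed simp

lemma everywhere_subdiff_continuous:
  fixes v :: "'a::euclidean_space \<Rightarrow> real"
  assumes "everywhere_subdiff v"
  shows "continuous_on UNIV v"
  using everywhere_subdiff_convex[OF assms] by (intro convex_on_continuous) auto

lemma subdiff_monotone:
  assumes "p \<in> subdiff v x" "q \<in> subdiff v y"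
  shows "0 \<le> (p - q) \<bullet> (x - y)"
  using subdiffD[OF assms(1), of y] subdiffD[OF assms(2), of x]
  by (simp add: inner_diff_left inner_diff_right)

lemma convex_subdiff: "convex (subdiff v x)"
proof (rule convexI)
  fix p q and a b :: real assume pq: "p \<in> subdiff v x" "q \<in> subdiff v x" and ab: "0 \<le> a" "0 \<le> b" "a + b = 1"
  show "a *\<^sub>R p + b *\<^sub>R q \<in> subdiff v x"
    unfolding subdiff_def
  proof (clarify)
    fix z
    have b: "b = 1 - a" using ab(3) by simp
    have "a * (v x + p \<bullet> (z - x)) + b * (v x + q \<bullet> (z - x)) \<le> a * v z + b * v z"
      using ab subdiffD[OF pq(1)] subdiffD[OF pq(2)] by (intro add_mono mult_left_mono) auto
    then show "v x + (a *\<^sub>R p + b *\<^sub>R q) \<bullet> (z - x) \<le> v z"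
      unfolding b by (simp add: inner_add_left algebra_simps)
  qed
qed

lemma subdiff_segment:
  assumes v: "convex_on UNIV v" and p: "p \<in> subdiff v x" "p \<in> subdiff v y" and t: "0 \<le> t" "t \<le> 1"
  shows "p \<in> subdiff v (x + t *\<^sub>R (y - x))"
  unfolding subdiff_def
proof (clarify)
  fix z
  have "v (x + t *\<^sub>R (y - x)) \<le> (1 - t) * v x + t * v y"
    using convex_onD[OF v, of t x y] t by (simp add: algebra_simps)
  also have "\<dots> \<le> (1 - t) * (v z - p \<bullet> (z - x)) + t * (v z - p \<bullet> (z - y))"
    using subdiffD[OF p(1), of z] subdiffD[OF p(2), of z] t by (intro add_mono mult_left_mono) auto
  also have "\<dots> = v z - p \<bullet> (z - (x + t *\<^sub>R (y - x)))"
    by (simp add: inner_diff_right inner_add_right algebra_simps)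
  finally show "v (x + t *\<^sub>R (y - x)) + p \<bullet> (z - (x + t *\<^sub>R (y - x))) \<le> v z" by simp
qed

text \<open>Test the subgradient inequality at distance \<open>r\<close> from \<open>x\<close> in
  the direction of \<open>p\<close>.\<close>

lemma norm_subdiff_le:
  fixes v :: "'a::real_inner \<Rightarrow> real"
  assumes p: "p \<in> subdiff v x" and r: "0 < r" and M: "\<And>z. norm (z - x) \<le> r \<Longrightarrow> \<bar>v z\<bar> \<le> M"
  shows "norm p \<le> 2 * M / r"
proof (cases "p = 0")
  case True
  then show ?thesis using M[of x] r by simp
next
  case False
  define z where "z = x + (r / norm p) *\<^sub>R p"
  have "norm (z - x) = r" using False r unfolding z_def by simp
  then have "p \<bullet> (z - x) \<le> 2 * M" using subdiffD[OF p, of z] M[of z] M[of x] r by (simp add: abs_le_iff)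
  moreover have "p \<bullet> (z - x) = r * norm p" using False unfolding z_def
    by (simp add: power2_norm_eq_inner[symmetric] power2_eq_square)
  ultimately show ?thesis using r by (simp add: field_simps)
qed

text \<open>Continuous convergence: the point of evaluation may move along with \<open>k\<close>. A
  constant sequence recovers continuity, so that statements about convergent sequences also serve
  for a single function.\<close>

definition cont_converges :: "(nat \<Rightarrow> 'a::metric_space \<Rightarrow> real) \<Rightarrow> ('a \<Rightarrow> real) \<Rightarrow> bool" where
  "cont_converges vs v \<longleftrightarrow>
     (\<forall>x e. 0 < e \<longrightarrow> (\<exists>d>0. \<exists>k0. \<forall>k\<ge>k0. \<forall>x'. dist x' x < d \<longrightarrow> \<bar>vs k x' - v x\<bar> < e))"

lemma cont_convergesD:
  assumes "cont_converges vs v" "0 < e"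
  obtains d k0 where "0 < d" "\<And>k x'. k0 \<le> k \<Longrightarrow> dist x' x < d \<Longrightarrow> \<bar>vs k x' - v x\<bar> < e"
  using assms unfolding cont_converges_def by meson

lemma cont_converges_const:
  assumes "continuous_on UNIV v"
  shows "cont_converges (\<lambda>_. v) v"
  using assms unfolding cont_converges_def continuous_on_iff dist_real_def by (metis UNIV_I)

lemma cont_converges_LIMSEQ:
  assumes "cont_converges vs v" "\<xi> \<longlonglongrightarrow> x" "filterlim \<kappa> sequentially sequentially"
  shows "(\<lambda>m. vs (\<kappa> m) (\<xi> m)) \<longlonglongrightarrow> v x"
proof (rule tendstoI)
  fix e :: real assume "0 < e"
  obtain d k0 where d: "0 < d" "\<And>k x'. k0 \<le> k \<Longrightarrow> dist x' x < d \<Longrightarrow> \<bar>vs k x' - v x\<bar> < e"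
    by (rule cont_convergesD[OF assms(1) \<open>0 < e\<close>, of x]) blast
  have "\<forall>\<^sub>F m in sequentially. dist (\<xi> m) x < d" using tendstoD[OF assms(2) d(1)] .
  moreover have "\<forall>\<^sub>F m in sequentially. k0 \<le> \<kappa> m" using assms(3) by (simp add: filterlim_at_top)
  ultimately show "\<forall>\<^sub>F m in sequentially. dist (vs (\<kappa> m) (\<xi> m)) (v x) < e"
    by eventually_elim (simp add: d(2) dist_real_def)
qed

text \<open>If this failed, there would be subgradients outside \<open>W\<close> at points tending
  to \<open>x\<close>. Local bounds on \<open>vs k\<close> keep them bounded, so a subsequence
  converges; its limit is a subgradient of \<open>v\<close> at \<open>x\<close> because the
  subgradient inequality passes to the limit, yet it lies outside the open set
  \<open>W\<close>.\<close>

lemma subdiff_upper_semicontinuous: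
  fixes v :: "'a::euclidean_space \<Rightarrow> real"
  assumes conv: "cont_converges vs v" and W: "open W" "subdiff v x \<subseteq> W"
  obtains d k0 where "0 < d" "\<And>k x'. k0 \<le> k \<Longrightarrow> dist x' x < d \<Longrightarrow> subdiff (vs k) x' \<subseteq> W"
proof (rule ccontr)
  assume "\<not> thesis"
  with that have neg: "\<And>d k0. 0 < d \<Longrightarrow> \<exists>k\<ge>k0. \<exists>x'. dist x' x < d \<and> \<not> subdiff (vs k) x' \<subseteq> W"
    by meson
  have "\<exists>k x' y. m \<le> k \<and> dist x' x < 1 / real (Suc m) \<and> y \<in> subdiff (vs k) x' \<and> y \<notin> W" for m :: nat
    using neg[of "1 / real (Suc m)" m] by (auto simp del: of_nat_Suc)
  then obtain \<kappa> \<xi> \<eta> where seq: "\<And>m. m \<le> \<kappa> m" "\<And>m. dist (\<xi> m) x < 1 / real (Suc m)"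
      "\<And>m. \<eta> m \<in> subdiff (vs (\<kappa> m)) (\<xi> m)" "\<And>m. \<eta> m \<notin> W"
    by metis
  have \<kappa>: "filterlim \<kappa> sequentially sequentially"
    using seq(1) by (intro filterlim_at_top_mono[OF filterlim_ident]) auto
  have \<xi>: "\<xi> \<longlonglongrightarrow> x"
  proof (rule metric_tendsto_imp_tendsto[OF LIMSEQ_Suc[OF lim_1_over_n]])
    show "\<forall>\<^sub>F m in sequentially. dist (\<xi> m) x \<le> dist (1 / real (Suc m)) 0"
      using seq(2) by (intro always_eventually) (simp add: less_imp_le del: of_nat_Suc)
  qed
  obtain d k0 where d: "0 < d" "\<And>k x'. k0 \<le> k \<Longrightarrow> dist x' x < d \<Longrightarrow> \<bar>vs k x' - v x\<bar> < 1"
    by (rule cont_convergesD[OF conv, of 1 x]) auto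
  have bd: "norm (\<eta> m) \<le> 2 * (\<bar>v x\<bar> + 1) / (d / 2)" if "k0 \<le> m" "dist (\<xi> m) x < d / 2" for m
  proof (rule norm_subdiff_le[OF seq(3)])
    fix z assume z: "norm (z - \<xi> m) \<le> d / 2"
    have "dist z x \<le> dist z (\<xi> m) + dist (\<xi> m) x" by (rule dist_triangle)
    then have "dist z x < d" using z that(2) by (simp add: dist_norm)
    then show "\<bar>vs (\<kappa> m) z\<bar> \<le> \<bar>v x\<bar> + 1" using d(2)[of "\<kappa> m" z] seq(1)[of m] that(1) by fastforce
  qed (use d in simp)
  have "\<forall>\<^sub>F m in sequentially. norm (\<eta> m) \<le> 2 * (\<bar>v x\<bar> + 1) / (d / 2)"
    using eventually_ge_at_top[of k0] tendstoD[OF \<xi> half_gt_zero[OF d(1)]]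
    by eventually_elim (rule bd)
  then obtain m0 where m0: "\<And>m. m0 \<le> m \<Longrightarrow> norm (\<eta> m) \<le> 2 * (\<bar>v x\<bar> + 1) / (d / 2)"
    by (auto simp: eventually_sequentially)
  have "\<forall>m. \<eta> (m + m0) \<in> cball 0 (2 * (\<bar>v x\<bar> + 1) / (d / 2))" using m0 by simp
  then obtain y r where r: "strict_mono r" "((\<lambda>m. \<eta> (m + m0)) \<circ> r) \<longlonglongrightarrow> y"
    using compact_cball[THEN compact_imp_seq_compact, THEN seq_compactE] by metis
  define \<sigma> where "\<sigma> = (\<lambda>m. r m + m0)"
  have \<sigma>: "filterlim \<sigma> sequentially sequentially"
  proof -
    have "strict_mono \<sigma>" using r(1) unfolding \<sigma>_def strict_mono_def by simp
    then show ?thesis by (rule filterlim_subseq)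
  qed
  have \<eta>: "(\<lambda>m. \<eta> (\<sigma> m)) \<longlonglongrightarrow> y" using r(2) by (simp add: \<sigma>_def o_def)
  have \<xi>\<sigma>: "(\<lambda>m. \<xi> (\<sigma> m)) \<longlonglongrightarrow> x" using filterlim_compose[OF \<xi> \<sigma>] .
  have \<kappa>\<sigma>: "filterlim (\<lambda>m. \<kappa> (\<sigma> m)) sequentially sequentially" using filterlim_compose[OF \<kappa> \<sigma>] .
  have "y \<notin> W"
  proof -
    have "y \<in> - W" by (rule closed_sequentially[OF closed_Compl[OF W(1)] _ \<eta>]) (simp add: seq(4))
    then show ?thesis by simp
  qed
  moreover have "y \<in> subdiff v x"
    unfolding subdiff_def
  proof (clarify)
    fix z
    show "v x + y \<bullet> (z - x) \<le> v z"
    proof (rule LIMSEQ_le)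
      show "(\<lambda>m. vs (\<kappa> (\<sigma> m)) (\<xi> (\<sigma> m)) + \<eta> (\<sigma> m) \<bullet> (z - \<xi> (\<sigma> m))) \<longlonglongrightarrow> v x + y \<bullet> (z - x)"
        by (intro tendsto_intros cont_converges_LIMSEQ[OF conv \<xi>\<sigma> \<kappa>\<sigma>] \<eta> \<xi>\<sigma>)
      show "(\<lambda>m. vs (\<kappa> (\<sigma> m)) z) \<longlonglongrightarrow> v z"
        by (rule cont_converges_LIMSEQ[OF conv tendsto_const \<kappa>\<sigma>])
      show "\<exists>N. \<forall>m\<ge>N. vs (\<kappa> (\<sigma> m)) (\<xi> (\<sigma> m)) + \<eta> (\<sigma> m) \<bullet> (z - \<xi> (\<sigma> m)) \<le> vs (\<kappa> (\<sigma> m)) z"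
        using subdiffD[OF seq(3)] by blast
    qed
  qed
  ultimately show False using W(2) by blast
qed

lemma bounded_subdiff_image:
  fixes v :: "'a::euclidean_space \<Rightarrow> real"
  assumes v: "everywhere_subdiff v" and B: "bounded B"
  shows "bounded (\<Union>x\<in>B. subdiff v x)"
proof -
  obtain R where R: "\<And>x. x \<in> B \<Longrightarrow> norm x \<le> R" using B by (auto simp: bounded_iff)
  have "compact (v ` cball 0 (R + 1))"
    using everywhere_subdiff_continuous[OF v] by (intro compact_continuous_image) (auto intro: continuous_on_subset)
  then have "bounded (v ` cball 0 (R + 1))" by (rule compact_imp_bounded)
  then obtain M where M: "\<And>z. norm z \<le> R + 1 \<Longrightarrow> \<bar>v z\<bar> \<le> M"
    unfolding bounded_iff by (force simp: mem_cball_0)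
  have "norm p \<le> 2 * M / 1" if x: "x \<in> B" "p \<in> subdiff v x" for x p
  proof (rule norm_subdiff_le[OF x(2)])
    fix z assume "norm (z - x) \<le> 1"
    then have "norm z \<le> R + 1" using R[OF x(1)] norm_triangle_sub[of z x] by simp
    then show "\<bar>v z\<bar> \<le> M" by (rule M)
  qed simp
  then show ?thesis by (auto simp: bounded_iff)
qed

text \<open>The main use is measurability: images of compact sets, hence of countable unions of
  them, are Borel.\<close>

lemma compact_subdiff_image:
  fixes v :: "'a::euclidean_space \<Rightarrow> real"
  assumes v: "everywhere_subdiff v" and K: "compact K"
  shows "compact (\<Union>x\<in>K. subdiff v x)"
proof -
  have cont: "continuous_on UNIV v" by (rule everywhere_subdiff_continuous[OF v])
  have "closed (\<Union>x\<in>K. subdiff v x)"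
    unfolding closed_sequential_limits
  proof (intro allI impI, elim conjE)
    fix \<eta> y assume mem: "\<forall>n. \<eta> n \<in> (\<Union>x\<in>K. subdiff v x)" and \<eta>: "\<eta> \<longlonglongrightarrow> y"
    have "\<forall>n. \<exists>x. x \<in> K \<and> \<eta> n \<in> subdiff v x" using mem by blast
    then obtain \<xi> where \<xi>: "\<And>n. \<xi> n \<in> K" "\<And>n. \<eta> n \<in> subdiff v (\<xi> n)" by metis
    have "\<forall>n. \<xi> n \<in> K" using \<xi>(1) by blast
    then obtain x r where r: "x \<in> K" "strict_mono r" "(\<xi> \<circ> r) \<longlonglongrightarrow> x"
      using K[THEN compact_imp_seq_compact, THEN seq_compactE] by metis
    have "y \<in> subdiff v x"
      unfolding subdiff_def
    proof (clarify)
      fix z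
      have \<eta>r: "(\<lambda>n. \<eta> (r n)) \<longlonglongrightarrow> y" using LIMSEQ_subseq_LIMSEQ[OF \<eta> r(2)] by (simp add: o_def)
      have \<xi>r: "(\<lambda>n. \<xi> (r n)) \<longlonglongrightarrow> x" using r(3) by (simp add: o_def)
      have "(\<lambda>n. v (\<xi> (r n))) \<longlonglongrightarrow> v x"
        using continuous_on_tendsto_compose[OF cont \<xi>r] by simp
      then have "(\<lambda>n. v (\<xi> (r n)) + \<eta> (r n) \<bullet> (z - \<xi> (r n))) \<longlonglongrightarrow> v x + y \<bullet> (z - x)"
        by (intro tendsto_intros \<eta>r \<xi>r)
      then show "v x + y \<bullet> (z - x) \<le> v z"
        by (rule LIMSEQ_le_const2) (use subdiffD[OF \<xi>(2)] in blast)
    qed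
    then show "y \<in> (\<Union>x\<in>K. subdiff v x)" using r(1) by blast
  qed
  then show ?thesis
    using bounded_subdiff_image[OF v compact_imp_bounded[OF K]] by (simp add: compact_eq_bounded_closed)
qed

section \<open>The resolvent of the subdifferential\<close>

definition resolvent :: "('a::real_inner \<Rightarrow> real) \<Rightarrow> 'a \<Rightarrow> 'a" where
  "resolvent v z = (THE x. z - x \<in> subdiff v x)"

lemma resolvent_unique:
  assumes "z - x \<in> subdiff v x" "z - y \<in> subdiff v y"
  shows "x = y"
proof -
  have "0 \<le> - ((x - y) \<bullet> (x - y))"
    using subdiff_monotone[OF assms] by (simp add: inner_diff_left inner_diff_right inner_commute algebra_simps)
  then have "(x - y) \<bullet> (x - y) \<le> 0" by simp
  then show ?thesis by (metis eq_iff_diff_eq_0 inner_ge_zero inner_eq_zero_iff order_antisym)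
qed

text \<open>The point sought minimises \<open>\<phi>\<close>, the function \<open>v\<close> plus
  half the squared distance to \<open>z\<close>. Outside the ball of radius
  \<open>2 * norm p\<close> the quadratic term outweighs the affine minorant of slope
  \<open>p\<close>, so a minimiser over the ball is global. Comparing it with points at parameter
  \<open>t\<close> on segments, dividing by \<open>t\<close> and letting \<open>t\<close> tend to 0
  gives the subgradient inequality.\<close>

lemma resolvent_exists:
  fixes v :: "'a::euclidean_space \<Rightarrow> real"
  assumes v: "everywhere_subdiff v"
  shows "\<exists>x. z - x \<in> subdiff v x"
proof -
  obtain p where p: "p \<in> subdiff v z" using v by (auto simp: everywhere_subdiff_def)
  define \<phi> where "\<phi> = (\<lambda>x. v x + (norm (x - z))\<^sup>2 / 2)"
  have "continuous_on (cball z (2 * norm p)) \<phi>"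
    unfolding \<phi>_def
    by (intro continuous_intros continuous_on_subset[OF everywhere_subdiff_continuous[OF v]]) auto
  then obtain m where m: "m \<in> cball z (2 * norm p)" "\<And>x. x \<in> cball z (2 * norm p) \<Longrightarrow> \<phi> m \<le> \<phi> x"
    using continuous_attains_inf[of "cball z (2 * norm p)" \<phi>] by auto
  have min: "\<phi> m \<le> \<phi> x" for x
  proof (cases "x \<in> cball z (2 * norm p)")
    case False
    then have n: "2 * norm p \<le> norm (x - z)" by (simp add: dist_norm norm_minus_commute)
    have "\<phi> m \<le> \<phi> z" using m(2)[of z] by simp
    also have "\<phi> z = v z" by (simp add: \<phi>_def)
    also have "\<dots> \<le> v x - p \<bullet> (x - z)" using subdiffD[OF p, of x] by simp
    also have "\<dots> \<le> v x + norm p * norm (x - z)" using Cauchy_Schwarz_ineq2[of p "x - z"] by simp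
    also have "\<dots> \<le> v x + (norm (x - z) / 2) * norm (x - z)" using n by (intro add_left_mono mult_right_mono) auto
    also have "\<dots> = \<phi> x" by (simp add: \<phi>_def power2_eq_square)
    finally show ?thesis .
  qed (rule m(2))
  have "z - m \<in> subdiff v m"
    unfolding subdiff_def
  proof (clarify)
    fix u
    have cv: "convex_on UNIV v" by (rule everywhere_subdiff_convex[OF v])
    have ineq: "v m \<le> v u + (m - z) \<bullet> (u - m) + t * ((norm (u - m))\<^sup>2 / 2)" if t: "0 < t" "t < 1" for t
    proof -
      have "\<phi> m \<le> \<phi> (m + t *\<^sub>R (u - m))" by (rule min)
      also have "v (m + t *\<^sub>R (u - m)) \<le> (1 - t) * v m + t * v u"
        using convex_onD[OF cv, of t m u] t by (simp add: algebra_simps)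
      then have "\<phi> (m + t *\<^sub>R (u - m)) \<le> (1 - t) * v m + t * v u + (norm ((m - z) + t *\<^sub>R (u - m)))\<^sup>2 / 2"
        unfolding \<phi>_def by (simp add: algebra_simps)
      also have "(norm ((m - z) + t *\<^sub>R (u - m)))\<^sup>2 = (norm (m - z))\<^sup>2 + 2 * t * ((m - z) \<bullet> (u - m)) + t\<^sup>2 * (norm (u - m))\<^sup>2"
        unfolding power2_norm_eq_inner
        by (simp add: inner_add_left inner_add_right inner_commute power2_eq_square algebra_simps)
      finally have "t * v m \<le> t * v u + t * ((m - z) \<bullet> (u - m)) + t\<^sup>2 * (norm (u - m))\<^sup>2 / 2"
        unfolding \<phi>_def by (simp add: field_simps)
      then have "t * v m \<le> t * (v u + (m - z) \<bullet> (u - m) + t * ((norm (u - m))\<^sup>2 / 2))"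
        by (simp add: algebra_simps power2_eq_square)
      then show ?thesis using t by simp
    qed
    have "((\<lambda>t. v u + (m - z) \<bullet> (u - m) + t * ((norm (u - m))\<^sup>2 / 2)) \<longlongrightarrow> v u + (m - z) \<bullet> (u - m) + 0 * ((norm (u - m))\<^sup>2 / 2)) (at_right 0)"
      by (intro tendsto_intros)
    moreover have "\<forall>\<^sub>F t in at_right 0. v m \<le> v u + (m - z) \<bullet> (u - m) + t * ((norm (u - m))\<^sup>2 / 2)"
      unfolding eventually_at_right_field using ineq zero_less_one by blast
    ultimately have "v m \<le> v u + (m - z) \<bullet> (u - m)"
      using tendsto_lowerbound by fastforce
    then show "v m + (z - m) \<bullet> (u - m) \<le> v u" by (simp add: inner_diff_left)
  qed
  then show ?thesis ..
qed

lemma resolvent_mem: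
  fixes v :: "'a::euclidean_space \<Rightarrow> real"
  assumes "everywhere_subdiff v"
  shows "z - resolvent v z \<in> subdiff v (resolvent v z)"
proof -
  have "\<exists>!x. z - x \<in> subdiff v x" using resolvent_exists[OF assms] resolvent_unique by metis
  then show ?thesis unfolding resolvent_def by (rule theI')
qed

lemma resolvent_eq:
  fixes v :: "'a::euclidean_space \<Rightarrow> real"
  assumes "everywhere_subdiff v" "y \<in> subdiff v x"
  shows "resolvent v (x + y) = x"
  using resolvent_unique[OF resolvent_mem[OF assms(1), of "x + y"], of x] assms(2) by simp

text \<open>Monotonicity gives firm nonexpansiveness,
  \<open>a \<bullet> a \<le> (z - w) \<bullet> a\<close>, and Cauchy-Schwarz finishes.\<close>

lemma resolvent_nonexpansive:
  fixes v :: "'a::euclidean_space \<Rightarrow> real"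
  assumes "everywhere_subdiff v"
  shows "norm (resolvent v z - resolvent v w) \<le> norm (z - w)"
proof -
  define a where "a = resolvent v z - resolvent v w"
  have "0 \<le> ((z - w) - a) \<bullet> a"
    using subdiff_monotone[OF resolvent_mem[OF assms, of z] resolvent_mem[OF assms, of w]]
    by (simp add: a_def algebra_simps)
  then have "norm a * norm a \<le> (z - w) \<bullet> a" by (simp add: inner_diff_left flip: power2_norm_eq_inner power2_eq_square)
  also have "\<dots> \<le> norm (z - w) * norm a" by (rule norm_cauchy_schwarz)
  finally show ?thesis by (cases "a = 0") (auto simp: a_def)
qed

subsection \<open>Aleksandrov's theorem\<close>

lemma le_if_le_add_eps_mult:
  fixes a b c :: real
  assumes "\<And>e. 0 < e \<Longrightarrow> a \<le> b + e * c"
  shows "a \<le> b"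
proof (rule field_le_epsilon)
  fix e :: real assume e: "0 < e"
  have "a \<le> b + (e / (\<bar>c\<bar> + 1)) * c" using e by (intro assms) auto
  also have "(e / (\<bar>c\<bar> + 1)) * c \<le> (e / (\<bar>c\<bar> + 1)) * (\<bar>c\<bar> + 1)" using e by (intro mult_left_mono) auto
  also have "\<dots> = e" by simp
  finally show "a \<le> b + e" by simp
qed

text \<open>The increments of \<open>t \<mapsto> v (x + t h)\<close> lie between those of the slopes at the two end points,
  so over \<open>m\<close> equal pieces the error beyond \<open>e |h|\<^sup>2\<close> is only \<open>O(1/m)\<close>.\<close>
lemma second_order_expansion:
  fixes v :: "'a::euclidean_space \<Rightarrow> real"
  assumes s: "\<And>x. s x \<in> subdiff v x" and der: "(s has_derivative A) (at x)" and e: "0 < e"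
  obtains d where "0 < d"
    "\<And>h. norm h < d \<Longrightarrow> norm (s (x + h) - s x - A h) \<le> e * norm h"
    "\<And>h. norm h < d \<Longrightarrow> \<bar>v (x + h) - v x - s x \<bullet> h - (A h \<bullet> h) / 2\<bar> \<le> e * (norm h)\<^sup>2"
proof -
  have lin: "linear A" using has_derivative_linear[OF der] .
  obtain d where d: "0 < d" "\<And>y. norm (y - x) < d \<Longrightarrow> norm (s y - s x - A (y - x)) \<le> e * norm (y - x)"
    using der e unfolding has_derivative_at_alt by blast
  have d': "norm (s (x + h) - s x - A h) \<le> e * norm h" if "norm h < d" for h
    using d(2)[of "x + h"] that by simp
  have "\<bar>v (x + h) - v x - s x \<bullet> h - (A h \<bullet> h) / 2\<bar> \<le> e * (norm h)\<^sup>2" if h: "norm h < d" for h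
  proof -
    define b where "b = A h \<bullet> h"
    \<comment> \<open>Along the segment this is \<open>v\<close> minus the linear and quadratic
      terms, so \<open>\<psi> 1 - \<psi> 0\<close> is exactly the remainder to be bounded.\<close>
    define \<psi> where "\<psi> = (\<lambda>t. v (x + t *\<^sub>R h) - t * (s x \<bullet> h) - t\<^sup>2 / 2 * b)"
    have slope: "\<bar>s (x + t *\<^sub>R h) \<bullet> h - s x \<bullet> h - t * b\<bar> \<le> e * (norm h)\<^sup>2" if t: "0 \<le> t" "t \<le> 1" for t
    proof -
      have "norm (t *\<^sub>R h) \<le> norm h" using t by (simp add: mult_left_le_one_le)
      then have "norm (s (x + t *\<^sub>R h) - s x - A (t *\<^sub>R h)) \<le> e * norm h"
        using d'[of "t *\<^sub>R h"] h e by (smt (verit) mult_left_mono)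
      then have "\<bar>(s (x + t *\<^sub>R h) - s x - A (t *\<^sub>R h)) \<bullet> h\<bar> \<le> (e * norm h) * norm h"
        by (meson Cauchy_Schwarz_ineq2 mult_right_mono norm_ge_zero order_trans)
      then show ?thesis
        by (simp add: b_def linear_scale[OF lin] inner_diff_left power2_eq_square mult.assoc)
    qed
    have incr: "\<bar>\<psi> t' - \<psi> t\<bar> \<le> (t' - t) * (e * (norm h)\<^sup>2) + (t' - t)\<^sup>2 / 2 * \<bar>b\<bar>"
      if t: "0 \<le> t" "t \<le> t'" "t' \<le> 1" for t t'
    proof -
      have up: "v (x + t' *\<^sub>R h) - v (x + t *\<^sub>R h) \<le> (t' - t) * (s (x + t' *\<^sub>R h) \<bullet> h)"
        using subdiffD[OF s[of "x + t' *\<^sub>R h"], of "x + t *\<^sub>R h"]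
        by (simp add: algebra_simps)
      also have "\<dots> \<le> (t' - t) * (s x \<bullet> h + t' * b + e * (norm h)\<^sup>2)"
        using slope[of t'] t by (intro mult_left_mono) (auto simp: abs_le_iff)
      finally have 1: "\<psi> t' - \<psi> t \<le> (t' - t) * (e * (norm h)\<^sup>2) + (t' - t)\<^sup>2 / 2 * b"
        unfolding \<psi>_def by (simp add: field_simps power2_eq_square)
      have "(t' - t) * (s x \<bullet> h + t * b - e * (norm h)\<^sup>2) \<le> (t' - t) * (s (x + t *\<^sub>R h) \<bullet> h)"
        using slope[of t] t by (intro mult_left_mono) (auto simp: abs_le_iff)
      also have "\<dots> \<le> v (x + t' *\<^sub>R h) - v (x + t *\<^sub>R h)"
        using subdiffD[OF s[of "x + t *\<^sub>R h"], of "x + t' *\<^sub>R h"]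
        by (simp add: algebra_simps)
      finally have 2: "- ((t' - t) * (e * (norm h)\<^sup>2) + (t' - t)\<^sup>2 / 2 * b) \<le> \<psi> t' - \<psi> t"
        unfolding \<psi>_def by (simp add: field_simps power2_eq_square)
      have "(t' - t)\<^sup>2 / 2 * b \<le> (t' - t)\<^sup>2 / 2 * \<bar>b\<bar>" by (intro mult_left_mono) auto
      then show ?thesis using 1 2 by (simp add: abs_le_iff)
    qed
    have "\<bar>\<psi> 1 - \<psi> 0\<bar> \<le> e * (norm h)\<^sup>2 + inverse (real (Suc m)) * (\<bar>b\<bar> / 2)" for m
    proof -
      define M where "M = real (Suc m)"
      have M: "0 < M" unfolding M_def by simp
      have "\<psi> 1 - \<psi> 0 = (\<Sum>i<Suc m. \<psi> (real (Suc i) / M) - \<psi> (real i / M))"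
        using M by (subst sum_lessThan_telescope) (simp add: M_def)
      also have "\<bar>\<dots>\<bar> \<le> (\<Sum>i<Suc m. \<bar>\<psi> (real (Suc i) / M) - \<psi> (real i / M)\<bar>)" by (rule sum_abs)
      also have "\<dots> \<le> (\<Sum>i<Suc m. (1 / M) * (e * (norm h)\<^sup>2) + (1 / M)\<^sup>2 / 2 * \<bar>b\<bar>)"
      proof (rule sum_mono)
        fix i assume "i \<in> {..<Suc m}"
        then have "real (Suc i) / M \<le> 1" using M unfolding M_def by simp
        moreover have "real (Suc i) / M - real i / M = 1 / M" by (simp add: diff_divide_distrib[symmetric])
        ultimately show "\<bar>\<psi> (real (Suc i) / M) - \<psi> (real i / M)\<bar> \<le> (1 / M) * (e * (norm h)\<^sup>2) + (1 / M)\<^sup>2 / 2 * \<bar>b\<bar>"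
          using incr[of "real i / M" "real (Suc i) / M"] M by (simp add: divide_right_mono)
      qed
      also have "\<dots> = M * ((1 / M) * (e * (norm h)\<^sup>2) + (1 / M)\<^sup>2 / 2 * \<bar>b\<bar>)" by (simp add: M_def)
      also have "\<dots> = e * (norm h)\<^sup>2 + inverse M * (\<bar>b\<bar> / 2)" using M by (simp add: field_simps power2_eq_square)
      finally show ?thesis by (simp add: M_def)
    qed
    then have "(\<lambda>m. e * (norm h)\<^sup>2 + inverse (real (Suc m)) * (\<bar>b\<bar> / 2)) \<longlonglongrightarrow> e * (norm h)\<^sup>2 + 0 * (\<bar>b\<bar> / 2)
        \<Longrightarrow> \<bar>\<psi> 1 - \<psi> 0\<bar> \<le> e * (norm h)\<^sup>2 + 0 * (\<bar>b\<bar> / 2)"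
      by (intro LIMSEQ_le_const[where a="\<bar>\<psi> 1 - \<psi> 0\<bar>"]) auto
    moreover have "(\<lambda>m. e * (norm h)\<^sup>2 + inverse (real (Suc m)) * (\<bar>b\<bar> / 2)) \<longlonglongrightarrow> e * (norm h)\<^sup>2 + 0 * (\<bar>b\<bar> / 2)"
      by (intro tendsto_intros LIMSEQ_inverse_real_of_nat)
    ultimately show ?thesis by (simp add: \<psi>_def b_def)
  qed
  then show thesis using that d(1) d' by blast
qed

text \<open>The subgradient at \<open>x + t *\<^sub>R a\<close> is tested at
  \<open>x + t *\<^sub>R (a + b)\<close>, and both values of \<open>v\<close> are replaced by their
  second-order expansions at \<open>x\<close>; dividing by \<open>t\<^sup>2\<close> leaves the
  inequality. It yields positivity for \<open>a = b\<close>, and symmetry after scaling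
  \<open>b\<close> by a factor tending to 0, with differentiability of \<open>s\<close> required at
  the single point \<open>x\<close> only.\<close>

lemma subdiff_derivative_asymmetry_le:
  fixes v :: "'a::euclidean_space \<Rightarrow> real"
  assumes s: "\<And>x. s x \<in> subdiff v x" and der: "(s has_derivative A) (at x)"
  shows "A a \<bullet> b - A b \<bullet> a \<le> A b \<bullet> b"
proof -
  have lin: "linear A" using has_derivative_linear[OF der] .
  define c where "c = (norm (a + b))\<^sup>2 + (norm a)\<^sup>2 + norm a * norm b"
  have "A a \<bullet> b \<le> (A a \<bullet> b + A b \<bullet> a + A b \<bullet> b) / 2 + e * c" if e: "0 < e" for e
  proof -
    obtain d where d: "0 < d"
      "\<And>h. norm h < d \<Longrightarrow> norm (s (x + h) - s x - A h) \<le> e * norm h"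
      "\<And>h. norm h < d \<Longrightarrow> \<bar>v (x + h) - v x - s x \<bullet> h - (A h \<bullet> h) / 2\<bar> \<le> e * (norm h)\<^sup>2"
      using second_order_expansion[OF s der e] by metis
    define \<nu> where "\<nu> = norm a + norm b + 1"
    have \<nu>: "0 < \<nu>" unfolding \<nu>_def by (simp add: add_nonneg_pos)
    define t where "t = d / (2 * \<nu>)"
    have t: "0 < t" unfolding t_def using d(1) \<nu> by simp
    have "t * \<nu> < d" unfolding t_def using d(1) \<nu> by simp
    then have tab: "t * (norm a + norm b + 1) < d" by (simp add: \<nu>_def)
    have "norm (t *\<^sub>R a) \<le> t * (norm a + norm b + 1)" "norm (t *\<^sub>R (a + b)) \<le> t * (norm a + norm b + 1)"
      using t norm_triangle_ineq[of a b] by (auto intro!: mult_left_mono)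
    then have n: "norm (t *\<^sub>R a) < d" "norm (t *\<^sub>R (a + b)) < d" using tab by linarith+
    have expand: "\<bar>v (x + t *\<^sub>R u) - v x - t * (s x \<bullet> u) - t\<^sup>2 / 2 * (A u \<bullet> u)\<bar> \<le> e * (t\<^sup>2 * (norm u)\<^sup>2)"
      if u: "norm (t *\<^sub>R u) < d" for u
    proof -
      have "A (t *\<^sub>R u) \<bullet> (t *\<^sub>R u) / 2 = t\<^sup>2 / 2 * (A u \<bullet> u)"
        by (simp add: linear_scale[OF lin] power2_eq_square)
      then show ?thesis using d(3)[OF u] by (simp add: power_mult_distrib)
    qed
    have 1: "v (x + t *\<^sub>R (a + b)) \<le> v x + t * (s x \<bullet> (a + b)) + t\<^sup>2 / 2 * (A (a + b) \<bullet> (a + b)) + e * (t\<^sup>2 * (norm (a + b))\<^sup>2)"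
      using expand[OF n(2)] unfolding abs_le_iff by linarith
    have 2: "v x + t * (s x \<bullet> a) + t\<^sup>2 / 2 * (A a \<bullet> a) - e * (t\<^sup>2 * (norm a)\<^sup>2) \<le> v (x + t *\<^sub>R a)"
      using expand[OF n(1)] unfolding abs_le_iff by linarith
    have 3: "v (x + t *\<^sub>R a) + t * (s (x + t *\<^sub>R a) \<bullet> b) \<le> v (x + t *\<^sub>R (a + b))"
      using subdiffD[OF s[of "x + t *\<^sub>R a"], of "x + t *\<^sub>R (a + b)"] by (simp add: algebra_simps)
    have "\<bar>(s (x + t *\<^sub>R a) - s x - A (t *\<^sub>R a)) \<bullet> b\<bar> \<le> (e * norm (t *\<^sub>R a)) * norm b"
      using d(2)[OF n(1)] by (meson Cauchy_Schwarz_ineq2 mult_right_mono norm_ge_zero order_trans)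
    then have "s x \<bullet> b + t * (A a \<bullet> b) - e * (t * (norm a * norm b)) \<le> s (x + t *\<^sub>R a) \<bullet> b"
      using t by (simp add: linear_scale[OF lin] inner_diff_left abs_le_iff mult_ac)
    from mult_left_mono[OF this, of t] t
    have 4: "t * (s x \<bullet> b) + t\<^sup>2 * (A a \<bullet> b) - e * (t\<^sup>2 * (norm a * norm b)) \<le> t * (s (x + t *\<^sub>R a) \<bullet> b)"
      by (simp add: algebra_simps power2_eq_square)
    have 5: "A (a + b) \<bullet> (a + b) = A a \<bullet> a + A a \<bullet> b + A b \<bullet> a + A b \<bullet> b"
      by (simp add: linear_add[OF lin] inner_add_left inner_add_right)
    have 6: "v (x + t *\<^sub>R (a + b)) \<le> v x + t * (s x \<bullet> a) + t * (s x \<bullet> b) + t\<^sup>2 * (A a \<bullet> a) / 2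
        + t\<^sup>2 * (A a \<bullet> b) / 2 + t\<^sup>2 * (A b \<bullet> a) / 2 + t\<^sup>2 * (A b \<bullet> b) / 2 + e * (t\<^sup>2 * (norm (a + b))\<^sup>2)"
      using 1 unfolding 5 by (simp add: algebra_simps add_divide_distrib)
    have "t\<^sup>2 * (A a \<bullet> b) \<le> t\<^sup>2 * (A a \<bullet> b) / 2 + t\<^sup>2 * (A b \<bullet> a) / 2 + t\<^sup>2 * (A b \<bullet> b) / 2
        + (e * (t\<^sup>2 * (norm (a + b))\<^sup>2) + e * (t\<^sup>2 * (norm a)\<^sup>2) + e * (t\<^sup>2 * (norm a * norm b)))"
      using 2 3 4 6 by simp
    also have "\<dots> = t\<^sup>2 * ((A a \<bullet> b + A b \<bullet> a + A b \<bullet> b) / 2 + e * c)"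
      unfolding c_def by (simp add: algebra_simps add_divide_distrib)
    finally have "t\<^sup>2 * (A a \<bullet> b) \<le> t\<^sup>2 * ((A a \<bullet> b + A b \<bullet> a + A b \<bullet> b) / 2 + e * c)" .
    then show ?thesis using t by simp
  qed
  then have "A a \<bullet> b \<le> (A a \<bullet> b + A b \<bullet> a + A b \<bullet> b) / 2" by (rule le_if_le_add_eps_mult)
  then show ?thesis by simp
qed

lemma subdiff_derivative_psd:
  fixes v :: "'a::euclidean_space \<Rightarrow> real"
  assumes "\<And>x. s x \<in> subdiff v x" "(s has_derivative A) (at x)"
  shows "0 \<le> A b \<bullet> b"
  using subdiff_derivative_asymmetry_le[OF assms, of b b] by simp

lemma subdiff_derivative_symmetric:
  fixes v :: "'a::euclidean_space \<Rightarrow> real"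
  assumes s: "\<And>x. s x \<in> subdiff v x" and der: "(s has_derivative A) (at x)"
  shows "A a \<bullet> b = A b \<bullet> a"
proof -
  have lin: "linear A" using has_derivative_linear[OF der] .
  have le: "A a \<bullet> b \<le> A b \<bullet> a" for a b
  proof (rule le_if_le_add_eps_mult)
    fix t :: real assume t: "0 < t"
    have "t * (A a \<bullet> b - A b \<bullet> a) \<le> t * (t * (A b \<bullet> b))"
      using subdiff_derivative_asymmetry_le[OF s der, of a "t *\<^sub>R b"]
      by (simp add: linear_scale[OF lin] algebra_simps)
    then show "A a \<bullet> b \<le> A b \<bullet> a + t * (A b \<bullet> b)" using t by simp
  qed
  show ?thesis using le[of a b] le[of b a] by simp
qed

lemma has_hessian_at_subdiff_derivative:
  fixes v :: "real^'n \<Rightarrow> real"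
  assumes s: "\<And>x. s x \<in> subdiff v x" and der: "(s has_derivative (\<lambda>h. A *v h)) (at x)"
  shows "has_hessian_at v A x"
  unfolding has_hessian_at_def
proof (intro conjI exI)
  have "(A *v axis j 1) \<bullet> axis i 1 = (A *v axis i 1) \<bullet> axis j 1" for i j
    by (rule subdiff_derivative_symmetric[OF s der])
  then show "transpose A = A"
    by (simp add: vec_eq_iff transpose_def inner_axis matrix_vector_mult_basis column_def)
  show "((\<lambda>y. (v y - v x - s x \<bullet> (y - x) - 1 / 2 * ((y - x) \<bullet> (A *v (y - x)))) / (norm (y - x))\<^sup>2) \<longlongrightarrow> 0) (at x)"
  proof (rule LIM_I)
    fix e :: real assume e: "0 < e"
    obtain d where d: "0 < d"
      "\<And>h. norm h < d \<Longrightarrow> \<bar>v (x + h) - v x - s x \<bullet> h - ((A *v h) \<bullet> h) / 2\<bar> \<le> e / 2 * (norm h)\<^sup>2"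
      using second_order_expansion[OF s der half_gt_zero[OF e]] by metis
    have "\<bar>(v y - v x - s x \<bullet> (y - x) - 1 / 2 * ((y - x) \<bullet> (A *v (y - x)))) / (norm (y - x))\<^sup>2\<bar> < e"
      if y: "y \<noteq> x" "norm (y - x) < d" for y
    proof -
      have n: "0 < (norm (y - x))\<^sup>2" using y(1) by simp
      have "\<bar>v y - v x - s x \<bullet> (y - x) - 1 / 2 * ((y - x) \<bullet> (A *v (y - x)))\<bar> \<le> e / 2 * (norm (y - x))\<^sup>2"
        using d(2)[OF y(2)] by (simp add: inner_commute)
      also have "\<dots> < e * (norm (y - x))\<^sup>2" using n e by simp
      finally show ?thesis using n by (simp add: abs_divide pos_divide_less_eq)
    qed
    then show "\<exists>r>0. \<forall>y. y \<noteq> x \<and> norm (y - x) < r \<longrightarrow>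
        norm ((v y - v x - s x \<bullet> (y - x) - 1 / 2 * ((y - x) \<bullet> (A *v (y - x)))) / (norm (y - x))\<^sup>2 - 0) < e"
      using d(1) by auto
  qed
qed

text \<open>Subtracting two expansions leaves a linear plus a quadratic term of order
  o(\<open>(norm h)\<^sup>2\<close>). Along rays the linear part and then the quadratic form must
  vanish. A quadratic form determines only the symmetric part of its matrix, so the symmetry
  demanded in \<open>has_hessian_at\<close> is what permits the definite description in
  \<open>Hess\<close>.\<close>

lemma has_hessian_at_unique:
  fixes v :: "real^'n \<Rightarrow> real"
  assumes A: "has_hessian_at v A x" and B: "has_hessian_at v B x"
  shows "A = B"
proof -
  obtain p q where
    p: "((\<lambda>y. (v y - v x - p \<bullet> (y - x) - 1 / 2 * ((y - x) \<bullet> (A *v (y - x)))) / (norm (y - x))\<^sup>2) \<longlongrightarrow> 0) (at x)" and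
    q: "((\<lambda>y. (v y - v x - q \<bullet> (y - x) - 1 / 2 * ((y - x) \<bullet> (B *v (y - x)))) / (norm (y - x))\<^sup>2) \<longlongrightarrow> 0) (at x)"
    using A B unfolding has_hessian_at_def by blast
  define c where "c = q - p"
  define C where "C = B - A"
  have lim: "((\<lambda>y. (c \<bullet> (y - x) + 1 / 2 * ((y - x) \<bullet> (C *v (y - x)))) / (norm (y - x))\<^sup>2) \<longlongrightarrow> 0) (at x)"
  proof -
    have "(\<lambda>y. (c \<bullet> (y - x) + 1 / 2 * ((y - x) \<bullet> (C *v (y - x)))) / (norm (y - x))\<^sup>2)
      = (\<lambda>y. (v y - v x - p \<bullet> (y - x) - 1 / 2 * ((y - x) \<bullet> (A *v (y - x)))) / (norm (y - x))\<^sup>2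
           - (v y - v x - q \<bullet> (y - x) - 1 / 2 * ((y - x) \<bullet> (B *v (y - x)))) / (norm (y - x))\<^sup>2)"
      unfolding c_def C_def diff_divide_distrib[symmetric]
      by (simp add: matrix_vector_mult_diff_rdistrib inner_diff_left inner_diff_right algebra_simps)
    then show ?thesis using tendsto_diff[OF p q] by simp
  qed
  have quad: "u \<bullet> (C *v u) = 0" for u
  proof (cases "u = 0")
    case False
    have "((\<lambda>t. x + t *\<^sub>R u) \<longlongrightarrow> x + 0 *\<^sub>R u) (at_right 0)" by (intro tendsto_intros)
    then have "filterlim (\<lambda>t. x + t *\<^sub>R u) (at x) (at_right 0)"
      unfolding filterlim_at using False by (auto simp: eventually_at_right_field intro!: exI[of _ 1])
    from filterlim_compose[OF lim this]
    have "((\<lambda>t. (c \<bullet> (t *\<^sub>R u) + 1 / 2 * ((t *\<^sub>R u) \<bullet> (C *v (t *\<^sub>R u)))) / (norm (t *\<^sub>R u))\<^sup>2) \<longlongrightarrow> 0) (at_right 0)"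
      by simp
    moreover have "(c \<bullet> (t *\<^sub>R u) + 1 / 2 * ((t *\<^sub>R u) \<bullet> (C *v (t *\<^sub>R u)))) / (norm (t *\<^sub>R u))\<^sup>2
        = (t * (c \<bullet> u) + 1 / 2 * (t\<^sup>2 * (u \<bullet> (C *v u)))) / (t\<^sup>2 * (norm u)\<^sup>2)" for t
      by (simp add: power_mult_distrib power2_eq_square[of t] matrix_vector_mult_scaleR)
    ultimately have "((\<lambda>t. (t * (c \<bullet> u) + 1 / 2 * (t\<^sup>2 * (u \<bullet> (C *v u)))) / (t\<^sup>2 * (norm u)\<^sup>2)) \<longlongrightarrow> 0) (at_right 0)"
      by simp
    from tendsto_mult_right[OF this, of "(norm u)\<^sup>2"]
    have "((\<lambda>t. (t * (c \<bullet> u) + 1 / 2 * (t\<^sup>2 * (u \<bullet> (C *v u)))) / (t\<^sup>2 * (norm u)\<^sup>2) * (norm u)\<^sup>2) \<longlongrightarrow> 0) (at_right 0)"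
      by simp
    moreover have "\<forall>\<^sub>F t in at_right 0. (t * (c \<bullet> u) + 1 / 2 * (t\<^sup>2 * (u \<bullet> (C *v u)))) / (t\<^sup>2 * (norm u)\<^sup>2) * (norm u)\<^sup>2
        = (c \<bullet> u) / t + 1 / 2 * (u \<bullet> (C *v u))"
      unfolding eventually_at_right_field using False
      by (intro exI[of _ 1]) (simp add: field_simps power2_eq_square)
    ultimately have l1: "((\<lambda>t. (c \<bullet> u) / t + 1 / 2 * (u \<bullet> (C *v u))) \<longlongrightarrow> 0) (at_right 0)"
      using tendsto_cong by force
    \<comment> \<open>Multiplying by \<open>t\<close> isolates the linear coefficient; once that is
      0, the limit relation \<open>l1\<close> is a statement about the quadratic form alone.\<close>
    have "((\<lambda>t::real. t) \<longlongrightarrow> 0) (at_right 0)" by (intro tendsto_intros)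
    from tendsto_mult[OF this l1]
    have "((\<lambda>t. t * ((c \<bullet> u) / t + 1 / 2 * (u \<bullet> (C *v u)))) \<longlongrightarrow> 0) (at_right 0)" by simp
    moreover have "\<forall>\<^sub>F t in at_right 0. t * ((c \<bullet> u) / t + 1 / 2 * (u \<bullet> (C *v u))) = c \<bullet> u + t * (1 / 2 * (u \<bullet> (C *v u)))"
      unfolding eventually_at_right_field by (intro exI[of _ 1]) (simp add: field_simps)
    ultimately have "((\<lambda>t. c \<bullet> u + t * (1 / 2 * (u \<bullet> (C *v u)))) \<longlongrightarrow> 0) (at_right 0)"
      using tendsto_cong by force
    moreover have "((\<lambda>t. c \<bullet> u + t * (1 / 2 * (u \<bullet> (C *v u)))) \<longlongrightarrow> c \<bullet> u + 0 * (1 / 2 * (u \<bullet> (C *v u)))) (at_right 0)"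
      by (intro tendsto_intros)
    ultimately have "c \<bullet> u = 0" using tendsto_unique[of "at_right (0::real)"] by fastforce
    then have "((\<lambda>t::real. 1 / 2 * (u \<bullet> (C *v u))) \<longlongrightarrow> 0) (at_right 0)" using l1 by simp
    then have "1 / 2 * (u \<bullet> (C *v u)) = 0" by (metis tendsto_const tendsto_unique trivial_limit_at_right_real)
    then show ?thesis by simp
  qed simp
  have tC: "transpose C = C" using A B unfolding has_hessian_at_def C_def
    by (simp add: transpose_def vec_eq_iff)
  have "u \<bullet> (C *v w) = 0" for u w
  proof -
    have "w \<bullet> (C *v u) = u \<bullet> (C *v w)" by (metis dot_lmul_matrix inner_commute tC transpose_matrix_vector)
    then show ?thesis using quad[of "u + w"] quad[of u] quad[of w]
      by (simp add: matrix_vector_right_distrib inner_add_left inner_add_right)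
  qed
  then have "C *v w = 0" for w by (metis inner_eq_zero_iff)
  then have "C = 0" by (metis matrix_eq matrix_vector_mult_0)
  then show ?thesis by (simp add: C_def)
qed

lemma Hess_eq: "has_hessian_at v A x \<Longrightarrow> Hess v x = A"
  unfolding Hess_def using has_hessian_at_unique by (auto intro!: the_equality)

text \<open>On the segment from the identity to \<open>A\<close> every matrix before the end point
  is positive definite, so the determinant starts at 1 and cannot pass through 0 on the way.\<close>

lemma det_nonneg_if_psd:
  fixes A :: "real^'n^'n"
  assumes psd: "\<And>h. 0 \<le> h \<bullet> (A *v h)"
  shows "0 \<le> det A"
proof (rule ccontr)
  assume neg: "\<not> 0 \<le> det A"
  define B where "B = (\<lambda>c. (1 - c) *\<^sub>R mat 1 + c *\<^sub>R A)"
  have "continuous_on {0..1} (\<lambda>c. det (B c))"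
    unfolding det_def B_def by (auto intro!: continuous_intros simp: )
  moreover have "det (B 1) \<le> 0" "0 \<le> det (B 0)" using neg by (simp_all add: B_def)
  ultimately obtain c where c: "0 \<le> c" "c \<le> 1" "det (B c) = 0"
    using IVT2'[of "\<lambda>c. det (B c)" 1 0 0] by auto
  have "c \<noteq> 1" using c(3) neg by (auto simp: B_def)
  then have c1: "c < 1" using c(2) by simp
  have "h = 0" if "B c *v h = 0" for h
  proof -
    have "h \<bullet> (B c *v h) = (1 - c) * (h \<bullet> h) + c * (h \<bullet> (A *v h))"
      by (simp add: B_def matrix_vector_mult_add_rdistrib inner_add_right scaleR_matrix_vector_assoc[symmetric])
    moreover have "0 \<le> c * (h \<bullet> (A *v h))" using c(1) psd by simp
    ultimately have "(1 - c) * (h \<bullet> h) \<le> 0" using that by simp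
    then have "h \<bullet> h \<le> 0" using c1 by (simp add: mult_le_0_iff)
    then show ?thesis by (metis inner_ge_zero inner_eq_zero_iff order_antisym)
  qed
  then have "inj ((*v) (B c))"
    using linear_injective_0[OF matrix_vector_mul_linear[of "B c"]] by simp
  then have "det (B c) \<noteq> 0"
    using det_nz_iff_inj[OF matrix_vector_mul_linear[of "B c"]] by simp
  then show False using c(3) by simp
qed

lemma borel_measurable_det_derivative:
  fixes f :: "real^'n \<Rightarrow> real^'n"
  assumes S: "S \<in> sets lebesgue"
    and der: "\<And>x. x \<in> S \<Longrightarrow> (f has_derivative f' x) (at x within S)"
  shows "(\<lambda>x. det (matrix (f' x)) * indicator S x) \<in> borel_measurable lebesgue"
proof -
  define F where "F = (\<lambda>y. copy_vec (f (uncopy_vec y)))"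
  define F' where "F' = (\<lambda>y h. copy_vec (f' (uncopy_vec y) (uncopy_vec h)))"
  let ?S = "copy_vec ` S"
  have S': "?S \<in> sets lebesgue" using emeasure_copy_image(1)[OF S] .
  have "(F has_derivative F' y) (at y within ?S)" if "y \<in> ?S" for y
    using that has_derivative_copy[OF der] unfolding F_def F'_def by auto
  then have "(\<lambda>y. det (matrix (F' y))) \<in> borel_measurable (lebesgue_on ?S)"
    by (rule borel_measurable_det_Jacobian[OF S'])
  then have m: "(\<lambda>y. det (matrix (F' y)) * indicator ?S y) \<in> borel_measurable lebesgue"
    using S' by (subst (asm) borel_measurable_restrict_space_iff) (auto simp: mult.commute)
  have "det (matrix (F' (copy_vec x))) * indicator ?S (copy_vec x) = det (matrix (f' x)) * indicator S x" for x
  proof -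
    have "copy_vec x \<in> ?S \<longleftrightarrow> x \<in> S" by (metis image_iff uncopy_copy)
    then show ?thesis by (simp add: F'_def det_matrix_copy indicator_def)
  qed
  then show ?thesis using measurable_compose[OF copy_vec_lebesgue m] by simp
qed

lemma negligible_nondifferentiable_nonexpansive:
  fixes J :: "'a::euclidean_space \<Rightarrow> 'a"
  assumes J: "\<And>z w. norm (J z - J w) \<le> norm (z - w)"
  shows "negligible {z. \<not> J differentiable (at z)}"
proof -
  have "AE z in lborel. (\<lambda>z. J z \<bullet> b) differentiable (at z)" if b: "b \<in> Basis" for b
  proof (rule rademacher)
    show "1-lipschitz_on UNIV (\<lambda>z. J z \<bullet> b)"
    proof (rule lipschitz_onI)
      fix z w
      have "\<bar>(J z - J w) \<bullet> b\<bar> \<le> norm (J z - J w)" by (rule Basis_le_norm[OF b])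
      also have "\<dots> \<le> norm (z - w)" by (rule J)
      finally show "dist (J z \<bullet> b) (J w \<bullet> b) \<le> 1 * dist z w"
        by (simp add: dist_norm inner_diff_left)
    qed simp
  qed
  then have "AE z in lborel. \<forall>b\<in>Basis. (\<lambda>z. J z \<bullet> b) differentiable (at z)"
    by (subst AE_ball_countable) (auto simp: countable_finite)
  then have "AE z in lborel. J differentiable (at z)"
    by eventually_elim (subst differentiable_componentwise_within, simp)
  then obtain N where N: "\<And>z. z \<in> space lborel - N \<Longrightarrow> J differentiable (at z)" "N \<in> null_sets lborel"
    by (rule AE_E3) blast
  have "negligible N" using N(2) by (simp add: negligible_iff_null_sets null_sets_completionI)
  then show ?thesis by (rule negligible_subset) (use N(1) in auto)
qed

text \<open>Used at an end point of the segment in two cases: for \<open>e = 0\<close> the resolvent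
  is constant on a segment, which comes from two subgradients at one point; for \<open>e = d\<close>
  it is a translation there, which comes from one subgradient shared by two points.\<close>

lemma derivative_along_segment:
  fixes J :: "'a::real_normed_vector \<Rightarrow> 'b::real_normed_vector"
  assumes der: "(J has_derivative L) (at z)"
    and seg: "\<And>t. 0 \<le> t \<Longrightarrow> t \<le> 1 \<Longrightarrow> J (z + t *\<^sub>R d) = w + t *\<^sub>R e"
  shows "L d = e"
proof -
  have lin: "linear L" using has_derivative_linear[OF der] .
  have "norm (e - L d) \<le> 0 + \<epsilon> * norm d" if \<epsilon>: "0 < \<epsilon>" for \<epsilon>
  proof -
    obtain \<delta> where \<delta>: "0 < \<delta>" "\<And>y. norm (y - z) < \<delta> \<Longrightarrow> norm (J y - J z - L (y - z)) \<le> \<epsilon> * norm (y - z)"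
      using der \<epsilon> unfolding has_derivative_at_alt by blast
    define \<nu> where "\<nu> = norm d + 1"
    define t where "t = min 1 (\<delta> / (2 * \<nu>))"
    have nd: "0 < \<nu>" by (simp add: \<nu>_def add_nonneg_pos)
    have t: "0 < t" "t \<le> 1" unfolding t_def using \<delta>(1) nd by auto
    have "t * norm d \<le> (\<delta> / (2 * \<nu>)) * \<nu>"
      using \<delta>(1) nd by (intro mult_mono) (auto simp: t_def, simp add: \<nu>_def)
    also have "\<dots> = \<delta> / 2" using nd by simp
    finally have "norm ((z + t *\<^sub>R d) - z) < \<delta>" using t \<delta>(1) by simp
    from \<delta>(2)[OF this] have "norm (t *\<^sub>R e - L (t *\<^sub>R d)) \<le> \<epsilon> * (t * norm d)"
      using seg[of t] seg[of 0] t by simp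
    also have "t *\<^sub>R e - L (t *\<^sub>R d) = t *\<^sub>R (e - L d)"
      by (simp add: linear_scale[OF lin] scaleR_right_diff_distrib)
    finally have "t * norm (e - L d) \<le> t * (\<epsilon> * norm d)" using t by (simp add: mult_ac)
    then show ?thesis using t by simp
  qed
  then have "norm (e - L d) \<le> 0" by (rule le_if_le_add_eps_mult)
  then show ?thesis by simp
qed

text \<open>Where the resolvent has an invertible derivative \<open>L\<close>, the derivative of \<open>\<partial>v\<close> is \<open>L\<^sup>-\<^sup>1 - I\<close>.\<close>
theorem aleksandrov:
  fixes v :: "real^'n \<Rightarrow> real"
  assumes v: "everywhere_subdiff v" and s: "\<And>x. s x \<in> subdiff v x"
  obtains N where "negligible N"
    "\<And>x. x \<notin> N \<Longrightarrow> subdiff v x = {s x}"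
    "\<And>x. x \<notin> N \<Longrightarrow> (s has_derivative (\<lambda>h. Hess v x *v h)) (at x)"
    "\<And>x x'. x \<notin> N \<Longrightarrow> s x \<in> subdiff v x' \<Longrightarrow> Hess v x *v (x' - x) = 0"
proof -
  define J where "J = resolvent v"
  have conv: "convex_on UNIV v" by (rule everywhere_subdiff_convex[OF v])
  have Jeq: "J (x + y) = x" if "y \<in> subdiff v x" for x y
    unfolding J_def using resolvent_eq[OF v that] .
  have Jn: "norm (J z - J w) \<le> norm (z - w)" for z w
    unfolding J_def by (rule resolvent_nonexpansive[OF v])
  define D where "D = {z. J differentiable (at z)}"
  define L where "L = (\<lambda>z. frechet_derivative J (at z))"
  have L: "(J has_derivative L z) (at z)" if "z \<in> D" for z
    using that unfolding D_def L_def by (simp add: frechet_derivative_works)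
  define Crit where "Crit = {z \<in> D. \<not> inj (L z)}"
  \<comment> \<open>A point lies outside \<open>N\<close> exactly if \<open>J\<close> is
    differentiable with injective derivative at each of its preimages. The first part is null as the
    Lipschitz image of a null set, the second by Sard.\<close>
  define N where "N = J ` (- D) \<union> J ` Crit"
  have "negligible (J ` (- D))"
  proof (rule negligible_locally_Lipschitz_image)
    show "negligible (- D)"
      using negligible_nondifferentiable_nonexpansive[of J] Jn unfolding D_def by (simp add: Collect_neg_eq)
    show "\<exists>T B. open T \<and> z \<in> T \<and> (\<forall>y\<in>- D \<inter> T. norm (J y - J z) \<le> B * norm (y - z))" for z
      by (intro exI[of _ UNIV] exI[of _ 1]) (simp add: Jn)
  qed simp
  moreover have "negligible (J ` Crit)"
    using L by (intro negligible_image_noninjective_derivative[where f'=L])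
      (auto simp: Crit_def intro: has_derivative_at_withinI)
  ultimately have N: "negligible N" unfolding N_def by simp
  have good: "z \<in> D \<and> inj (L z)" if "J z \<notin> N" for z
    using that unfolding N_def Crit_def by blast
  have main: "subdiff v x = {s x}" "(s has_derivative (\<lambda>h. Hess v x *v h)) (at x)"
    "\<And>x'. s x \<in> subdiff v x' \<Longrightarrow> Hess v x *v (x' - x) = 0" if x: "x \<notin> N" for x
  proof -
    define z where "z = x + s x"
    have Jz: "J z = x" unfolding z_def by (rule Jeq[OF s])
    have zD: "z \<in> D" and inj: "inj (L z)" using good[of z] x Jz by auto
    have der: "(J has_derivative L z) (at z)" by (rule L[OF zD])
    have lin: "linear (L z)" using has_derivative_linear[OF der] .
    show single: "subdiff v x = {s x}"
    proof -
      have "y = s x" if y: "y \<in> subdiff v x" for y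
      proof -
        \<comment> \<open>By convexity of the subdifferential, a second subgradient \<open>y\<close>
          would make \<open>J\<close> constant on the segment from \<open>x + s x\<close> to
          \<open>x + y\<close>.\<close>
        have "L z (y - s x) = 0"
        proof (rule derivative_along_segment[OF der])
          fix t :: real assume t: "0 \<le> t" "t \<le> 1"
          have "(1 - t) *\<^sub>R s x + t *\<^sub>R y \<in> subdiff v x"
            using t convex_subdiff[of v x] s y by (intro convexD_alt) auto
          from Jeq[OF this] show "J (z + t *\<^sub>R (y - s x)) = x + t *\<^sub>R 0"
            unfolding z_def by (simp add: algebra_simps)
        qed
        then have "y - s x = 0" using inj linear_0[OF lin] by (metis injD)
        then show ?thesis by simp
      qed
      then show ?thesis using s[of x] by blast
    qed
    obtain G where G: "linear G" "\<And>h. G (L z h) = h" "\<And>h. L z (G h) = h"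
      using linear_injective_isomorphism[OF lin inj] by blast
    define g where "g = (\<lambda>x'. x' + s x')"
    \<comment> \<open>Differentiating the right inverse \<open>g\<close> of \<open>J\<close>
      requires its continuity at \<open>x\<close>, which follows from upper semicontinuity once the
      subdifferential at \<open>x\<close> is a singleton.\<close>
    have sc: "isCont s x"
      unfolding continuous_at_eps_delta
    proof (intro allI impI)
      fix e :: real assume e: "0 < e"
      obtain d k0 where d: "0 < d" "\<And>k x'. k0 \<le> k \<Longrightarrow> dist x' x < d \<Longrightarrow> subdiff ((\<lambda>_::nat. v) k) x' \<subseteq> ball (s x) e"
        by (rule subdiff_upper_semicontinuous[OF cont_converges_const[OF everywhere_subdiff_continuous[OF v]],
              of "ball (s x) e" x]) (use single e in auto)
      have "dist (s x') (s x) < e" if "dist x' x < d" for x'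
        using d(2)[OF order_refl that] s[of x'] by (auto simp: dist_commute)
      then show "\<exists>d>0. \<forall>x'. dist x' x < d \<longrightarrow> dist (s x') (s x) < e" using d(1) by blast
    qed
    have "(g has_derivative G) (at x)"
    proof (rule has_derivative_inverse_basic[where f=J and f'="L z" and T=UNIV])
      show "(J has_derivative L z) (at (g x))" using der by (simp add: g_def z_def)
      show "bounded_linear G" using G(1) by (simp add: linear_linear)
      show "G \<circ> L z = id" using G(2) by auto
      show "continuous (at x) g" unfolding g_def using sc by (intro continuous_intros)
      show "J (g w) = w" for w unfolding g_def by (rule Jeq[OF s])
    qed auto
    then have "((\<lambda>x'. g x' - x') has_derivative (\<lambda>h. G h - h)) (at x)"
      by (intro has_derivative_diff has_derivative_ident)
    then have sd: "(s has_derivative (\<lambda>h. G h - h)) (at x)" by (simp add: g_def)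
    define A where "A = matrix (\<lambda>h. G h - h)"
    have A: "A *v h = G h - h" for h
      unfolding A_def using fun_cong[OF matrix_vector_mul(2)[OF has_derivative_linear[OF sd]]] by simp
    have "has_hessian_at v A x"
      using sd by (intro has_hessian_at_subdiff_derivative[OF s]) (simp add: A)
    then have H: "Hess v x = A" by (rule Hess_eq)
    then show "(s has_derivative (\<lambda>h. Hess v x *v h)) (at x)" using sd by (simp add: A)
    show "Hess v x *v (x' - x) = 0" if x': "s x \<in> subdiff v x'" for x'
    proof -
      \<comment> \<open>A subgradient shared by \<open>x\<close> and \<open>x'\<close> is shared by
        the whole segment, along which \<open>J\<close> therefore moves with unit speed; hence
        \<open>G\<close>, the inverse of \<open>L z\<close>, fixes \<open>x' - x\<close>.\<close>
      have "L z (x' - x) = x' - x"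
      proof (rule derivative_along_segment[OF der])
        fix t :: real assume t: "0 \<le> t" "t \<le> 1"
        have "s x \<in> subdiff v (x + t *\<^sub>R (x' - x))" by (rule subdiff_segment[OF conv s x' t])
        from Jeq[OF this] show "J (z + t *\<^sub>R (x' - x)) = x + t *\<^sub>R (x' - x)"
          unfolding z_def by (simp add: algebra_simps)
      qed
      then have "G (x' - x) = x' - x" using G(2)[of "x' - x"] by simp
      then show ?thesis by (simp add: H A)
    qed
  qed
  show thesis using that[OF N main] by blast
qed

section \<open>Change of variables for the Hessian determinant\<close>

definition hess_det :: "(real^'n \<Rightarrow> real) \<Rightarrow> real^'n \<Rightarrow> real" where
  "hess_det v x = det (Hess v x)"

text \<open>Away from a negligible set the subdifferential is a differentiable map whose restriction to
  \<open>{det > 0}\<close> is injective, so only the null image of \<open>{det = 0}\<close> escapes the change of variables formula.\<close>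
lemma hess_det_change_of_variables:
  fixes v :: "real^'n \<Rightarrow> real"
  assumes v: "everywhere_subdiff v"
  obtains N where "negligible N" "\<And>x. x \<notin> N \<Longrightarrow> 0 \<le> hess_det v x"
    "hess_det v \<in> borel_measurable lebesgue"
    "\<And>S. S \<in> sets lebesgue \<Longrightarrow> bounded S \<Longrightarrow> S \<inter> N = {} \<Longrightarrow>
        (\<Union>x\<in>S. subdiff v x) \<in> sets lebesgue \<and>
        emeasure lebesgue (\<Union>x\<in>S. subdiff v x) = (\<integral>\<^sup>+x\<in>S. ennreal (hess_det v x) \<partial>lebesgue)"
proof -
  have "\<forall>x. \<exists>p. p \<in> subdiff v x" using v unfolding everywhere_subdiff_def by blast
  then obtain s where s: "\<And>x. s x \<in> subdiff v x" by metis
  obtain N where N: "negligible N"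
    "\<And>x. x \<notin> N \<Longrightarrow> subdiff v x = {s x}"
    "\<And>x. x \<notin> N \<Longrightarrow> (s has_derivative (\<lambda>h. Hess v x *v h)) (at x)"
    "\<And>x x'. x \<notin> N \<Longrightarrow> s x \<in> subdiff v x' \<Longrightarrow> Hess v x *v (x' - x) = 0"
    using aleksandrov[OF v s] by metis
  have NL: "- N \<in> sets lebesgue" "N \<in> null_sets lebesgue"
    using N(1) by (auto simp: negligible_iff_null_sets dest: null_setsD2 intro: Compl_in_sets_lebesgue[THEN iffD2])
  have mat: "matrix ((*v) A) = A" for A :: "real^'n^'n" by simp
  have nonneg: "0 \<le> hess_det v x" if "x \<notin> N" for x
    unfolding hess_det_def
    using subdiff_derivative_psd[OF s N(3)[OF that]] by (intro det_nonneg_if_psd) (simp add: inner_commute)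
  have dw: "(s has_derivative (*v) (Hess v x)) (at x within S)" if "x \<in> S" "S \<inter> N = {}" for x S
  proof -
    have "x \<notin> N" using that by blast
    then show ?thesis by (rule has_derivative_at_withinI[OF N(3)])
  qed
  have meas: "hess_det v \<in> borel_measurable lebesgue"
  proof -
    have "(\<lambda>x. det (matrix ((*v) (Hess v x))) * indicator (- N) x) \<in> borel_measurable lebesgue"
    proof (rule borel_measurable_det_derivative[where f = s and f' = "\<lambda>x. (*v) (Hess v x)", OF NL(1)])
      show "(s has_derivative (*v) (Hess v x)) (at x within - N)" if "x \<in> - N" for x
        using that by (rule dw) simp
    qed
    then have "(\<lambda>x. hess_det v x * indicator (- N) x) \<in> borel_measurable lebesgue"
      unfolding mat hess_det_def .
    moreover have "AE x in lebesgue. hess_det v x * indicator (- N) x = hess_det v x"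
      using AE_not_in[OF NL(2)] by eventually_elim simp
    ultimately show ?thesis
      by (rule borel_measurable_AE)
  qed
  have img: "(\<Union>x\<in>S. subdiff v x) \<in> sets lebesgue \<and>
        emeasure lebesgue (\<Union>x\<in>S. subdiff v x) = (\<integral>\<^sup>+x\<in>S. ennreal (hess_det v x) \<partial>lebesgue)"
    if S: "S \<in> sets lebesgue" "bounded S" "S \<inter> N = {}" for S
  proof -
    have Us: "(\<Union>x\<in>S. subdiff v x) = s ` S" using N(2) S(3) by auto
    define P where "P = {x \<in> S. hess_det v x \<noteq> 0}"
    define Q where "Q = {x \<in> S. hess_det v x = 0}"
    have P: "P \<in> sets lebesgue"
    proof -
      have "P = S \<inter> (hess_det v -` (- {0}) \<inter> space lebesgue)" unfolding P_def by auto
      then show ?thesis using S(1) measurable_sets[OF meas, of "- {0}"] by auto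
    qed
    have SPQ: "s ` S = s ` P \<union> s ` Q" unfolding P_def Q_def by auto
    \<comment> \<open>Two points with a common subgradient differ by a vector in the kernel of the
      Hessian, and that kernel is trivial on \<open>P\<close>.\<close>
    have inj: "inj_on s P"
    proof (rule inj_onI)
      fix x x' assume xx: "x \<in> P" "x' \<in> P" "s x = s x'"
      have xN: "x \<notin> N" using xx(1) S(3) unfolding P_def by auto
      have "Hess v x *v (x' - x) = 0" using N(4)[OF xN, of x'] s[of x'] xx(3) by simp
      moreover have "inj ((*v) (Hess v x))"
        using xx(1) det_nz_iff_inj[OF matrix_vector_mul_linear[of "Hess v x"]] by (simp add: P_def hess_det_def)
      ultimately have "x' - x = 0" by (metis injD matrix_vector_mult_0_right)
      then show "x = x'" by simp
    qed
    have "bounded (\<Union>x\<in>S. subdiff v x)" by (rule bounded_subdiff_image[OF v S(2)])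
    then have bP: "bounded (s ` P)" by (rule bounded_subset) (use s in \<open>auto simp: P_def\<close>)
    have PN: "P \<inter> N = {}" "Q \<inter> N = {}" using S(3) unfolding P_def Q_def by auto
    have cv: "s ` P \<in> sets lebesgue"
      "emeasure lebesgue (s ` P) = (\<integral>\<^sup>+x. ennreal \<bar>det (matrix ((*v) (Hess v x)))\<bar> * indicator P x \<partial>lebesgue)"
      using emeasure_differentiable_image[OF P dw[OF _ PN(1)] inj bP] by auto
    have "negligible (s ` Q)"
    proof (rule negligible_image_noninjective_derivative[OF dw[OF _ PN(2)]])
      show "\<not> inj ((*v) (Hess v x))" if "x \<in> Q" for x
        using that det_nz_iff_inj[OF matrix_vector_mul_linear[of "Hess v x"]] by (simp add: Q_def hess_det_def)
    qed
    then have Q: "s ` Q \<in> null_sets lebesgue" by (simp add: negligible_iff_null_sets)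
    have "emeasure lebesgue (s ` S) = emeasure lebesgue (s ` P)"
      unfolding SPQ using cv(1) Q by (intro emeasure_Un_null_set)
    also have "\<dots> = (\<integral>\<^sup>+x\<in>S. ennreal (hess_det v x) \<partial>lebesgue)"
      unfolding cv(2) mat
    proof (rule nn_integral_cong)
      fix x
      show "ennreal \<bar>det (Hess v x)\<bar> * indicator P x = ennreal (hess_det v x) * indicator S x"
      proof (cases "x \<in> S")
        case True
        then have "0 \<le> hess_det v x" using S(3) by (intro nonneg) auto
        then show ?thesis using True by (simp add: P_def indicator_def hess_det_def)
      qed (simp add: P_def)
    qed
    finally show ?thesis unfolding Us using SPQ cv(1) Q by auto
  qed
  show thesis using that[OF N(1) nonneg meas img] by blast
qed

subsection \<open>The Monge-Ampere measure and epi-convergence\<close>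

text \<open>A maximiser \<open>w\<close> in \<open>K\<close> at \<open>x\<close> gives an affine
  minorant of \<open>v\<close> touching it at \<open>x\<close>, with slope
  \<open>fst w\<close>.\<close>

lemma ConvMA_everywhere_subdiff:
  fixes v :: "real^'n \<Rightarrow> real"
  assumes "v \<in> ConvMA"
  shows "everywhere_subdiff v"
proof -
  obtain K :: "((real^'n) \<times> real) set" where K: "K \<noteq> {}" "compact K"
    and v: "v = (\<lambda>x. support_fun K (x, -1))"
    using assms unfolding ConvMA_def by blast
  have "\<exists>p. p \<in> subdiff v x" for x
  proof -
    have cont: "continuous_on K (\<lambda>w. (z, - 1) \<bullet> w)" for z :: "real^'n" by (intro continuous_intros)
    obtain w where w: "w \<in> K" "\<And>w'. w' \<in> K \<Longrightarrow> (x, - 1) \<bullet> w' \<le> (x, - 1) \<bullet> w"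
      using continuous_attains_sup[OF K(2,1) cont[of x]] by blast
    have vx: "v x = (x, - 1) \<bullet> w"
      unfolding v support_fun_def using w by (intro cSup_eq_maximum) auto
    have vz: "(z, - 1) \<bullet> w \<le> v z" for z
    proof -
      have "bdd_above ((\<lambda>w. (z, - 1) \<bullet> w) ` K)"
        by (intro bounded_imp_bdd_above compact_imp_bounded compact_continuous_image cont K(2))
      then show ?thesis unfolding v support_fun_def using w(1) by (intro cSup_upper) auto
    qed
    have "fst w \<in> subdiff v x"
      unfolding subdiff_def
    proof (clarify)
      fix z
      show "v x + fst w \<bullet> (z - x) \<le> v z"
        using vz[of z] unfolding vx by (cases w) (simp add: inner_diff_right inner_commute)
    qed
    then show ?thesis ..
  qed
  then show ?thesis by (auto simp: everywhere_subdiff_def)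
qed

lemma AE_hess_det_nonneg:
  assumes "everywhere_subdiff v"
  shows "AE x in lebesgue. 0 \<le> hess_det v x"
proof -
  obtain N where N: "negligible N" "\<And>x. x \<notin> N \<Longrightarrow> 0 \<le> hess_det v x"
    using hess_det_change_of_variables[OF assms] by metis
  show ?thesis using N by (intro AE_I'[of N]) (auto simp: negligible_iff_null_sets)
qed

lemma borel_measurable_hess_det:
  assumes "everywhere_subdiff v"
  shows "hess_det v \<in> borel_measurable lebesgue"
  using hess_det_change_of_variables[OF assms] by metis

text \<open>Removing \<open>N\<close> leaves the integral unchanged but may shrink the image, since
  the singular part of the Monge-Ampere measure can live over \<open>N\<close>; hence an inequality.
  The measurable superset \<open>T\<close> takes the place of the image of \<open>S\<close>, whose
  measurability is not at hand.\<close>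

lemma nn_integral_hess_det_le:
  assumes v: "everywhere_subdiff v" and S: "S \<in> sets lebesgue" "bounded S"
    and T: "T \<in> sets lebesgue" "\<And>x. x \<in> S \<Longrightarrow> subdiff v x \<subseteq> T"
  shows "(\<integral>\<^sup>+x\<in>S. ennreal (hess_det v x) \<partial>lebesgue) \<le> emeasure lebesgue T"
proof -
  obtain N where N: "negligible N"
    "\<And>S. S \<in> sets lebesgue \<Longrightarrow> bounded S \<Longrightarrow> S \<inter> N = {} \<Longrightarrow>
        (\<Union>x\<in>S. subdiff v x) \<in> sets lebesgue \<and>
        emeasure lebesgue (\<Union>x\<in>S. subdiff v x) = (\<integral>\<^sup>+x\<in>S. ennreal (hess_det v x) \<partial>lebesgue)"
    by (rule hess_det_change_of_variables[OF v], rule that) assumption+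
  have Nn: "N \<in> null_sets lebesgue" using N(1) by (simp add: negligible_iff_null_sets)
  have "(\<integral>\<^sup>+x\<in>S. ennreal (hess_det v x) \<partial>lebesgue) = (\<integral>\<^sup>+x\<in>S - N. ennreal (hess_det v x) \<partial>lebesgue)"
    by (rule nn_integral_cong_AE, use AE_not_in[OF Nn] in eventually_elim) (auto simp: indicator_def)
  also have "\<dots> = emeasure lebesgue (\<Union>x\<in>S - N. subdiff v x)"
  proof -
    have "S - N \<in> sets lebesgue" "bounded (S - N)" "(S - N) \<inter> N = {}"
      using S Nn by (auto intro: bounded_subset)
    from N(2)[OF this] show ?thesis by simp
  qed
  also have "\<dots> \<le> emeasure lebesgue T" using T by (intro emeasure_mono) auto
  finally show ?thesis .
qed

text \<open>By Lindelof the complement of the support is a countable union of open sets of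
  Monge-Ampere measure 0, and each of these is exhausted by compact sets, on which the integral
  estimate applies.\<close>

lemma hess_det_zero_off_MA_supp:
  fixes v :: "real^'n \<Rightarrow> real"
  assumes v: "everywhere_subdiff v"
  shows "AE x in lebesgue. x \<notin> MA_supp v \<longrightarrow> hess_det v x = 0"
proof -
  define \<F> where "\<F> = {U :: (real^'n) set. open U \<and> MA v U = 0}"
  obtain \<G> where \<G>: "\<G> \<subseteq> \<F>" "countable \<G>" "\<Union>\<G> = \<Union>\<F>"
    using Lindelof[of \<F>] unfolding \<F>_def by (metis (no_types, lifting) mem_Collect_eq)
  have "AE x in lebesgue. x \<in> U \<longrightarrow> hess_det v x = 0" if "U \<in> \<G>" for U
  proof -
    have U: "open U" "emeasure lebesgue (\<Union>x\<in>U. subdiff v x) = 0"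
      using that \<G>(1) unfolding \<F>_def MA_def by auto
    obtain C :: "nat \<Rightarrow> (real^'n) set" where C: "\<And>n. compact (C n)" "\<And>n. C n \<subseteq> U" "\<Union>(range C) = U"
      using open_Union_compact_subsets[OF U(1)] by metis
    have cC: "(\<Union>x\<in>C n. subdiff v x) \<in> sets lebesgue" for n
      using compact_subdiff_image[OF v C(1)] by (simp add: borel_compact)
    have Ueq: "(\<Union>x\<in>U. subdiff v x) = (\<Union>n. \<Union>x\<in>C n. subdiff v x)" using C(3) by blast
    \<comment> \<open>\<open>emeasure\<close> is 0 on nonmeasurable sets, so the vanishing of
      \<open>MA v U\<close> bounds the integral only once the image of \<open>U\<close> is known to
      be measurable.\<close>
    have sU: "(\<Union>x\<in>U. subdiff v x) \<in> sets lebesgue" unfolding Ueq using cC by blast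
    have "AE x in lebesgue. x \<in> C n \<longrightarrow> hess_det v x = 0" for n
    proof -
      have Cl: "C n \<in> sets lebesgue" using C(1) by (simp add: borel_compact)
      have "(\<integral>\<^sup>+x\<in>C n. ennreal (hess_det v x) \<partial>lebesgue) \<le> emeasure lebesgue (\<Union>x\<in>U. subdiff v x)"
        using C(1,2) Cl sU by (intro nn_integral_hess_det_le[OF v]) (auto intro: compact_imp_bounded)
      then have "(\<integral>\<^sup>+x\<in>C n. ennreal (hess_det v x) \<partial>lebesgue) = 0" using U(2) by simp
      moreover have "(\<lambda>x. ennreal (hess_det v x) * indicator (C n) x) \<in> borel_measurable lebesgue"
        using borel_measurable_hess_det[OF v] Cl by measurable
      ultimately have "AE x in lebesgue. ennreal (hess_det v x) * indicator (C n) x = 0"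
        by (simp add: nn_integral_0_iff_AE)
      then show ?thesis
        using AE_hess_det_nonneg[OF v] by eventually_elim (auto simp: indicator_def split: if_splits)
    qed
    then have "AE x in lebesgue. \<forall>n. x \<in> C n \<longrightarrow> hess_det v x = 0" by (intro AE_all_countable[THEN iffD2] allI)
    then show ?thesis by eventually_elim (use C(3) in blast)
  qed
  then have "AE x in lebesgue. \<forall>U\<in>\<G>. x \<in> U \<longrightarrow> hess_det v x = 0"
    by (subst AE_ball_countable[OF \<G>(2)]) blast
  then show ?thesis
  proof eventually_elim
    case (elim x)
    have "x \<in> \<Union>\<F>" if "x \<notin> MA_supp v" using that unfolding MA_supp_def \<F>_def by auto
    then show ?case using elim \<G>(3) by blast
  qed
qed

section \<open>From epi-convergence to continuous convergence\<close>

lemma exists_coordinate_descent: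
  fixes a :: "'a::euclidean_space"
  obtains b \<sigma> where "b \<in> Basis" "\<bar>\<sigma>\<bar> = (1::real)" "real DIM('a) * (a \<bullet> (\<sigma> *\<^sub>R b)) \<le> - norm a"
proof -
  \<comment> \<open>Some coordinate reaches the average of the absolute coordinates, whose sum
    dominates the Euclidean norm. Choosing the sign then makes the step a descent for
    \<open>a\<close>.\<close>
  have "\<exists>b\<in>Basis. norm a \<le> real DIM('a) * \<bar>a \<bullet> b\<bar>"
  proof (rule ccontr)
    assume "\<not> ?thesis"
    then have "real DIM('a) * \<bar>a \<bullet> b\<bar> < norm a" if "b \<in> Basis" for b using that by force
    then have "(\<Sum>b\<in>Basis. real DIM('a) * \<bar>a \<bullet> b\<bar>) < (\<Sum>b\<in>(Basis::'a set). norm a)"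
      by (intro sum_strict_mono) auto
    then have "real DIM('a) * (\<Sum>b\<in>Basis. \<bar>a \<bullet> b\<bar>) < real DIM('a) * norm a"
      by (simp add: sum_distrib_left)
    then show False using norm_le_l1[of a] by simp
  qed
  then obtain b where b: "b \<in> Basis" "norm a \<le> real DIM('a) * \<bar>a \<bullet> b\<bar>" by blast
  show thesis
  proof (cases "0 \<le> a \<bullet> b")
    case True then show ?thesis using that[of b "-1"] b by simp
  next
    case False then show ?thesis using that[of b 1] b by simp
  qed
qed

text \<open>Values along recovery sequences at the points \<open>\<plusminus>R b\<close> bound \<open>v\<^sub>k\<close> on a ball, since the hull of
  these slightly perturbed points still contains that ball.\<close>
lemma epi_converges_bounded_above:
  fixes v :: "'a::euclidean_space \<Rightarrow> real"
  assumes conv: "\<And>k. convex_on UNIV (vs k)" and epi: "epi_converges vs v" and \<rho>: "0 < \<rho>"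
  obtains M k0 where "\<And>k p. k0 \<le> k \<Longrightarrow> norm p \<le> \<rho> \<Longrightarrow> vs k p \<le> M"
proof -
  \<comment> \<open>With this radius coordinate descent finds a \<open>q\<close> with
    \<open>a \<bullet> q \<le> - 2 * \<rho> * norm a\<close>. Perturbing \<open>q\<close> by less
    than \<open>\<rho>\<close> uses up half of the margin, and the other half covers every
    \<open>p\<close> in the ball, so no hyperplane separates \<open>p\<close> from the hull.\<close>
  define R where "R = 2 * real DIM('a) * \<rho>"
  define Q where "Q = (\<lambda>(b, \<sigma>). (\<sigma> * R) *\<^sub>R b) ` ((Basis :: 'a set) \<times> {-1, 1 :: real})"
  have Q: "finite Q" "Q \<noteq> {}" unfolding Q_def by auto
  have "\<forall>q. \<exists>\<xi>. \<xi> \<longlonglongrightarrow> q \<and> (\<lambda>k. vs k (\<xi> k)) \<longlonglongrightarrow> v q"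
    using epi unfolding epi_converges_def by blast
  then obtain \<xi> where \<xi>: "\<And>q. \<xi> q \<longlonglongrightarrow> q" "\<And>q. (\<lambda>k. vs k (\<xi> q k)) \<longlonglongrightarrow> v q" by metis
  define M where "M = Max (v ` Q) + 1"
  have "\<forall>\<^sub>F k in sequentially. dist (\<xi> q k) q < \<rho> \<and> vs k (\<xi> q k) < M" if q: "q \<in> Q" for q
  proof -
    have "v q \<le> Max (v ` Q)" using Q(1) q by (intro Max_ge) auto
    then have "v q < M" unfolding M_def by simp
    then show ?thesis
      using tendstoD[OF \<xi>(1) \<rho>] order_tendstoD(2)[OF \<xi>(2)] by (auto intro: eventually_conj)
  qed
  then have "\<forall>\<^sub>F k in sequentially. \<forall>q\<in>Q. dist (\<xi> q k) q < \<rho> \<and> vs k (\<xi> q k) < M"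
    using Q(1) by (simp add: eventually_ball_finite)
  then obtain k0 where k0: "\<And>k q. k0 \<le> k \<Longrightarrow> q \<in> Q \<Longrightarrow> dist (\<xi> q k) q < \<rho> \<and> vs k (\<xi> q k) < M"
    unfolding eventually_sequentially by blast
  have "vs k p \<le> M" if k: "k0 \<le> k" and p: "norm p \<le> \<rho>" for k p
  proof -
    define H where "H = convex hull ((\<lambda>q. \<xi> q k) ` Q)"
    have "p \<in> H"
    proof (rule ccontr)
      assume "p \<notin> H"
      have "compact H" unfolding H_def using Q(1) by (simp add: finite_imp_compact_convex_hull)
      then have "closed H" by (rule compact_imp_closed)
      then obtain a \<beta> where a: "a \<bullet> p < \<beta>" "\<And>x. x \<in> H \<Longrightarrow> \<beta> < a \<bullet> x"
        using separating_hyperplane_closed_point[of H p] \<open>p \<notin> H\<close> unfolding H_def by auto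
      obtain b \<sigma> where b: "b \<in> Basis" "\<bar>\<sigma>\<bar> = (1::real)" "real DIM('a) * (a \<bullet> (\<sigma> *\<^sub>R b)) \<le> - norm a"
        by (rule exists_coordinate_descent)
      define q where "q = (\<sigma> * R) *\<^sub>R b"
      have "\<sigma> = 1 \<or> \<sigma> = -1" using b(2) by (auto simp: abs_if split: if_splits)
      then have q: "q \<in> Q" unfolding Q_def q_def using b(1) by force
      have "a \<bullet> q = 2 * \<rho> * (real DIM('a) * (a \<bullet> (\<sigma> *\<^sub>R b)))" unfolding q_def R_def by simp
      also have "\<dots> \<le> 2 * \<rho> * (- norm a)" using b(3) \<rho> by (intro mult_left_mono) auto
      finally have 1: "a \<bullet> q \<le> - 2 * \<rho> * norm a" by simp
      have "a \<bullet> (\<xi> q k - q) \<le> norm a * norm (\<xi> q k - q)" by (rule norm_cauchy_schwarz)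
      also have "\<dots> \<le> norm a * \<rho>" using k0[OF k q] by (intro mult_left_mono) (auto simp: dist_norm)
      finally have 2: "a \<bullet> \<xi> q k \<le> a \<bullet> q + norm a * \<rho>" by (simp add: inner_diff_right)
      have "- (a \<bullet> p) \<le> norm a * norm p" using norm_cauchy_schwarz[of "- a" p] by simp
      also have "\<dots> \<le> norm a * \<rho>" using p by (intro mult_left_mono) auto
      finally have 3: "- (norm a * \<rho>) \<le> a \<bullet> p" by simp
      have "\<xi> q k \<in> H" unfolding H_def using q by (intro hull_inc) auto
      from a(2)[OF this] a(1) 1 2 3 show False by (simp add: algebra_simps)
    qed
    moreover have "\<forall>x\<in>H. vs k x \<le> M"
      unfolding H_def
    proof (rule convex_on_convex_hull_bound)
      show "convex_on (convex hull ((\<lambda>q. \<xi> q k) ` Q)) (vs k)"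
        by (rule convex_on_subset[OF conv]) (auto simp: convex_convex_hull)
      show "\<forall>x\<in>(\<lambda>q. \<xi> q k) ` Q. vs k x \<le> M" using k0[OF k] by (auto intro: less_imp_le)
    qed
    ultimately show ?thesis by blast
  qed
  then show thesis using that by blast
qed

text \<open>The lower bound is obtained from the upper one by reflection: 0 is the midpoint of
  \<open>p\<close> and \<open>- p\<close>, the liminf inequality bounds \<open>vs k 0\<close> from
  below, and \<open>vs k (- p)\<close> is bounded above.\<close>

lemma epi_converges_bounded:
  fixes v :: "'a::euclidean_space \<Rightarrow> real"
  assumes conv: "\<And>k. convex_on UNIV (vs k)" and epi: "epi_converges vs v" and \<rho>: "0 < \<rho>"
  obtains M k0 where "\<And>k p. k0 \<le> k \<Longrightarrow> norm p \<le> \<rho> \<Longrightarrow> \<bar>vs k p\<bar> \<le> M"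
proof -
  obtain M k0 where M: "\<And>k p. k0 \<le> k \<Longrightarrow> norm p \<le> \<rho> \<Longrightarrow> vs k p \<le> M"
    using epi_converges_bounded_above[OF assms] by metis
  have "ereal (v 0 - 1) < ereal (v 0)" by simp
  also have "\<dots> \<le> liminf (\<lambda>k. ereal (vs k 0))"
    using epi tendsto_const[of 0 sequentially] unfolding epi_converges_def by blast
  finally have "\<forall>\<^sub>F k in sequentially. ereal (v 0 - 1) < ereal (vs k 0)" by (rule less_LiminfD)
  then obtain k1 where k1: "\<And>k. k1 \<le> k \<Longrightarrow> v 0 - 1 < vs k 0" unfolding eventually_sequentially by auto
  have "\<bar>vs k p\<bar> \<le> \<bar>M\<bar> + 2 * (\<bar>v 0\<bar> + 1)" if k: "max k0 k1 \<le> k" and p: "norm p \<le> \<rho>" for k p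
  proof -
    have "vs k ((1 - 1 / 2) *\<^sub>R p + (1 / 2) *\<^sub>R (- p)) \<le> (1 - 1 / 2) * vs k p + 1 / 2 * vs k (- p)"
      by (rule convex_onD[OF conv]) auto
    then have 1: "2 * vs k 0 \<le> vs k p + vs k (- p)" by simp
    have 2: "vs k p \<le> M" "vs k (- p) \<le> M" using M[of k p] M[of k "- p"] k p by auto
    have 3: "v 0 - 1 < vs k 0" using k1 k by simp
    define m w where "m = \<bar>M\<bar>" and "w = \<bar>v 0\<bar>"
    have 4: "M \<le> m" "- w \<le> v 0" "0 \<le> w" unfolding m_def w_def by auto
    have "vs k p \<le> m + 2 * (w + 1)" using 2(1) 4(1,3) by argo
    moreover have "- vs k p \<le> m + 2 * (w + 1)" using 1 2(2) 3 4 by argo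
    ultimately have "\<bar>vs k p\<bar> \<le> m + 2 * (w + 1)" unfolding abs_le_iff by blast
    then show ?thesis unfolding m_def w_def .
  qed
  then show thesis using that by blast
qed

text \<open>Uniform bounds on the ball of radius \<open>norm x + 2\<close> bound the subgradients on
  that of radius \<open>norm x + 1\<close>, so the \<open>vs k\<close> are equi-Lipschitz there. The
  convergence along a recovery sequence then carries over to every nearby point.\<close>

lemma epi_converges_imp_cont_converges:
  fixes v :: "'a::euclidean_space \<Rightarrow> real"
  assumes vs: "\<And>k. everywhere_subdiff (vs k)" and epi: "epi_converges vs v"
  shows "cont_converges vs v"
  unfolding cont_converges_def
proof (intro allI impI)
  fix x :: 'a and e :: real assume e: "0 < e"
  have "0 < norm x + 2" by (simp add: add_nonneg_pos)
  then obtain M k0 where M: "\<And>k p. k0 \<le> k \<Longrightarrow> norm p \<le> norm x + 2 \<Longrightarrow> \<bar>vs k p\<bar> \<le> M"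
    using epi_converges_bounded[OF everywhere_subdiff_convex[OF vs] epi] by metis
  have M0: "0 \<le> M" using M[of k0 0] by fastforce
  have lip: "vs k q - vs k p \<le> 2 * M * norm (q - p)" if k: "k0 \<le> k" and q: "norm q \<le> norm x + 1" for k p q
  proof -
    obtain y where y: "y \<in> subdiff (vs k) q" using vs[of k] unfolding everywhere_subdiff_def by blast
    have "norm y \<le> 2 * M / 1"
    proof (rule norm_subdiff_le[OF y])
      fix z assume "norm (z - q) \<le> 1"
      then have "norm z \<le> norm x + 2" using norm_triangle_sub[of z q] q by linarith
      then show "\<bar>vs k z\<bar> \<le> M" by (rule M[OF k])
    qed simp
    then have "norm y * norm (q - p) \<le> 2 * M * norm (q - p)" by (intro mult_right_mono) auto
    moreover have "vs k q - vs k p \<le> y \<bullet> (q - p)" using subdiffD[OF y, of p] by (simp add: inner_diff_right)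
    ultimately show ?thesis using norm_cauchy_schwarz[of y "q - p"] by linarith
  qed
  obtain \<xi> where \<xi>: "\<xi> \<longlonglongrightarrow> x" "(\<lambda>k. vs k (\<xi> k)) \<longlonglongrightarrow> v x"
    using epi unfolding epi_converges_def by blast
  \<comment> \<open>Both \<open>x'\<close> and \<open>\<xi> k\<close> lie within \<open>d\<close> of
    \<open>x\<close>, hence within \<open>2 * d\<close> of each other; the 8 makes the Lipschitz
    error \<open>2 * M * (2 * d)\<close> at most \<open>e / 2\<close>.\<close>
  define d where "d = min 1 (e / (8 * (M + 1)))"
  have d: "0 < d" "d \<le> 1" unfolding d_def using e M0 by auto
  have Md: "2 * M * (2 * d) \<le> e / 2"
  proof -
    have "d * (8 * (M + 1)) \<le> e" using M0 by (simp add: d_def min_mult_distrib_right)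
    then show ?thesis using d(1) by (simp add: algebra_simps)
  qed
  have "\<forall>\<^sub>F k in sequentially. k0 \<le> k \<and> dist (\<xi> k) x < d \<and> dist (vs k (\<xi> k)) (v x) < e / 2"
    using tendstoD[OF \<xi>(1) d(1)] tendstoD[OF \<xi>(2) half_gt_zero[OF e]]
    by (intro eventually_conj eventually_ge_at_top)
  then obtain k1 where k1: "\<And>k. k1 \<le> k \<Longrightarrow> k0 \<le> k \<and> dist (\<xi> k) x < d \<and> dist (vs k (\<xi> k)) (v x) < e / 2"
    unfolding eventually_sequentially by blast
  have "\<bar>vs k x' - v x\<bar> < e" if k: "k1 \<le> k" and x': "dist x' x < d" for k x'
  proof -
    have k0: "k0 \<le> k" and \<xi>k: "norm (\<xi> k - x) < d" and vk: "\<bar>vs k (\<xi> k) - v x\<bar> < e / 2"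
      using k1[OF k] by (auto simp: dist_norm)
    have xx: "norm (x' - x) < d" using x' by (simp add: dist_norm)
    have n: "norm x' \<le> norm x + 1" "norm (\<xi> k) \<le> norm x + 1"
      using norm_triangle_sub[of x' x] norm_triangle_sub[of "\<xi> k" x] xx \<xi>k d(2) by auto
    have "norm (x' - \<xi> k) \<le> norm (x' - x) + norm (\<xi> k - x)"
      using norm_triangle_ineq4[of "x' - x" "\<xi> k - x"] by simp
    then have "norm (x' - \<xi> k) \<le> 2 * d" using xx \<xi>k by linarith
    then have "2 * M * norm (x' - \<xi> k) \<le> 2 * M * (2 * d)" using M0 by (intro mult_left_mono) auto
    then have "2 * M * norm (x' - \<xi> k) \<le> e / 2" using Md by linarith
    moreover have "vs k (\<xi> k) - vs k x' \<le> 2 * M * norm (x' - \<xi> k)"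
      using lip[OF k0 n(2), of x'] by (simp add: norm_minus_commute)
    ultimately have "\<bar>vs k x' - vs k (\<xi> k)\<bar> \<le> e / 2"
      using lip[OF k0 n(1), of "\<xi> k"] unfolding abs_le_iff by linarith
    then show ?thesis using vk by linarith
  qed
  then show "\<exists>d>0. \<exists>k0. \<forall>k\<ge>k0. \<forall>x'. dist x' x < d \<longrightarrow> \<bar>vs k x' - v x\<bar> < e"
    using d(1) by blast
qed

subsection \<open>Upper semicontinuity\<close>

text \<open>The integrand of \<open>Zfun\<close> is the case \<open>p = 1 / (n + 2)\<close>,
  \<open>q = n / (n + 2)\<close>.\<close>

definition zdensity :: "real \<Rightarrow> real \<Rightarrow> (real^'n \<Rightarrow> real) \<Rightarrow> real^'n \<Rightarrow> real" where
  "zdensity p q v x = hess_det v x powr p * exp (- q * v x)"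

text \<open>Young's inequality for \<open>t powr p * s powr (1 - p)\<close>, multiplied by
  \<open>s powr (p - 1)\<close>.\<close>

lemma powr_le_tangent:
  fixes s t p :: real
  assumes "0 < p" "p < 1" "0 < s" "0 \<le> t"
  shows "t powr p \<le> (1 - p) * s powr p + p * s powr (p - 1) * t"
proof (cases "t = 0")
  case True
  then show ?thesis using assms by simp
next
  case False
  have "t powr p * s powr (1 - p) \<le> p * t + (1 - p) * s"
    using assms False by (intro Youngs_inequality_0) auto
  then have "t powr p * s powr (1 - p) * s powr (p - 1) \<le> (p * t + (1 - p) * s) * s powr (p - 1)"
    by (intro mult_right_mono) auto
  moreover have "t powr p * s powr (1 - p) * s powr (p - 1) = t powr p"
    using assms by (simp add: mult.assoc flip: powr_add)
  moreover have "s * s powr (p - 1) = s powr p"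
    using assms by (simp add: powr_diff)
  then have "(p * t + (1 - p) * s) * s powr (p - 1) = (1 - p) * s powr p + p * s powr (p - 1) * t"
    by (simp add: algebra_simps)
  ultimately show ?thesis by simp
qed

lemma continuous_borel_measurable_lebesgue:
  fixes v :: "'a::euclidean_space \<Rightarrow> real"
  assumes "continuous_on UNIV v"
  shows "v \<in> borel_measurable lebesgue"
  using borel_measurable_continuous_onI[OF assms] by (simp add: measurable_completion)

lemma borel_measurable_zdensity:
  assumes "everywhere_subdiff v"
  shows "zdensity p q v \<in> borel_measurable lebesgue"
proof -
  note [measurable] = borel_measurable_hess_det[OF assms]
    continuous_borel_measurable_lebesgue[OF everywhere_subdiff_continuous[OF assms]]
  show ?thesis unfolding zdensity_def by measurable
qed

lemma zdensity_nonneg [simp]: "0 \<le> zdensity p q v x"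
  by (simp add: zdensity_def)

text \<open>The point of tangency \<open>\<sigma>\<close> stays free: a bound on the average
  Monge-Ampere density makes the estimate sharp, a large value makes the coefficient of the volume
  of \<open>T\<close> small, and 1 suffices for finiteness.\<close>

lemma nn_integral_zdensity_le:
  fixes v :: "real^'n \<Rightarrow> real"
  assumes v: "everywhere_subdiff v" and p: "0 < p" "p < 1" and \<sigma>: "0 < \<sigma>"
    and S: "S \<in> sets lebesgue" "bounded S"
    and \<tau>: "0 \<le> \<tau>" "\<And>x. x \<in> S \<Longrightarrow> exp (- q * v x) \<le> \<tau>"
    and T: "T \<in> sets lebesgue" "\<And>x. x \<in> S \<Longrightarrow> subdiff v x \<subseteq> T"
  shows "(\<integral>\<^sup>+x\<in>S. ennreal (zdensity p q v x) \<partial>lebesgue)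
    \<le> ennreal (\<tau> * ((1 - p) * \<sigma> powr p)) * emeasure lebesgue S
      + ennreal (\<tau> * (p * \<sigma> powr (p - 1))) * emeasure lebesgue T"
proof -
  define A where "A = \<tau> * ((1 - p) * \<sigma> powr p)"
  define B where "B = \<tau> * (p * \<sigma> powr (p - 1))"
  have AB: "0 \<le> A" "0 \<le> B" unfolding A_def B_def using p \<tau>(1) by auto
  note [measurable] = borel_measurable_hess_det[OF v] S(1)
  have "(\<integral>\<^sup>+x\<in>S. ennreal (zdensity p q v x) \<partial>lebesgue)
      \<le> (\<integral>\<^sup>+x. ennreal A * indicator S x + ennreal B * (ennreal (hess_det v x) * indicator S x) \<partial>lebesgue)"
  proof (rule nn_integral_mono_AE, use AE_hess_det_nonneg[OF v] in eventually_elim)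
    case (elim x)
    show ?case
    proof (cases "x \<in> S")
      case True
      have "zdensity p q v x \<le> hess_det v x powr p * \<tau>"
        unfolding zdensity_def using \<tau>(2)[OF True] by (intro mult_left_mono) auto
      also have "\<dots> \<le> ((1 - p) * \<sigma> powr p + p * \<sigma> powr (p - 1) * hess_det v x) * \<tau>"
        using powr_le_tangent[OF p \<sigma> elim] \<tau>(1) by (intro mult_right_mono)
      also have "\<dots> = A + B * hess_det v x" unfolding A_def B_def by (simp add: algebra_simps)
      finally have "ennreal (zdensity p q v x) \<le> ennreal (A + B * hess_det v x)" by (rule ennreal_leI)
      also have "\<dots> = ennreal A + ennreal B * ennreal (hess_det v x)"
        using AB elim by (simp add: ennreal_plus ennreal_mult)
      finally show ?thesis using True by simp
    qed simp
  qed
  also have "\<dots> = ennreal A * emeasure lebesgue S + ennreal B * (\<integral>\<^sup>+x\<in>S. ennreal (hess_det v x) \<partial>lebesgue)"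
    by (subst nn_integral_add) (simp_all add: nn_integral_cmult nn_integral_cmult_indicator)
  also have "\<dots> \<le> ennreal A * emeasure lebesgue S + ennreal B * emeasure lebesgue T"
    by (intro add_left_mono mult_left_mono nn_integral_hess_det_le[OF v S T]) auto
  finally show ?thesis unfolding A_def B_def .
qed

text \<open>Off the support the determinant vanishes almost everywhere and
  \<open>0 powr p = 0\<close>, so restricting to \<open>C\<close> loses nothing although the
  exponential weight alone need not decay.\<close>

lemma Zfun_eq_nn_integral:
  fixes v :: "real^'n \<Rightarrow> real"
  assumes v: "everywhere_subdiff v" and C: "MA_supp v \<subseteq> C" and C': "C \<in> sets lebesgue"
  shows "Zfun v = (\<integral>\<^sup>+x\<in>C. ennreal (zdensity (1 / (real CARD('n) + 2)) (real CARD('n) / (real CARD('n) + 2)) v x) \<partial>lebesgue)"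
  unfolding Zfun_def zdensity_def hess_det_def[symmetric]
proof (rule nn_integral_cong_AE, use hess_det_zero_off_MA_supp[OF v] in eventually_elim)
  case (elim x)
  then show ?case using C by (cases "x \<in> C") auto
qed

text \<open>Upper semicontinuity and continuous convergence hold near each point of \<open>F\<close>
  from some index on; a finite subcover yields one neighbourhood and one index for both
  conditions.\<close>

lemma subdiff_and_exp_near_compact:
  fixes v :: "'a::euclidean_space \<Rightarrow> real"
  assumes conv: "cont_converges vs v" and F: "compact F"
    and W: "open W" "\<And>x. x \<in> F \<Longrightarrow> subdiff v x \<subseteq> W"
    and \<tau>: "\<And>x. x \<in> F \<Longrightarrow> exp (- q * v x) < \<tau>"
  obtains U k0 where "open U" "bounded U" "F \<subseteq> U"
    "\<And>k x. k0 \<le> k \<Longrightarrow> x \<in> U \<Longrightarrow> subdiff (vs k) x \<subseteq> W \<and> exp (- q * vs k x) < \<tau>"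
proof -
  have "\<exists>d k0. 0 < d \<and> (\<forall>k\<ge>k0. \<forall>x'. dist x' x < d \<longrightarrow> subdiff (vs k) x' \<subseteq> W \<and> exp (- q * vs k x') < \<tau>)"
    if x: "x \<in> F" for x
  proof -
    obtain d1 k1 where 1: "0 < d1" "\<And>k x'. k1 \<le> k \<Longrightarrow> dist x' x < d1 \<Longrightarrow> subdiff (vs k) x' \<subseteq> W"
      by (rule subdiff_upper_semicontinuous[OF conv W(1) W(2)[OF x]], rule that) assumption+
    have "isCont (\<lambda>a. exp (- q * a)) (v x)" by (intro continuous_intros)
    moreover have "0 < \<tau> - exp (- q * v x)" using \<tau>[OF x] by simp
    ultimately obtain \<epsilon> where \<epsilon>: "0 < \<epsilon>"
      "\<And>a. dist a (v x) < \<epsilon> \<Longrightarrow> dist (exp (- q * a)) (exp (- q * v x)) < \<tau> - exp (- q * v x)"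
      unfolding continuous_at_eps_delta by blast
    obtain d2 k2 where 2: "0 < d2" "\<And>k x'. k2 \<le> k \<Longrightarrow> dist x' x < d2 \<Longrightarrow> \<bar>vs k x' - v x\<bar> < \<epsilon>"
      by (rule cont_convergesD[OF conv \<epsilon>(1)], rule that) assumption+
    have "exp (- q * vs k x') < \<tau>" if "k2 \<le> k" "dist x' x < d2" for k x'
      using \<epsilon>(2)[of "vs k x'"] 2(2)[OF that] by (simp add: dist_real_def abs_less_iff)
    then have "\<forall>k\<ge>max k1 k2. \<forall>x'. dist x' x < min d1 d2 \<longrightarrow> subdiff (vs k) x' \<subseteq> W \<and> exp (- q * vs k x') < \<tau>"
      using 1(2) by simp
    then show ?thesis using 1(1) 2(1) by (intro exI[of _ "min d1 d2"] exI[of _ "max k1 k2"]) simp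
  qed
  then obtain d \<kappa> where d: "\<And>x. x \<in> F \<Longrightarrow> 0 < d x"
    "\<And>x k x'. x \<in> F \<Longrightarrow> \<kappa> x \<le> k \<Longrightarrow> dist x' x < d x \<Longrightarrow> subdiff (vs k) x' \<subseteq> W \<and> exp (- q * vs k x') < \<tau>"
    by metis
  have "F \<subseteq> (\<Union>x\<in>F. ball x (d x))" using d(1) by auto
  then obtain D where D: "D \<subseteq> F" "finite D" "F \<subseteq> (\<Union>x\<in>D. ball x (d x))"
    using compactE_image[OF F, of F "\<lambda>x. ball x (d x)"] by (metis open_ball)
  define U where "U = (\<Union>x\<in>D. ball x (d x))"
  \<comment> \<open>The inserted 0 keeps \<open>Max\<close> meaningful when \<open>F\<close> is
    empty.\<close>
  define k0 where "k0 = Max (insert 0 (\<kappa> ` D))"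
  have "open U" "bounded U" "F \<subseteq> U" unfolding U_def using D by auto
  moreover have "subdiff (vs k) x \<subseteq> W \<and> exp (- q * vs k x) < \<tau>" if k: "k0 \<le> k" and x: "x \<in> U" for k x
  proof -
    obtain y where y: "y \<in> D" "dist x y < d y" using x unfolding U_def by (auto simp: dist_commute)
    have "\<kappa> y \<le> k0" unfolding k0_def using D(2) y(1) by (intro Max_ge) auto
    then show ?thesis using d(2)[of y k x] y D(1) k by auto
  qed
  ultimately show thesis using that by blast
qed

lemma exists_open_superset_emeasure_le:
  fixes S :: "'a::euclidean_space set"
  assumes S: "S \<in> sets lebesgue" and e: "0 < e"
  obtains W where "open W" "S \<subseteq> W" "emeasure lebesgue W \<le> emeasure lebesgue S + ennreal e"
proof -
  obtain W where W: "open W" "S \<subseteq> W" "W - S \<in> lmeasurable" "emeasure lebesgue (W - S) < ennreal e"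
    using sets_lebesgue_outer_open[OF S e] by metis
  have "emeasure lebesgue W = emeasure lebesgue (S \<union> (W - S))" using W(2) by (simp add: Un_absorb1)
  also have "\<dots> \<le> emeasure lebesgue S + emeasure lebesgue (W - S)"
    using S W(3) by (intro emeasure_subadditive) auto
  also have "\<dots> \<le> emeasure lebesgue S + ennreal e" using W(4) by (intro add_left_mono) simp
  finally show thesis using that W(1,2) by blast
qed

text \<open>With tangency at \<open>\<sigma>\<close>, the volume of \<open>F\<close> enters with
  factor \<open>(1 - p) * \<sigma> powr p\<close>, and its image, at most \<open>\<sigma>\<close>
  times as large, with factor \<open>p * \<sigma> powr (p - 1)\<close>. These add up to
  \<open>\<sigma> powr p\<close>; the weight contributes \<open>\<tau>\<close>.\<close>

lemma zdensity_local_upper_bound: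
  fixes v :: "real^'n \<Rightarrow> real"
  assumes vs: "\<And>k. everywhere_subdiff (vs k)" and conv: "cont_converges vs v"
    and p: "0 < p" "p < 1" and F: "compact F"
    and sF: "(\<Union>x\<in>F. subdiff v x) \<in> sets lebesgue"
    and \<sigma>: "0 < \<sigma>" "emeasure lebesgue (\<Union>x\<in>F. subdiff v x) \<le> ennreal \<sigma> * emeasure lebesgue F"
    and \<tau>: "0 < \<tau>" "\<And>x. x \<in> F \<Longrightarrow> exp (- q * v x) < \<tau>" and e: "0 < e"
  obtains U k0 where "open U" "F \<subseteq> U"
    "\<And>k. k0 \<le> k \<Longrightarrow> (\<integral>\<^sup>+x\<in>U. ennreal (zdensity p q (vs k) x) \<partial>lebesgue)
        \<le> ennreal (\<sigma> powr p * \<tau>) * emeasure lebesgue F + ennreal e"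
proof -
  define A where "A = \<tau> * ((1 - p) * \<sigma> powr p)"
  define B where "B = \<tau> * (p * \<sigma> powr (p - 1))"
  have AB: "0 < A" "0 < B" unfolding A_def B_def using p \<tau>(1) \<sigma>(1) by auto
  \<comment> \<open>The open sets around \<open>F\<close> and around its image each exceed them by
    at most \<open>e'\<close>, at a cost of \<open>A * e'\<close> and \<open>B * e'\<close>.\<close>
  define e' where "e' = e / (A + B)"
  have e': "0 < e'" "(A + B) * e' = e" unfolding e'_def using e AB by auto
  have Fl: "F \<in> lmeasurable" using F by (simp add: lmeasurable_compact)
  define f where "f = measure lebesgue F"
  have f: "emeasure lebesgue F = ennreal f" "0 \<le> f" unfolding f_def using Fl by (simp_all add: emeasure_eq_measure2)
  obtain W where W: "open W" "(\<Union>x\<in>F. subdiff v x) \<subseteq> W"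
      "emeasure lebesgue W \<le> emeasure lebesgue (\<Union>x\<in>F. subdiff v x) + ennreal e'"
    using exists_open_superset_emeasure_le[OF sF e'(1)] by metis
  obtain U1 where U1: "open U1" "F \<subseteq> U1" "emeasure lebesgue U1 \<le> emeasure lebesgue F + ennreal e'"
    using exists_open_superset_emeasure_le[OF _ e'(1), of F] Fl by (metis fmeasurableD)
  have W': "subdiff v x \<subseteq> W" if "x \<in> F" for x using W(2) that by blast
  obtain U2 k0 where U2: "open U2" "bounded U2" "F \<subseteq> U2"
    "\<And>k x. k0 \<le> k \<Longrightarrow> x \<in> U2 \<Longrightarrow> subdiff (vs k) x \<subseteq> W \<and> exp (- q * vs k x) < \<tau>"
    by (rule subdiff_and_exp_near_compact[OF conv F W(1) W' \<tau>(2)], assumption+, rule that) assumption+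
  define U where "U = U1 \<inter> U2"
  have U: "open U" "F \<subseteq> U" "bounded U" unfolding U_def using U1 U2 by (auto intro: bounded_subset)
  have Ul: "U \<in> sets lebesgue" "U1 \<in> sets lebesgue" "W \<in> sets lebesgue" using U(1) U1(1) W(1) by auto
  have eU: "emeasure lebesgue U \<le> ennreal (f + e')"
  proof -
    have "emeasure lebesgue U \<le> emeasure lebesgue U1" using Ul by (intro emeasure_mono) (auto simp: U_def)
    also have "\<dots> \<le> ennreal (f + e')" using U1(3) f e'(1) by simp
    finally show ?thesis .
  qed
  have eW: "emeasure lebesgue W \<le> ennreal (\<sigma> * f + e')"
  proof -
    have "emeasure lebesgue W \<le> ennreal \<sigma> * ennreal f + ennreal e'"
      using W(3) \<sigma>(2) f(1) by (metis add_right_mono order_trans)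
    also have "\<dots> = ennreal (\<sigma> * f + e')" using \<sigma>(1) f(2) e'(1) by (simp add: ennreal_mult ennreal_plus)
    finally show ?thesis .
  qed
  have "(\<integral>\<^sup>+x\<in>U. ennreal (zdensity p q (vs k) x) \<partial>lebesgue) \<le> ennreal (\<sigma> powr p * \<tau>) * emeasure lebesgue F + ennreal e"
    if k: "k0 \<le> k" for k
  proof -
    have "(\<integral>\<^sup>+x\<in>U. ennreal (zdensity p q (vs k) x) \<partial>lebesgue) \<le> ennreal A * emeasure lebesgue U + ennreal B * emeasure lebesgue W"
      unfolding A_def B_def
      by (rule nn_integral_zdensity_le[OF vs p \<sigma>(1) Ul(1) U(3)])
         (use \<tau>(1) Ul U2(4)[OF k] in \<open>auto simp: U_def intro: less_imp_le\<close>)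
    also have "\<dots> \<le> ennreal A * ennreal (f + e') + ennreal B * ennreal (\<sigma> * f + e')"
      by (intro add_mono mult_left_mono eU eW) auto
    also have "\<dots> = ennreal (A * (f + e') + B * (\<sigma> * f + e'))"
      using AB f(2) e'(1) \<sigma>(1) by (simp add: ennreal_mult ennreal_plus)
    also have "A * (f + e') + B * (\<sigma> * f + e') = \<sigma> powr p * \<tau> * f + e"
    proof -
      have "\<sigma> * \<sigma> powr (p - 1) = \<sigma> powr p" using \<sigma>(1) by (simp add: powr_diff)
      then have "A + B * \<sigma> = \<sigma> powr p * \<tau>" unfolding A_def B_def by (simp add: algebra_simps)
      moreover have "A * (f + e') + B * (\<sigma> * f + e') = (A + B * \<sigma>) * f + (A + B) * e'" by (simp add: algebra_simps)
      ultimately show ?thesis using e'(2) by simp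
    qed
    also have "ennreal (\<sigma> powr p * \<tau> * f + e) = ennreal (\<sigma> powr p * \<tau>) * emeasure lebesgue F + ennreal e"
      using f \<tau>(1) e by (simp add: ennreal_mult ennreal_plus)
    finally show ?thesis .
  qed
  then show thesis using that U(1,2) by blast
qed

lemma exp_bounded_on_compact:
  fixes v :: "'a::euclidean_space \<Rightarrow> real"
  assumes v: "everywhere_subdiff v" and C: "compact C"
  obtains \<tau> where "0 < \<tau>" "\<And>x. x \<in> C \<Longrightarrow> exp (- q * v x) < \<tau>"
proof -
  have "compact ((\<lambda>x. exp (- q * v x)) ` C)"
    using everywhere_subdiff_continuous[OF v]
    by (intro compact_continuous_image C continuous_intros) (auto intro: continuous_on_subset)
  then have "bounded ((\<lambda>x. exp (- q * v x)) ` C)" by (rule compact_imp_bounded)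
  then obtain b where b: "\<And>x. x \<in> C \<Longrightarrow> exp (- q * v x) \<le> b" unfolding bounded_iff by force
  show thesis
    using b by (intro that[of "max b 0 + 1"]) force+
qed

text \<open>Eventually all subgradients over \<open>C\<close> lie in one ball \<open>W\<close>.
  Since \<open>p < 1\<close>, a large \<open>\<sigma>\<close> makes the contribution of
  \<open>W\<close> at most \<open>e / 2\<close> whatever \<open>R\<close> is; only afterwards is
  \<open>\<delta>\<close> chosen, because \<open>A\<close> grows with
  \<open>\<sigma>\<close>.\<close>

lemma zdensity_uniformly_integrable:
  fixes v :: "real^'n \<Rightarrow> real"
  assumes v: "everywhere_subdiff v" and vs: "\<And>k. everywhere_subdiff (vs k)" and conv: "cont_converges vs v"
    and p: "0 < p" "p < 1" and C: "compact C" and e: "0 < e"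
  obtains \<delta> k0 where "0 < \<delta>"
    "\<And>k R. k0 \<le> k \<Longrightarrow> R \<in> sets lebesgue \<Longrightarrow> R \<subseteq> C \<Longrightarrow> emeasure lebesgue R \<le> ennreal \<delta> \<Longrightarrow>
        (\<integral>\<^sup>+x\<in>R. ennreal (zdensity p q (vs k) x) \<partial>lebesgue) \<le> ennreal e"
proof -
  obtain r where r: "(\<Union>x\<in>C. subdiff v x) \<subseteq> ball 0 r"
    using bounded_subdiff_image[OF v compact_imp_bounded[OF C]] bounded_subset_ballD by metis
  define W where "W = ball (0 :: real^'n) r"
  obtain \<tau> where \<tau>: "0 < \<tau>" "\<And>x. x \<in> C \<Longrightarrow> exp (- q * v x) < \<tau>"
    using exp_bounded_on_compact[OF v C] by metis
  have W': "subdiff v x \<subseteq> W" if "x \<in> C" for x using r that unfolding W_def by blast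
  have Wo: "open W" unfolding W_def by simp
  obtain U k0 where U: "open U" "bounded U" "C \<subseteq> U"
    "\<And>k x. k0 \<le> k \<Longrightarrow> x \<in> U \<Longrightarrow> subdiff (vs k) x \<subseteq> W \<and> exp (- q * vs k x) < \<tau>"
    by (rule subdiff_and_exp_near_compact[OF conv C Wo W' \<tau>(2)], assumption+, rule that) assumption+
  define m where "m = measure lebesgue W"
  have m: "emeasure lebesgue W = ennreal m" "0 \<le> m"
    unfolding m_def W_def by (simp_all add: emeasure_eq_measure2 lmeasurable_ball)
  \<comment> \<open>A strictly positive bound for the volume of \<open>W\<close>, safe as a divisor
    even if \<open>m = 0\<close>.\<close>
  define g where "g = m + 1"
  have g: "0 < g" unfolding g_def using m(2) by simp
  \<comment> \<open>\<open>c\<close> and \<open>\<sigma>\<close> solve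
    \<open>\<tau> * p * \<sigma> powr (p - 1) * g = e / 2\<close>, that is,
    \<open>B * g = e / 2\<close>.\<close>
  define c where "c = 2 * \<tau> * p * g / e"
  have c: "0 < c" unfolding c_def using \<tau>(1) p(1) g e by simp
  define \<sigma> where "\<sigma> = c powr (1 / (1 - p))"
  have \<sigma>: "0 < \<sigma>" unfolding \<sigma>_def using c by simp
  have "1 / (1 - p) * (p - 1) = - 1" using p by (simp add: field_simps)
  then have "\<sigma> powr (p - 1) = c powr - 1" unfolding \<sigma>_def by (simp add: powr_powr)
  also have "c powr - 1 = 1 / c" using c by (simp add: powr_minus_divide)
  also have "1 / c = e / (2 * \<tau> * p * g)" by (simp add: c_def)
  finally have \<sigma>c: "\<sigma> powr (p - 1) = e / (2 * \<tau> * p * g)" .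
  define B where "B = \<tau> * (p * \<sigma> powr (p - 1))"
  define A where "A = \<tau> * ((1 - p) * \<sigma> powr p)"
  have AB: "0 < A" "0 < B" unfolding A_def B_def using p \<tau>(1) \<sigma> by auto
  have Bm: "B * m \<le> e / 2"
  proof -
    have "B * g = e / 2" unfolding B_def \<sigma>c using \<tau>(1) p(1) g by simp
    then show ?thesis using AB(2) by (simp add: g_def algebra_simps)
  qed
  define \<delta> where "\<delta> = e / (2 * A)"
  have \<delta>: "0 < \<delta>" "A * \<delta> = e / 2" unfolding \<delta>_def using e AB by auto
  have "(\<integral>\<^sup>+x\<in>R. ennreal (zdensity p q (vs k) x) \<partial>lebesgue) \<le> ennreal e"
    if k: "k0 \<le> k" and R: "R \<in> sets lebesgue" "R \<subseteq> C" "emeasure lebesgue R \<le> ennreal \<delta>" for k R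
  proof -
    have "(\<integral>\<^sup>+x\<in>R. ennreal (zdensity p q (vs k) x) \<partial>lebesgue) \<le> ennreal A * emeasure lebesgue R + ennreal B * emeasure lebesgue W"
      unfolding A_def B_def
    proof (rule nn_integral_zdensity_le[OF vs p \<sigma> R(1)])
      show "bounded R" using R(2) compact_imp_bounded[OF C] bounded_subset by blast
      have "x \<in> U" if "x \<in> R" for x using that R(2) U(3) by blast
      then show "exp (- q * vs k x) \<le> \<tau>" "subdiff (vs k) x \<subseteq> W" if "x \<in> R" for x
        using U(4)[OF k] that by (auto intro: less_imp_le)
    qed (use \<tau>(1) Wo in auto)
    also have "\<dots> \<le> ennreal A * ennreal \<delta> + ennreal B * ennreal m"
      unfolding m(1) by (intro add_right_mono mult_left_mono R(3)) auto
    also have "\<dots> = ennreal (A * \<delta> + B * m)"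
      using AB \<delta>(1) m(2) by (simp add: ennreal_mult ennreal_plus)
    also have "\<dots> \<le> ennreal e" using Bm \<delta>(2) by (intro ennreal_leI) simp
    finally show ?thesis .
  qed
  then show thesis using that \<delta>(1) by blast
qed

lemma nn_integral_zdensity_finite:
  fixes v :: "real^'n \<Rightarrow> real"
  assumes v: "everywhere_subdiff v" and p: "0 < p" "p < 1" and C: "compact C"
  shows "(\<integral>\<^sup>+x\<in>C. ennreal (zdensity p q v x) \<partial>lebesgue) < \<infinity>"
proof -
  obtain \<tau> where \<tau>: "0 < \<tau>" "\<And>x. x \<in> C \<Longrightarrow> exp (- q * v x) < \<tau>"
    using exp_bounded_on_compact[OF v C] by metis
  define T where "T = (\<Union>x\<in>C. subdiff v x)"
  have T: "compact T" unfolding T_def by (rule compact_subdiff_image[OF v C])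
  have "(\<integral>\<^sup>+x\<in>C. ennreal (zdensity p q v x) \<partial>lebesgue)
    \<le> ennreal (\<tau> * ((1 - p) * 1 powr p)) * emeasure lebesgue C + ennreal (\<tau> * (p * 1 powr (p - 1))) * emeasure lebesgue T"
  proof (rule nn_integral_zdensity_le[OF v p])
    show "exp (- q * v x) \<le> \<tau>" if "x \<in> C" for x using \<tau>(2)[OF that] by simp
  qed (use \<tau>(1) T C in \<open>auto simp: T_def intro: compact_imp_bounded lmeasurable_compact fmeasurableD\<close>)
  also have "\<dots> < \<infinity>"
    using lmeasurable_compact[OF C] lmeasurable_compact[OF T]
    by (auto simp: ennreal_mult_less_top fmeasurable_def simp del: emeasure_completion)
  finally show ?thesis .
qed

text \<open>Off a negligible set, \<open>C\<close> is cut along the level sets of the density of the Monge-Ampere measure and of the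
  exponential weight; on a compact part of each piece the local upper bound is sharp up to the mesh \<open>\<eta>\<close>, and
  the left-over part of \<open>C\<close> is controlled by uniform integrability.\<close>
lemma zdensity_eventually_le:
  fixes v :: "real^'n \<Rightarrow> real"
  assumes v: "everywhere_subdiff v" and vs: "\<And>k. everywhere_subdiff (vs k)" and conv: "cont_converges vs v"
    and p: "0 < p" "p < 1" and C: "compact C" and \<eta>: "0 < \<eta>" and e: "0 < e"
  shows "\<forall>\<^sub>F k in sequentially. (\<integral>\<^sup>+x\<in>C. ennreal (zdensity p q (vs k) x) \<partial>lebesgue)
    \<le> (\<integral>\<^sup>+x\<in>C. ennreal ((hess_det v x + \<eta>) powr p * (exp (- q * v x) + \<eta>)) \<partial>lebesgue) + ennreal e"
proof -
  obtain N where N: "negligible N" "\<And>x. x \<notin> N \<Longrightarrow> 0 \<le> hess_det v x"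
    "\<And>S. S \<in> sets lebesgue \<Longrightarrow> bounded S \<Longrightarrow> S \<inter> N = {} \<Longrightarrow>
        (\<Union>x\<in>S. subdiff v x) \<in> sets lebesgue \<and>
        emeasure lebesgue (\<Union>x\<in>S. subdiff v x) = (\<integral>\<^sup>+x\<in>S. ennreal (hess_det v x) \<partial>lebesgue)"
    by (rule hess_det_change_of_variables[OF v], rule that) assumption+
  have Nn: "N \<in> null_sets lebesgue" using N(1) by (simp add: negligible_iff_null_sets)
  then have Nl: "N \<in> sets lebesgue" by auto
  have Cl: "C \<in> sets lebesgue" and Cfin: "emeasure lebesgue C < \<infinity>"
    using lmeasurable_compact[OF C] by (auto simp: fmeasurable_def simp del: emeasure_completion)
  define a where "a = hess_det v"
  define w where "w = (\<lambda>x. exp (- q * v x))"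
  have am: "a \<in> borel_measurable lebesgue" unfolding a_def by (rule borel_measurable_hess_det[OF v])
  have wm: "w \<in> borel_measurable lebesgue"
    using continuous_borel_measurable_lebesgue[OF everywhere_subdiff_continuous[OF v]] unfolding w_def by measurable
  \<comment> \<open>Cells of a half-open grid of mesh \<open>\<eta>\<close> in the pair
    (determinant, weight). Being half-open they are disjoint, and off \<open>N\<close> both
    coordinates are nonnegative, so natural indices cover everything.\<close>
  define B where "B = (\<lambda>\<iota> :: nat \<times> nat. {x \<in> C - N. real (fst \<iota>) * \<eta> \<le> a x \<and> a x < (real (fst \<iota>) + 1) * \<eta> \<and>
      real (snd \<iota>) * \<eta> \<le> w x \<and> w x < (real (snd \<iota>) + 1) * \<eta>})"
  have Bl: "B \<iota> \<in> sets lebesgue" for \<iota>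
  proof -
    have "{x \<in> space lebesgue. real (fst \<iota>) * \<eta> \<le> a x \<and> a x < (real (fst \<iota>) + 1) * \<eta> \<and>
      real (snd \<iota>) * \<eta> \<le> w x \<and> w x < (real (snd \<iota>) + 1) * \<eta>} \<in> sets lebesgue"
      using am wm by measurable
    moreover have "B \<iota> = (C - N) \<inter> {x \<in> space lebesgue. real (fst \<iota>) * \<eta> \<le> a x \<and> a x < (real (fst \<iota>) + 1) * \<eta> \<and>
      real (snd \<iota>) * \<eta> \<le> w x \<and> w x < (real (snd \<iota>) + 1) * \<eta>}"
      unfolding B_def by auto
    ultimately show ?thesis using Cl Nl by auto
  qed
  have same_level: "i = j" if "real i * \<eta> \<le> y" "y < (real i + 1) * \<eta>" "real j * \<eta> \<le> y" "y < (real j + 1) * \<eta>" for i j y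
  proof -
    have "real i * \<eta> < (real j + 1) * \<eta>" "real j * \<eta> < (real i + 1) * \<eta>" using that by linarith+
    then show ?thesis using \<eta> by simp
  qed
  have Bdisj: "B \<iota> \<inter> B \<kappa> = {}" if "\<iota> \<noteq> \<kappa>" for \<iota> \<kappa>
  proof (rule ccontr)
    assume "B \<iota> \<inter> B \<kappa> \<noteq> {}"
    then obtain x where "x \<in> B \<iota>" "x \<in> B \<kappa>" by blast
    then have "fst \<iota> = fst \<kappa>" "snd \<iota> = snd \<kappa>"
      unfolding B_def by (auto intro: same_level)
    then show False using that by (simp add: prod_eq_iff)
  qed
  \<comment> \<open>Besides the part of \<open>C\<close> in \<open>N\<close>, this contains the
    points at which one of the two levels is at least \<open>M\<close>; it shrinks into
    \<open>N\<close> as \<open>M\<close> grows.\<close>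
  define R where "R = (\<lambda>M :: nat. C - (\<Union>\<iota>\<in>{..<M} \<times> {..<M}. B \<iota>))"
  have Rl: "R M \<in> sets lebesgue" for M unfolding R_def using Cl Bl by auto
  have "(\<Inter>M. R M) \<subseteq> N"
  proof
    fix x assume x: "x \<in> (\<Inter>M. R M)"
    show "x \<in> N"
    proof (rule ccontr)
      assume xN: "x \<notin> N"
      have level: "real (nat \<lfloor>y / \<eta>\<rfloor>) * \<eta> \<le> y \<and> y < (real (nat \<lfloor>y / \<eta>\<rfloor>) + 1) * \<eta>" if "0 \<le> y" for y
      proof -
        have "0 \<le> y / \<eta>" using that \<eta> by simp
        then have "real (nat \<lfloor>y / \<eta>\<rfloor>) \<le> y / \<eta>" "y / \<eta> < real (nat \<lfloor>y / \<eta>\<rfloor>) + 1" by linarith+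
        then show ?thesis using \<eta> by (simp add: pos_le_divide_eq pos_divide_less_eq)
      qed
      define i where "i = nat \<lfloor>a x / \<eta>\<rfloor>"
      define j where "j = nat \<lfloor>w x / \<eta>\<rfloor>"
      have "x \<in> C" using x unfolding R_def by auto
      then have "x \<in> B (i, j)"
        unfolding B_def i_def j_def using xN level[of "a x"] level[of "w x"] N(2)[OF xN] by (simp add: a_def w_def)
      moreover have "x \<in> R (Suc (max i j))" using x by blast
      ultimately show False unfolding R_def by auto
    qed
  qed
  then have "emeasure lebesgue (\<Inter>M. R M) = 0"
    using Nn by (metis null_setsD1 emeasure_mono Nl le_zero_eq)
  moreover have "(\<lambda>M. emeasure lebesgue (R M)) \<longlonglongrightarrow> emeasure lebesgue (\<Inter>M. R M)"
  proof (rule Lim_emeasure_decseq)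
    show "decseq R"
      unfolding decseq_def
    proof (intro allI impI)
      fix m n :: nat assume "m \<le> n"
      then have "{..<m} \<times> {..<m} \<subseteq> {..<n} \<times> {..<n}" by auto
      then show "R n \<subseteq> R m" unfolding R_def by blast
    qed
    have "emeasure lebesgue (R M) \<le> emeasure lebesgue C" for M
      using Cl by (intro emeasure_mono) (auto simp: R_def)
    then show "emeasure lebesgue (R M) \<noteq> \<infinity>" for M using Cfin by (metis leD)
  qed (use Rl in auto)
  ultimately have Rlim: "(\<lambda>M. emeasure lebesgue (R M)) \<longlonglongrightarrow> 0" by simp
  obtain \<delta> k1 where \<delta>: "0 < \<delta>"
    "\<And>k R. k1 \<le> k \<Longrightarrow> R \<in> sets lebesgue \<Longrightarrow> R \<subseteq> C \<Longrightarrow> emeasure lebesgue R \<le> ennreal \<delta> \<Longrightarrow>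
        (\<integral>\<^sup>+x\<in>R. ennreal (zdensity p q (vs k) x) \<partial>lebesgue) \<le> ennreal (e / 2)"
    by (rule zdensity_uniformly_integrable[OF v vs conv p C half_gt_zero[OF e]], rule that) assumption+
  have "(0::ennreal) < ennreal (\<delta> / 2)" using \<delta>(1) by simp
  from order_tendstoD(2)[OF Rlim this] obtain M where M: "emeasure lebesgue (R M) < ennreal (\<delta> / 2)"
    by (auto simp: eventually_sequentially)
  define I where "I = {..<M} \<times> {..<M}"
  have I: "finite I" unfolding I_def by simp
  \<comment> \<open>The added 1 avoids division by zero when \<open>M = 0\<close> and
    \<open>I\<close> is empty.\<close>
  define c where "c = real (card I) + 1"
  have c: "0 < c" "real (card I) \<le> c" unfolding c_def by auto
  have "\<exists>F. closed F \<and> F \<subseteq> B \<iota> \<and> emeasure lebesgue (B \<iota> - F) \<le> ennreal (\<delta> / 2 / c)" for \<iota>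
  proof -
    have "0 < \<delta> / 2 / c" using \<delta>(1) c by simp
    from sets_lebesgue_inner_closed[OF Bl this] show ?thesis by (metis less_imp_le)
  qed
  then obtain F where F: "\<And>\<iota>. closed (F \<iota>)" "\<And>\<iota>. F \<iota> \<subseteq> B \<iota>"
    "\<And>\<iota>. emeasure lebesgue (B \<iota> - F \<iota>) \<le> ennreal (\<delta> / 2 / c)" by metis
  have FC: "F \<iota> \<subseteq> C - N" for \<iota> using F(2)[of \<iota>] unfolding B_def by auto
  have Fc: "compact (F \<iota>)" for \<iota>
  proof -
    have "F \<iota> = C \<inter> F \<iota>" using FC[of \<iota>] by blast
    then show ?thesis using compact_Int_closed[OF C F(1)] by metis
  qed
  have Fl: "F \<iota> \<in> sets lebesgue" for \<iota> using F(1) by simp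
  \<comment> \<open>\<open>\<sigma>\<close> and \<open>\<tau>\<close> are the upper ends of the
    cell: strict bounds on the cell, yet at most \<open>\<eta>\<close> above the actual values
    there.\<close>
  define \<sigma> where "\<sigma> = (\<lambda>\<iota> :: nat \<times> nat. (real (fst \<iota>) + 1) * \<eta>)"
  define \<tau> where "\<tau> = (\<lambda>\<iota> :: nat \<times> nat. (real (snd \<iota>) + 1) * \<eta>)"
  have st: "0 < \<sigma> \<iota>" "0 < \<tau> \<iota>" for \<iota> unfolding \<sigma>_def \<tau>_def using \<eta> by simp_all
  define P where "P = (\<lambda>\<iota> U k0. open U \<and> F \<iota> \<subseteq> U \<and> (\<forall>k\<ge>k0. (\<integral>\<^sup>+x\<in>U. ennreal (zdensity p q (vs k) x) \<partial>lebesgue)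
        \<le> ennreal (\<sigma> \<iota> powr p * \<tau> \<iota>) * emeasure lebesgue (F \<iota>) + ennreal (e / 2 / c)))"
  have "\<exists>U k0. P \<iota> U k0" for \<iota>
  proof -
    \<comment> \<open>Avoiding \<open>N\<close> keeps the singular part of the Monge-Ampere measure
      out, so the image of the piece has exactly the integral of the determinant as its
      measure.\<close>
    have FN: "F \<iota> \<inter> N = {}" using FC[of \<iota>] by blast
    have im: "(\<Union>x\<in>F \<iota>. subdiff v x) \<in> sets lebesgue"
      "emeasure lebesgue (\<Union>x\<in>F \<iota>. subdiff v x) = (\<integral>\<^sup>+x\<in>F \<iota>. ennreal (hess_det v x) \<partial>lebesgue)"
      using N(3)[OF Fl compact_imp_bounded[OF Fc] FN] by blast+
    have "(\<integral>\<^sup>+x\<in>F \<iota>. ennreal (hess_det v x) \<partial>lebesgue) \<le> (\<integral>\<^sup>+x. ennreal (\<sigma> \<iota>) * indicator (F \<iota>) x \<partial>lebesgue)"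
    proof (rule nn_integral_mono)
      fix x
      show "ennreal (hess_det v x) * indicator (F \<iota>) x \<le> ennreal (\<sigma> \<iota>) * indicator (F \<iota>) x"
      proof (cases "x \<in> F \<iota>")
        case True
        then have "hess_det v x \<le> \<sigma> \<iota>" using F(2)[of \<iota>] unfolding B_def a_def \<sigma>_def by auto
        then show ?thesis by (intro mult_right_mono ennreal_leI) auto
      qed simp
    qed
    then have im2: "emeasure lebesgue (\<Union>x\<in>F \<iota>. subdiff v x) \<le> ennreal (\<sigma> \<iota>) * emeasure lebesgue (F \<iota>)"
      unfolding im(2) using Fl by (simp add: nn_integral_cmult_indicator del: emeasure_completion)
    have wt: "exp (- q * v x) < \<tau> \<iota>" if "x \<in> F \<iota>" for x
      using that F(2)[of \<iota>] unfolding B_def w_def \<tau>_def by auto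
    have e': "0 < e / 2 / c" using e c by simp
    obtain U k0 where "open U" "F \<iota> \<subseteq> U"
      "\<And>k. k0 \<le> k \<Longrightarrow> (\<integral>\<^sup>+x\<in>U. ennreal (zdensity p q (vs k) x) \<partial>lebesgue)
        \<le> ennreal (\<sigma> \<iota> powr p * \<tau> \<iota>) * emeasure lebesgue (F \<iota>) + ennreal (e / 2 / c)"
      by (rule zdensity_local_upper_bound[OF vs conv p Fc im(1) st(1) im2 st(2) wt e'], assumption, rule that) assumption+
    then have "P \<iota> U k0" unfolding P_def by blast
    then show ?thesis by blast
  qed
  then obtain U \<kappa> where "\<And>\<iota>. P \<iota> (U \<iota>) (\<kappa> \<iota>)" by metis
  then have U: "\<And>\<iota>. open (U \<iota>)" "\<And>\<iota>. F \<iota> \<subseteq> U \<iota>"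
    "\<And>\<iota> k. \<kappa> \<iota> \<le> k \<Longrightarrow> (\<integral>\<^sup>+x\<in>U \<iota>. ennreal (zdensity p q (vs k) x) \<partial>lebesgue)
        \<le> ennreal (\<sigma> \<iota> powr p * \<tau> \<iota>) * emeasure lebesgue (F \<iota>) + ennreal (e / 2 / c)"
    unfolding P_def by blast+
  have Ul: "U \<iota> \<in> sets lebesgue" for \<iota> using U(1) by simp
  \<comment> \<open>The remainder is taken with respect to the open sets \<open>U \<iota>\<close>,
    because the local bounds hold on these; what is left lies in \<open>R M\<close> and the gaps
    \<open>B \<iota> - F \<iota>\<close>, of total measure at most \<open>\<delta>\<close>.\<close>
  define Q where "Q = C - (\<Union>\<iota>\<in>I. U \<iota>)"
  have Ql: "Q \<in> sets lebesgue" unfolding Q_def using Cl Ul I by auto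
  have card_le: "ennreal (t / 2) + (\<Sum>\<iota>\<in>I. ennreal (t / 2 / c)) \<le> ennreal t" if t: "0 < t" for t
  proof -
    have "(\<Sum>\<iota>\<in>I. ennreal (t / 2 / c)) = ennreal (\<Sum>\<iota>\<in>I. t / 2 / c)" using t c by (intro sum_ennreal) simp
    also have "(\<Sum>\<iota>\<in>I. t / 2 / c) = real (card I) * (t / 2 / c)" by simp
    also have "\<dots> \<le> c * (t / 2 / c)" using t c by (intro mult_right_mono) auto
    also have "\<dots> = t / 2" using c by simp
    finally have "(\<Sum>\<iota>\<in>I. ennreal (t / 2 / c)) \<le> ennreal (t / 2)" by (simp add: ennreal_leI)
    then have "ennreal (t / 2) + (\<Sum>\<iota>\<in>I. ennreal (t / 2 / c)) \<le> ennreal (t / 2) + ennreal (t / 2)"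
      by (rule add_left_mono)
    also have "\<dots> = ennreal t" using t by (simp flip: ennreal_plus)
    finally show ?thesis .
  qed
  have Qm: "emeasure lebesgue Q \<le> ennreal \<delta>"
  proof -
    have "Q \<subseteq> R M \<union> (\<Union>\<iota>\<in>I. B \<iota> - F \<iota>)" using U(2) unfolding Q_def R_def I_def by blast
    then have "emeasure lebesgue Q \<le> emeasure lebesgue (R M \<union> (\<Union>\<iota>\<in>I. B \<iota> - F \<iota>))"
      using Rl Bl Fl I by (intro emeasure_mono) auto
    also have "\<dots> \<le> emeasure lebesgue (R M) + emeasure lebesgue (\<Union>\<iota>\<in>I. B \<iota> - F \<iota>)"
      using Rl Bl Fl I by (intro emeasure_subadditive) auto
    also have "\<dots> \<le> ennreal (\<delta> / 2) + (\<Sum>\<iota>\<in>I. ennreal (\<delta> / 2 / c))"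
    proof (rule add_mono)
      have "emeasure lebesgue (\<Union>\<iota>\<in>I. B \<iota> - F \<iota>) \<le> (\<Sum>\<iota>\<in>I. emeasure lebesgue (B \<iota> - F \<iota>))"
        using Bl Fl I by (intro emeasure_subadditive_finite) auto
      also have "\<dots> \<le> (\<Sum>\<iota>\<in>I. ennreal (\<delta> / 2 / c))" by (intro sum_mono F(3))
      finally show "emeasure lebesgue (\<Union>\<iota>\<in>I. B \<iota> - F \<iota>) \<le> (\<Sum>\<iota>\<in>I. ennreal (\<delta> / 2 / c))" .
    qed (use M in simp)
    also have "\<dots> \<le> ennreal \<delta>" by (rule card_le[OF \<delta>(1)])
    finally show ?thesis .
  qed
  define G where "G = (\<lambda>x. ennreal ((a x + \<eta>) powr p * (w x + \<eta>)))"
  have Gm: "G \<in> borel_measurable lebesgue" unfolding G_def using am wm by measurable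
  have sumF: "(\<Sum>\<iota>\<in>I. ennreal (\<sigma> \<iota> powr p * \<tau> \<iota>) * emeasure lebesgue (F \<iota>)) \<le> (\<integral>\<^sup>+x\<in>C. G x \<partial>lebesgue)"
  proof -
    have "(\<Sum>\<iota>\<in>I. ennreal (\<sigma> \<iota> powr p * \<tau> \<iota>) * emeasure lebesgue (F \<iota>))
        = (\<Sum>\<iota>\<in>I. (\<integral>\<^sup>+x. ennreal (\<sigma> \<iota> powr p * \<tau> \<iota>) * indicator (F \<iota>) x \<partial>lebesgue))"
      using Fl by (simp add: nn_integral_cmult_indicator del: emeasure_completion)
    also have "\<dots> \<le> (\<Sum>\<iota>\<in>I. (\<integral>\<^sup>+x. G x * indicator (F \<iota>) x \<partial>lebesgue))"
    proof (intro sum_mono nn_integral_mono)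
      fix \<iota> x
      show "ennreal (\<sigma> \<iota> powr p * \<tau> \<iota>) * indicator (F \<iota>) x \<le> G x * indicator (F \<iota>) x"
      proof (cases "x \<in> F \<iota>")
        case True
        then have "\<sigma> \<iota> \<le> a x + \<eta>" "\<tau> \<iota> \<le> w x + \<eta>"
          using F(2)[of \<iota>] unfolding B_def \<sigma>_def \<tau>_def by (auto simp: algebra_simps)
        then have "\<sigma> \<iota> powr p * \<tau> \<iota> \<le> (a x + \<eta>) powr p * (w x + \<eta>)"
          using st[of \<iota>] p by (intro mult_mono powr_mono2) auto
        then show ?thesis unfolding G_def by (intro mult_right_mono ennreal_leI) auto
      qed simp
    qed
    also have "\<dots> = (\<integral>\<^sup>+x. (\<Sum>\<iota>\<in>I. G x * indicator (F \<iota>) x) \<partial>lebesgue)"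
    proof (rule nn_integral_sum[symmetric])
      note [measurable] = Gm Fl
      show "(\<lambda>x. G x * indicator (F \<iota>) x) \<in> borel_measurable lebesgue" for \<iota> by measurable
    qed
    also have "\<dots> \<le> (\<integral>\<^sup>+x\<in>C. G x \<partial>lebesgue)"
    proof (rule nn_integral_mono)
      fix x
      have "disjoint_family_on F I"
        unfolding disjoint_family_on_def using Bdisj F(2) by blast
      then have "(\<Sum>\<iota>\<in>I. indicator (F \<iota>) x) = (indicator (\<Union>\<iota>\<in>I. F \<iota>) x :: ennreal)"
        using indicator_UN_disjoint[OF I] by metis
      also have "\<dots> \<le> indicator C x" using FC by (auto simp: indicator_def)
      finally show "(\<Sum>\<iota>\<in>I. G x * indicator (F \<iota>) x) \<le> G x * indicator C x"
        by (simp add: sum_distrib_left[symmetric] mult_left_mono)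
    qed
    finally show ?thesis .
  qed
  have bound: "(\<integral>\<^sup>+x\<in>C. ennreal (zdensity p q (vs k) x) \<partial>lebesgue) \<le> (\<integral>\<^sup>+x\<in>C. G x \<partial>lebesgue) + ennreal e"
    if k: "k1 \<le> k" "\<forall>\<iota>\<in>I. \<kappa> \<iota> \<le> k" for k
  proof -
    define f where "f = (\<lambda>x. ennreal (zdensity p q (vs k) x))"
    have fm: "f \<in> borel_measurable lebesgue" unfolding f_def using borel_measurable_zdensity[OF vs] by measurable
    note [measurable] = fm Ql Ul
    have "(\<integral>\<^sup>+x\<in>C. f x \<partial>lebesgue) \<le> (\<integral>\<^sup>+x. f x * indicator Q x + (\<Sum>\<iota>\<in>I. f x * indicator (U \<iota>) x) \<partial>lebesgue)"
    proof (rule nn_integral_mono)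
      fix x
      consider "x \<notin> C" | "x \<in> Q" | \<iota> where "\<iota> \<in> I" "x \<in> U \<iota>" unfolding Q_def by blast
      then show "f x * indicator C x \<le> f x * indicator Q x + (\<Sum>\<iota>\<in>I. f x * indicator (U \<iota>) x)"
      proof cases
        case 2
        then have "f x * indicator C x \<le> f x * indicator Q x" by (simp add: indicator_def)
        then show ?thesis by (simp add: add_increasing2)
      next
        case 3
        have "f x * indicator C x \<le> f x * indicator (U \<iota>) x" using 3 by (simp add: indicator_def)
        also have "\<dots> \<le> (\<Sum>\<iota>\<in>I. f x * indicator (U \<iota>) x)" using 3(1) I by (intro member_le_sum) auto
        finally show ?thesis by (simp add: add_increasing)
      qed simp
    qed
    also have "\<dots> = (\<integral>\<^sup>+x\<in>Q. f x \<partial>lebesgue) + (\<integral>\<^sup>+x. (\<Sum>\<iota>\<in>I. f x * indicator (U \<iota>) x) \<partial>lebesgue)"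
      by (intro nn_integral_add) measurable
    also have "(\<integral>\<^sup>+x. (\<Sum>\<iota>\<in>I. f x * indicator (U \<iota>) x) \<partial>lebesgue) = (\<Sum>\<iota>\<in>I. (\<integral>\<^sup>+x\<in>U \<iota>. f x \<partial>lebesgue))"
      by (intro nn_integral_sum) measurable
    also have "(\<integral>\<^sup>+x\<in>Q. f x \<partial>lebesgue) + (\<Sum>\<iota>\<in>I. (\<integral>\<^sup>+x\<in>U \<iota>. f x \<partial>lebesgue))
      \<le> ennreal (e / 2) + (\<Sum>\<iota>\<in>I. ennreal (\<sigma> \<iota> powr p * \<tau> \<iota>) * emeasure lebesgue (F \<iota>) + ennreal (e / 2 / c))"
      unfolding f_def using k Ql Qm
      by (intro add_mono sum_mono U(3) \<delta>(2)) (auto simp: Q_def)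
    also have "\<dots> = (\<Sum>\<iota>\<in>I. ennreal (\<sigma> \<iota> powr p * \<tau> \<iota>) * emeasure lebesgue (F \<iota>))
        + (ennreal (e / 2) + (\<Sum>\<iota>\<in>I. ennreal (e / 2 / c)))"
      by (simp only: sum.distrib add_ac)
    also have "\<dots> \<le> (\<integral>\<^sup>+x\<in>C. G x \<partial>lebesgue) + ennreal e"
      by (intro add_mono sumF card_le e)
    finally show ?thesis unfolding f_def .
  qed
  have "\<forall>\<^sub>F k in sequentially. k1 \<le> k \<and> (\<forall>\<iota>\<in>I. \<kappa> \<iota> \<le> k)"
    using I by (intro eventually_conj eventually_ball_finite) (auto intro: eventually_ge_at_top)
  then show ?thesis
    by eventually_elim (use bound in \<open>simp add: G_def a_def w_def\<close>)
qed

text \<open>This removes the mesh from the preceding bound. As \<open>p < 1\<close>, the regularised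
  integrands are dominated by an affine function of \<open>hess_det v\<close>, whose integral over
  \<open>C\<close> is bounded through the volume of the compact subdifferential image.\<close>

lemma nn_integral_regularized_zdensity_tendsto:
  fixes v :: "real^'n \<Rightarrow> real"
  assumes v: "everywhere_subdiff v" and p: "0 < p" "p < 1" and C: "compact C"
  shows "(\<lambda>m. \<integral>\<^sup>+x\<in>C. ennreal ((hess_det v x + 1 / real (Suc m)) powr p * (exp (- q * v x) + 1 / real (Suc m))) \<partial>lebesgue)
    \<longlonglongrightarrow> (\<integral>\<^sup>+x\<in>C. ennreal (zdensity p q v x) \<partial>lebesgue)"
proof -
  obtain \<tau> where \<tau>: "0 < \<tau>" "\<And>x. x \<in> C \<Longrightarrow> exp (- q * v x) < \<tau>"
    using exp_bounded_on_compact[OF v C] by metis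
  have Cl: "C \<in> sets lebesgue" and Cfin: "emeasure lebesgue C < \<infinity>"
    using lmeasurable_compact[OF C] by (auto simp: fmeasurable_def simp del: emeasure_completion)
  note [measurable] = Cl borel_measurable_hess_det[OF v] borel_measurable_zdensity[OF v]
    continuous_borel_measurable_lebesgue[OF everywhere_subdiff_continuous[OF v]]
  define T where "T = (\<Union>x\<in>C. subdiff v x)"
  have T: "compact T" unfolding T_def by (rule compact_subdiff_image[OF v C])
  define W where "W = (\<lambda>x. ennreal (2 * (\<tau> + 1)) * indicator C x + ennreal (\<tau> + 1) * (ennreal (hess_det v x) * indicator C x))"
  define u where "u = (\<lambda>m x. ennreal ((hess_det v x + 1 / real (Suc m)) powr p * (exp (- q * v x) + 1 / real (Suc m))) * indicator C x)"
  have "(\<lambda>m. \<integral>\<^sup>+x. u m x \<partial>lebesgue) \<longlonglongrightarrow> (\<integral>\<^sup>+x. ennreal (zdensity p q v x) * indicator C x \<partial>lebesgue)"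
  proof (rule nn_integral_dominated_convergence[where w = W])
    show "u m \<in> borel_measurable lebesgue" for m unfolding u_def by measurable
    show "(\<lambda>x. ennreal (zdensity p q v x) * indicator C x) \<in> borel_measurable lebesgue" by measurable
    show "W \<in> borel_measurable lebesgue" unfolding W_def by measurable
    show "AE x in lebesgue. u m x \<le> W x" for m
      using AE_hess_det_nonneg[OF v]
    proof eventually_elim
      case (elim x)
      show ?case
      proof (cases "x \<in> C")
        case True
        define h where "h = 1 / real (Suc m)"
        have h: "0 < h" "h \<le> 1" unfolding h_def by auto
        \<comment> \<open>Adding 2 lifts the base above 1, after which the exponent may be raised
          from \<open>p\<close> to 1.\<close>
        have "(hess_det v x + h) powr p \<le> (hess_det v x + 2) powr p"
          using elim h p by (intro powr_mono2) auto
        also have "\<dots> \<le> (hess_det v x + 2) powr 1" using elim p by (intro powr_mono) auto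
        finally have "(hess_det v x + h) powr p \<le> hess_det v x + 2" using elim by simp
        moreover have "exp (- q * v x) + h \<le> \<tau> + 1" using \<tau>(2)[OF True] h by simp
        ultimately have "(hess_det v x + h) powr p * (exp (- q * v x) + h) \<le> (hess_det v x + 2) * (\<tau> + 1)"
          using elim h by (intro mult_mono) (auto intro: add_nonneg_nonneg)
        also have "\<dots> = 2 * (\<tau> + 1) + (\<tau> + 1) * hess_det v x" by (simp add: algebra_simps)
        finally have "ennreal ((hess_det v x + h) powr p * (exp (- q * v x) + h))
            \<le> ennreal (2 * (\<tau> + 1) + (\<tau> + 1) * hess_det v x)" by (rule ennreal_leI)
        also have "\<dots> = ennreal (2 * (\<tau> + 1)) + ennreal (\<tau> + 1) * ennreal (hess_det v x)"
          using elim \<tau>(1) by (subst ennreal_plus) (auto simp: ennreal_mult)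
        finally show ?thesis using True by (simp add: u_def W_def h_def)
      qed (simp add: u_def)
    qed
    show "(\<integral>\<^sup>+x. W x \<partial>lebesgue) < \<infinity>"
    proof -
      have "(\<integral>\<^sup>+x. W x \<partial>lebesgue) = ennreal (2 * (\<tau> + 1)) * emeasure lebesgue C
          + ennreal (\<tau> + 1) * (\<integral>\<^sup>+x\<in>C. ennreal (hess_det v x) \<partial>lebesgue)"
        unfolding W_def
        by (subst nn_integral_add) (simp_all add: nn_integral_cmult nn_integral_cmult_indicator del: emeasure_completion)
      also have "\<dots> \<le> ennreal (2 * (\<tau> + 1)) * emeasure lebesgue C + ennreal (\<tau> + 1) * emeasure lebesgue T"
        using T by (intro add_left_mono mult_left_mono nn_integral_hess_det_le[OF v Cl compact_imp_bounded[OF C]])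
          (auto simp: T_def intro: lmeasurable_compact fmeasurableD)
      also have "\<dots> < \<infinity>"
        using Cfin lmeasurable_compact[OF T]
        by (auto simp: ennreal_mult_less_top fmeasurable_def simp del: emeasure_completion)
      finally show ?thesis .
    qed
    show "AE x in lebesgue. (\<lambda>m. u m x) \<longlonglongrightarrow> ennreal (zdensity p q v x) * indicator C x"
      using AE_hess_det_nonneg[OF v]
    proof eventually_elim
      case (elim x)
      have h: "(\<lambda>m. 1 / real (Suc m)) \<longlonglongrightarrow> 0" by (rule LIMSEQ_Suc[OF lim_1_over_n])
      have "(\<lambda>m. (hess_det v x + 1 / real (Suc m)) powr p) \<longlonglongrightarrow> (hess_det v x + 0) powr p"
      proof (rule tendsto_powr'[OF tendsto_add[OF tendsto_const h] tendsto_const])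
        show "hess_det v x + 0 \<noteq> 0 \<or> 0 < p \<and> (\<forall>\<^sub>F m in sequentially. 0 \<le> hess_det v x + 1 / real (Suc m))"
          using p elim by (auto intro!: always_eventually add_nonneg_nonneg)
      qed
      moreover have "(\<lambda>m. exp (- q * v x) + 1 / real (Suc m)) \<longlonglongrightarrow> exp (- q * v x) + 0"
        by (intro tendsto_intros h)
      ultimately have "(\<lambda>m. (hess_det v x + 1 / real (Suc m)) powr p * (exp (- q * v x) + 1 / real (Suc m)))
          \<longlonglongrightarrow> zdensity p q v x"
        unfolding zdensity_def using tendsto_mult by fastforce
      then have "(\<lambda>m. ennreal ((hess_det v x + 1 / real (Suc m)) powr p * (exp (- q * v x) + 1 / real (Suc m))))
          \<longlonglongrightarrow> ennreal (zdensity p q v x)" by (rule tendsto_ennrealI)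
      then show ?case unfolding u_def by (cases "x \<in> C") simp_all
    qed
  qed
  then show ?thesis unfolding u_def .
qed

lemma limsup_nn_integral_zdensity_le:
  fixes v :: "real^'n \<Rightarrow> real"
  assumes v: "everywhere_subdiff v" and vs: "\<And>k. everywhere_subdiff (vs k)" and conv: "cont_converges vs v"
    and p: "0 < p" "p < 1" and C: "compact C"
  shows "limsup (\<lambda>k. \<integral>\<^sup>+x\<in>C. ennreal (zdensity p q (vs k) x) \<partial>lebesgue)
    \<le> (\<integral>\<^sup>+x\<in>C. ennreal (zdensity p q v x) \<partial>lebesgue)" (is "?L \<le> ?Z v")
proof (rule ennreal_le_epsilon)
  fix e :: real assume "0 < e"
  then have e: "0 < e / 2" by simp
  have fin: "?Z v < \<infinity>" by (rule nn_integral_zdensity_finite[OF v p C])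
  \<comment> \<open>Finiteness of the limit value makes this strict in \<open>ennreal\<close>. Half
    of \<open>e\<close> then pays for the mesh \<open>1 / real (Suc m)\<close>, and after
    \<open>m\<close> is fixed the other half pays for large \<open>k\<close>.\<close>
  then have "?Z v < ?Z v + ennreal (e / 2)" 
    using e by (cases "?Z v" rule: ennreal_cases) (auto simp: ennreal_less_iff simp flip: ennreal_plus)
  from order_tendstoD(2)[OF nn_integral_regularized_zdensity_tendsto[OF v p C] this]
  obtain m where m: "(\<integral>\<^sup>+x\<in>C. ennreal ((hess_det v x + 1 / real (Suc m)) powr p * (exp (- q * v x) + 1 / real (Suc m))) \<partial>lebesgue)
      < ?Z v + ennreal (e / 2)"
    by (auto simp: eventually_sequentially)
  have "\<forall>\<^sub>F k in sequentially. ?Z (vs k) \<le> ?Z v + ennreal e"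
    using zdensity_eventually_le[OF v vs conv p C _ e, of "1 / real (Suc m)" q, simplified]
  proof eventually_elim
    case (elim k)
    have "?Z (vs k) \<le> (?Z v + ennreal (e / 2)) + ennreal (e / 2)"
      using elim m by (simp add: add_right_mono order_trans less_imp_le)
    also have "\<dots> = ?Z v + ennreal e" using e by (simp add: add.assoc flip: ennreal_plus)
    finally show ?case .
  qed
  then show "?L \<le> ?Z v + ennreal e" by (rule Limsup_bounded)
qed

theorem theorem5p2:
  fixes v :: "real^'n \<Rightarrow> real"
  assumes "v \<in> ConvMA"
  shows "Zfun v < \<infinity> \<and>
    (\<forall>vs. (\<forall>k. vs k \<in> ConvMA) \<and> tau_star_converges vs v \<longrightarrow>
       limsup (\<lambda>k. Zfun (vs k)) \<le> Zfun v)"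
proof (intro conjI allI impI)
  have p: "0 < 1 / (real CARD('n) + 2)" "1 / (real CARD('n) + 2) < 1" by (simp_all add: add_nonneg_pos)
  have v: "everywhere_subdiff v" by (rule ConvMA_everywhere_subdiff[OF assms])
  have "compact (MA_supp v)" using assms by (simp add: ConvMA_def)
  then show "Zfun v < \<infinity>"
    using Zfun_eq_nn_integral[OF v order_refl] nn_integral_zdensity_finite[OF v p]
    by (simp add: lmeasurable_compact fmeasurableD)
  fix vs assume "(\<forall>k. vs k \<in> ConvMA) \<and> tau_star_converges vs v"
  then obtain C where vs: "\<And>k. everywhere_subdiff (vs k)" and epi: "epi_converges vs v"
    and C: "compact C" "MA_supp v \<subseteq> C" "\<And>k. MA_supp (vs k) \<subseteq> C"
    unfolding tau_star_converges_def using ConvMA_everywhere_subdiff by blast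
  have Cl: "C \<in> sets lebesgue" using C(1) by (simp add: lmeasurable_compact fmeasurableD)
  show "limsup (\<lambda>k. Zfun (vs k)) \<le> Zfun v"
    unfolding Zfun_eq_nn_integral[OF vs C(3) Cl] Zfun_eq_nn_integral[OF v C(2) Cl]
    by (rule limsup_nn_integral_zdensity_le[OF v vs epi_converges_imp_cont_converges[OF vs epi] p C(1)])
qed

end
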